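(* Let $c \in (1,\infty)$ and let $a_n := \lfloor n^c \rfloor$ for $n \geq 1$. Then for (Lebesgue) almost all $\alpha \in \mathbb{R}$ the star-discrepancy $D_N^* = D_N^*(\{a_1\alpha\}, \ldots, \{a_N\alpha\})$ of the sequence $(\{a_n \alpha\})_{n \geq 1}$ satisfies $$N D_N^* = \Omega\left(N^{\tau - \varepsilon}\right) \quad \text{for all } \varepsilon > 0,$$ where $$\tau = \begin{cases} \frac{c-1}{2} & \text{if } 1 < c < \frac32, \\ \frac14 & \text{if } \frac32 \leq c < 2, \\ \frac{7}{26} & \text{if } c \geq 2. \end{cases}$$
   Context: $\{x\}$ denotes the fractional part and $\lfloor x \rfloor$ the integer part (floor) of a real number $x$. For points $x_1, \ldots, x_N \in [0,1)$ the star-discrepancy is $D_N^*(x_1,\ldots,x_N) := \sup_{0 < \beta \leq 1} \left| \frac{A_N(\beta)}{N} - \beta \right|$, where $A_N(\beta) := \#\{1 \leq n \leq N : x_n \in [0,\beta)\}$. $f(N) = \Omega(g(N))$ means that there is a constant $c_0 > 0$ with $f(N) \geq c_0\, g(N)$ for infinitely many $N$. *)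

theory Defs
  imports "HOL-Analysis.Analysis"
begin

text \<open>Sequences are indexed from 1; the value \<open>x 0\<close> is never used.\<close>

definition count_below :: "(nat \<Rightarrow> real) \<Rightarrow> nat \<Rightarrow> real \<Rightarrow> nat" where
  "count_below x N \<beta> = card {n \<in> {1..N}. x n \<in> {0..<\<beta>}}"

definition star_discrepancy :: "(nat \<Rightarrow> real) \<Rightarrow> nat \<Rightarrow> real" where
  "star_discrepancy x N = (SUP \<beta>\<in>{0<..1}. \<bar>real (count_below x N \<beta>) / real N - \<beta>\<bar>)"

text \<open>The lower bound is required for infinitely many \<open>N\<close> only (Hardy--Littlewood), in contrast to
  the eventual lower bound expressed by \<open>\<Omega>\<close> in \<open>Landau_Symbols\<close>.\<close>

definition Omega_infinitely_often :: "(nat \<Rightarrow> real) \<Rightarrow> (nat \<Rightarrow> real) \<Rightarrow> bool" where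
  "Omega_infinitely_often f g \<longleftrightarrow> (\<exists>c\<^sub>0>0. infinite {N. f N \<ge> c\<^sub>0 * g N})"

definition floor_power :: "real \<Rightarrow> nat \<Rightarrow> int" where
  "floor_power c n = \<lfloor>real n powr c\<rfloor>"

definition tau :: "real \<Rightarrow> real" where
  "tau c = (if c < 3/2 then (c - 1) / 2 else if c < 2 then 1/4 else 7/26)"

end

theory Submission
  imports Defs "HOL-Computational_Algebra.Primes" "HOL-Real_Asymp.Real_Asymp"
begin

text \<open>
  Let \<open>S(t)\<close> be the sum of \<open>e(a\<^sub>n t)\<close> over a short block \<open>N < n \<le> N + m\<close>. Koksma's inequality, applied
  to \<open>x \<mapsto> e(p x)\<close>, bounds \<open>\<bar>S(p t)\<bar> / p\<close> by a constant times the larger of \<open>n D\<^sub>n\<close> for \<open>n = N\<close> and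
  \<open>n = N + m\<close>. The second moment \<open>m\<close> and the fourth moment \<open>E\<close> (the additive energy of the block) of \<open>S\<close>
  force a level \<open>\<lambda>\<close> such that \<open>\<lambda> \<mu>\<close> is almost \<open>m\<^bsup>3/2\<^esup> / E\<^bsup>1/2\<^esup>\<close>, where \<open>\<mu>\<close> is the measure of the set
  \<open>\<bar>S\<bar> \<ge> \<lambda>\<close>. An integer has few prime factors, so by a variance estimate almost every \<open>t\<close> has a
  prime \<open>p\<close> not much larger than \<open>1 / \<mu>\<close> for which \<open>p t\<close> lies in (a slight enlargement of) this set.
  Then \<open>\<bar>S(p t)\<bar> / p\<close> is almost as large as \<open>\<lambda> \<mu>\<close>.

  For \<open>a\<^sub>n = \<lfloor>n\<^bsup>c\<^esup>\<rfloor>\<close> the block length is of order \<open>N\<^bsup>1/2\<^esup>\<close> if \<open>c < 2\<close> and \<open>N\<^bsup>7/13\<^esup>\<close> if \<open>c \<ge> 2\<close>. Pairs of equal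
  differences \<open>a\<^bsub>x'\<^esub> - a\<^sub>x = a\<^bsub>y'\<^esub> - a\<^sub>y\<close> with equal gaps \<open>x' - x = y' - y\<close> are counted with the second derivative
  of \<open>t\<^bsup>c\<^esup>\<close>; unequal gaps are impossible in the first case, and contribute only
  \<open>O(m\<^sup>2)\<close> to \<open>E\<close> in the second.
\<close>

section \<open>Trigonometric polynomials\<close>

text \<open>The exponents come from m^(3/2) / E^(1/2). For a block of length about N^\<theta> the
  energy is, up to logarithms, at most m^2 + m N^(2 - c), the second term from equal gaps. The two
  terms lead to the exponents \<theta> / 2 and \<theta> - 1 + c / 2. At \<theta> = 1/2 these are 1/4
  and (c - 1) / 2, which cross at c = 3/2. For c >= 2 only \<theta> / 2 matters, so a longer block
  pays; it admits unequal gaps, and these have to be counted.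

  The obstacle in the dilation step is that the number of prime factors of a frequency is controlled
  only if the frequency is bounded. An indicator function has infinitely many frequencies, so it is
  replaced by a polynomial in \<bar>S\<bar>^2 whose degree is a fixed power of N. The price is a
  logarithm and the slightly enlarged level set. Primes are used because p k = p' k' with k nonzero
  leaves few choices for p' once p and k are given.

  For each N the argument works outside a set whose measure tends to 0, which is enough for
  infinitely many N.\<close>

definition ee :: "real \<Rightarrow> complex" where
  "ee t = cis (2 * pi * t)"

lemma ee_add: "ee (s + t) = ee s * ee t"
  by (simp add: ee_def cis_mult distrib_left)

lemma cnj_ee: "cnj (ee t) = ee (- t)"
  by (simp add: ee_def cis_cnj)

lemma norm_ee [simp]: "cmod (ee t) = 1"
  by (simp add: ee_def)

lemma ee_0 [simp]: "ee 0 = 1"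
  by (simp add: ee_def)

lemma ee_of_int [simp]: "ee (of_int k) = 1"
  unfolding ee_def using cis_multiple_2pi[of "of_int k"] by simp

lemma ee_frac: "ee (of_nat p * frac t) = ee (of_nat p * t)"
proof -
  have "of_nat p * t = of_nat p * frac t + of_int (int p * \<lfloor>t\<rfloor>)"
    by (simp add: frac_def algebra_simps)
  then show ?thesis
    by (metis ee_add ee_of_int mult.right_neutral)
qed

lemma ee_has_vector_derivative:
  "((\<lambda>t. ee (k * t)) has_vector_derivative (2 * pi * \<i> * k * ee (k * t))) (at t within X)"
proof -
  have "((\<lambda>t. exp (\<i> * (2 * pi * k) * of_real t)) has_vector_derivative
      (\<i> * (2 * pi * k) * exp (\<i> * (2 * pi * k) * of_real t))) (at t within X)"
    by (auto intro!: derivative_eq_intros has_vector_derivative_real_field)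
  then show ?thesis
    by (simp add: ee_def cis_conv_exp mult_ac)
qed

lemma continuous_on_ee [continuous_intros]:
  "continuous_on X f \<Longrightarrow> continuous_on X (\<lambda>t. ee (f t))"
  unfolding ee_def by (intro continuous_intros)

section \<open>Orthogonality and moments over one period\<close>

lemma has_integral_ee:
  "((\<lambda>t. ee (of_int k * t)) has_integral (if k = 0 then 1 else 0)) {a..a + 1}"
proof (cases "k = 0")
  case True
  then show ?thesis
    using has_integral_const_real[of "1::complex" a "a + 1"] by simp
next
  case False
  define F where "F = (\<lambda>t. ee (of_int k * t) / (2 * pi * \<i> * of_int k))"
  have "((\<lambda>t. ee (of_int k * t)) has_integral (F (a + 1) - F a)) {a..a + 1}"
  proof (rule fundamental_theorem_of_calculus)
    fix t assume "t \<in> {a..a + 1}"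
    have "((\<lambda>t. ee (of_int k * t) / (2 * pi * \<i> * of_int k)) has_vector_derivative
       (2 * pi * \<i> * of_int k * ee (of_int k * t)) / (2 * pi * \<i> * of_int k)) (at t within {a..a + 1})"
      using has_vector_derivative_divide[OF ee_has_vector_derivative[of "of_int k" t "{a..a+1}"],
          of "2 * pi * \<i> * of_int k"]
      by simp
    then show "(F has_vector_derivative ee (of_int k * t)) (at t within {a..a + 1})"
      using False by (simp add: F_def)
  qed auto
  moreover have "F (a + 1) = F a"
    unfolding F_def by (simp add: distrib_left ee_add)
  ultimately show ?thesis
    using False by simp
qed

text \<open>Expanding the square over pairs, only pairs of equal frequency survive integration.
  Indexing by \<open>I\<close> and not by frequencies allows \<open>k\<close> to repeat values, as
  happens for the fourth moment, where the indices are pairs and the frequencies are sums.\<close>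

lemma has_integral_norm_square_exp_sum:
  assumes "finite I"
  shows "((\<lambda>t. (cmod (\<Sum>i\<in>I. w i * ee (of_int (k i) * t)))\<^sup>2) has_integral
    (\<Sum>z\<in>{z\<in>I \<times> I. k (fst z) = k (snd z)}. Re (w (fst z) * cnj (w (snd z))))) {a..a + 1}"
proof -
  have fin: "finite (I \<times> I)" using assms by simp
  have eq: "complex_of_real ((cmod (\<Sum>i\<in>I. w i * ee (of_int (k i) * t)))\<^sup>2) =
     (\<Sum>z\<in>I \<times> I. w (fst z) * cnj (w (snd z)) * ee (of_int (k (fst z) - k (snd z)) * t))" for t
  proof -
    have "complex_of_real ((cmod (\<Sum>i\<in>I. w i * ee (of_int (k i) * t)))\<^sup>2)
        = (\<Sum>i\<in>I. w i * ee (of_int (k i) * t)) * (\<Sum>i\<in>I. cnj (w i) * ee (- of_int (k i) * t))"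
      by (simp only: complex_norm_square cnj_sum complex_cnj_mult cnj_ee) simp
    also have "\<dots> = (\<Sum>z\<in>I \<times> I. w (fst z) * ee (of_int (k (fst z)) * t) *
                        (cnj (w (snd z)) * ee (- of_int (k (snd z)) * t)))"
      by (simp add: sum_product sum.cartesian_product case_prod_unfold)
    also have "\<dots> = (\<Sum>z\<in>I \<times> I. w (fst z) * cnj (w (snd z)) * ee (of_int (k (fst z) - k (snd z)) * t))"
    proof (rule sum.cong)
      fix z
      have "ee (of_int (k (fst z) - k (snd z)) * t)
          = ee (of_int (k (fst z)) * t) * ee (- of_int (k (snd z)) * t)"
        by (subst ee_add[symmetric]) (simp add: algebra_simps)
      then show "w (fst z) * ee (of_int (k (fst z)) * t) * (cnj (w (snd z)) * ee (- of_int (k (snd z)) * t))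
        = w (fst z) * cnj (w (snd z)) * ee (of_int (k (fst z) - k (snd z)) * t)"
        by simp
    qed simp
    finally show ?thesis .
  qed
  have "((\<lambda>t. \<Sum>z\<in>I \<times> I. w (fst z) * cnj (w (snd z)) * ee (of_int (k (fst z) - k (snd z)) * t))
     has_integral (\<Sum>z\<in>I \<times> I. w (fst z) * cnj (w (snd z)) * (if k (fst z) - k (snd z) = 0 then 1 else 0)))
     {a..a + 1}"
    by (intro has_integral_sum fin has_integral_mult_right has_integral_ee)
  then have "((\<lambda>t. complex_of_real ((cmod (\<Sum>i\<in>I. w i * ee (of_int (k i) * t)))\<^sup>2)) has_integral
     (\<Sum>z\<in>I \<times> I. w (fst z) * cnj (w (snd z)) * (if k (fst z) - k (snd z) = 0 then 1 else 0))) {a..a + 1}"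
    unfolding eq .
  from has_integral_linear[OF this bounded_linear_Re]
  have "((\<lambda>t. (cmod (\<Sum>i\<in>I. w i * ee (of_int (k i) * t)))\<^sup>2) has_integral
     Re (\<Sum>z\<in>I \<times> I. w (fst z) * cnj (w (snd z)) * (if k (fst z) - k (snd z) = 0 then 1 else 0))) {a..a + 1}"
    by (simp add: o_def del: of_real_power)
  moreover have "Re (\<Sum>z\<in>I \<times> I. w (fst z) * cnj (w (snd z)) * (if k (fst z) - k (snd z) = 0 then 1 else 0))
     = (\<Sum>z\<in>{z\<in>I \<times> I. k (fst z) = k (snd z)}. Re (w (fst z) * cnj (w (snd z))))"
    unfolding Re_sum by (rule sum.mono_neutral_cong_right) (use fin in auto)
  ultimately show ?thesis by simp
qed

corollary has_integral_norm_square_trig_sum: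
  assumes "finite F"
  shows "((\<lambda>t. (cmod (\<Sum>k\<in>F. c k * ee (of_int k * t)))\<^sup>2) has_integral (\<Sum>k\<in>F. (cmod (c k))\<^sup>2)) {a..a + 1}"
proof -
  have "(\<Sum>z\<in>{z\<in>F \<times> F. fst z = snd z}. Re (c (fst z) * cnj (c (snd z)))) = (\<Sum>k\<in>F. (cmod (c k))\<^sup>2)"
    by (rule sum.reindex_bij_witness[of _ "\<lambda>k. (k, k)" fst])
       (auto simp: cmod_power2 simp flip: power2_eq_square)
  with has_integral_norm_square_exp_sum[OF assms, of c "\<lambda>k. k" a] show ?thesis by simp
qed

text \<open>Additive energy counted over indices. The quadruples are grouped as two pairs so that
  this is literally the number of pairs of equal frequency in the squared modulus of a sum over
  \<open>I \<times> I\<close>.\<close>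

definition energy :: "('i \<Rightarrow> int) \<Rightarrow> 'i set \<Rightarrow> nat" where
  "energy k I = card {z \<in> (I \<times> I) \<times> I \<times> I.
     k (fst (fst z)) + k (snd (fst z)) = k (fst (snd z)) + k (snd (snd z))}"

lemma has_integral_norm_square_unweighted:
  assumes "finite I"
  shows "((\<lambda>t. (cmod (\<Sum>i\<in>I. ee (of_int (k i) * t)))\<^sup>2) has_integral
    real (card {z\<in>I \<times> I. k (fst z) = k (snd z)})) {a..a + 1}"
  using has_integral_norm_square_exp_sum[OF assms, of "\<lambda>_. 1" k a] by simp

lemma has_integral_norm_square_inj:
  assumes "finite I" "inj_on k I"
  shows "((\<lambda>t. (cmod (\<Sum>i\<in>I. ee (of_int (k i) * t)))\<^sup>2) has_integral real (card I)) {a..a + 1}"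
proof -
  have "{z\<in>I \<times> I. k (fst z) = k (snd z)} = (\<lambda>i. (i, i)) ` I"
    using assms(2) by (force dest: inj_onD)
  then have "card {z\<in>I \<times> I. k (fst z) = k (snd z)} = card I"
    by (simp add: card_image inj_on_def)
  with has_integral_norm_square_unweighted[OF assms(1), of k a] show ?thesis by simp
qed

lemma has_integral_norm_fourth_power:
  assumes "finite I"
  shows "((\<lambda>t. (cmod (\<Sum>i\<in>I. ee (of_int (k i) * t))) ^ 4) has_integral real (energy k I)) {a..a + 1}"
proof -
  have "(\<Sum>z\<in>I \<times> I. ee (of_int (k (fst z) + k (snd z)) * t)) = (\<Sum>i\<in>I. ee (of_int (k i) * t))\<^sup>2" for t
    unfolding power2_eq_square sum_product sum.cartesian_product case_prod_unfold
    by (intro sum.cong refl) (simp add: ee_add distrib_right)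
  moreover have "(cmod ((\<Sum>i\<in>I. ee (of_int (k i) * t))\<^sup>2))\<^sup>2 = cmod (\<Sum>i\<in>I. ee (of_int (k i) * t)) ^ 4" for t
    by (simp add: norm_power)
  ultimately show ?thesis
    using has_integral_norm_square_unweighted[of "I \<times> I" "\<lambda>z. k (fst z) + k (snd z)" a] assms
    unfolding energy_def by simp
qed

text \<open>The degree bound \<open>K\<close> is carried along because it bounds the frequencies,
  and hence the number of their prime factors.\<close>

definition trig_poly :: "nat \<Rightarrow> (real \<Rightarrow> complex) \<Rightarrow> bool" where
  "trig_poly K f \<longleftrightarrow> (\<exists>c. f = (\<lambda>t. \<Sum>k\<in>{- int K..int K}. c k * ee (of_int k * t)))"

lemma trig_polyI:
  assumes fin: "finite I" and k: "\<And>i. i \<in> I \<Longrightarrow> \<bar>k i\<bar> \<le> int K"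
    and f: "\<And>t. f t = (\<Sum>i\<in>I. w i * ee (of_int (k i) * t))"
  shows "trig_poly K f"
proof -
  define c where "c j = (\<Sum>i\<in>{i\<in>I. k i = j}. w i)" for j
  have "f t = (\<Sum>j\<in>{- int K..int K}. c j * ee (of_int j * t))" for t
  proof -
    have "(\<Sum>j\<in>{- int K..int K}. c j * ee (of_int j * t))
        = (\<Sum>j\<in>{- int K..int K}. \<Sum>i\<in>{i\<in>I. k i = j}. w i * ee (of_int (k i) * t))"
      by (intro sum.cong refl) (simp add: c_def sum_distrib_right)
    also have "\<dots> = (\<Sum>i\<in>I. w i * ee (of_int (k i) * t))"
      using k by (intro sum.group fin) (auto simp: abs_le_iff minus_le_iff)
    finally show ?thesis using f by simp
  qed
  then show ?thesis unfolding trig_poly_def by blast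
qed

lemma trig_poly_const: "trig_poly K (\<lambda>_. w)"
  by (rule trig_polyI[of "{()}" "\<lambda>_. 0" _ _ "\<lambda>_. w"]) auto

lemma trig_poly_diff:
  assumes "trig_poly K f" "trig_poly K g"
  shows "trig_poly K (\<lambda>t. f t - g t)"
proof -
  obtain b c where "f = (\<lambda>t. \<Sum>k\<in>{- int K..int K}. b k * ee (of_int k * t))"
    "g = (\<lambda>t. \<Sum>k\<in>{- int K..int K}. c k * ee (of_int k * t))"
    using assms unfolding trig_poly_def by blast
  then show ?thesis
    unfolding trig_poly_def
    by (intro exI[of _ "\<lambda>k. b k - c k"]) (simp add: left_diff_distrib sum_subtractf)
qed

lemma trig_poly_mult:
  assumes "trig_poly K f" "trig_poly L g"
  shows "trig_poly (K + L) (\<lambda>t. f t * g t)"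
proof -
  obtain b c where f: "f = (\<lambda>t. \<Sum>k\<in>{- int K..int K}. b k * ee (of_int k * t))"
    and g: "g = (\<lambda>t. \<Sum>k\<in>{- int L..int L}. c k * ee (of_int k * t))"
    using assms unfolding trig_poly_def by blast
  show ?thesis
  proof (rule trig_polyI[of "{- int K..int K} \<times> {- int L..int L}" "\<lambda>z. fst z + snd z" _ _
        "\<lambda>z. b (fst z) * c (snd z)"])
    fix t
    show "f t * g t = (\<Sum>z\<in>{- int K..int K} \<times> {- int L..int L}.
        b (fst z) * c (snd z) * ee (of_int (fst z + snd z) * t))"
      unfolding f g sum_product sum.cartesian_product case_prod_unfold
      by (intro sum.cong refl) (simp add: ee_add distrib_right)
  qed auto
qed

lemma trig_poly_power:
  assumes "trig_poly K f"
  shows "trig_poly (n * K) (\<lambda>t. f t ^ n)"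
proof (induction n)
  case 0
  then show ?case using trig_poly_const[of 0 1] by simp
next
  case (Suc n)
  show ?case using trig_poly_mult[OF assms Suc.IH] by simp
qed

section \<open>Prime divisors and the number of primes\<close>

lemma prime_divisors_card_le:
  fixes n :: nat
  assumes "n > 0" "finite P" "\<And>p. p \<in> P \<Longrightarrow> prime p \<and> p dvd n"
  shows "2 ^ card P \<le> n"
proof -
  have "P \<subseteq> prime_factors n"
    using assms by (auto simp: prime_factors_dvd)
  have "(2::nat) ^ card P = (\<Prod>p\<in>P. 2)" by simp
  also have "\<dots> \<le> (\<Prod>p\<in>P. p ^ multiplicity p n)"
  proof (rule prod_mono)
    fix p assume p: "p \<in> P"
    have "multiplicity p n \<ge> 1"
      using assms p by (simp add: Suc_leI prime_multiplicity_gt_zero_iff)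
    then have "p ^ 1 \<le> p ^ multiplicity p n"
      using assms(3)[OF p] prime_gt_0_nat by (intro power_increasing) (auto simp: Suc_le_eq)
    then show "0 \<le> (2::nat) \<and> 2 \<le> p ^ multiplicity p n"
      using assms(3)[OF p] prime_ge_2_nat[of p] by simp
  qed
  also have "\<dots> dvd (\<Prod>p\<in>prime_factors n. p ^ multiplicity p n)"
    using \<open>P \<subseteq> prime_factors n\<close> by (intro prod_dvd_prod_subset) auto
  then have "(\<Prod>p\<in>P. p ^ multiplicity p n) \<le> n"
    using \<open>n > 0\<close> by (simp add: prod_prime_factors dvd_imp_le)
  finally show ?thesis .
qed

text \<open>The reciprocals are the entries of Leibniz's harmonic triangle, where each entry is the
  sum of the two below it. Written as a difference, the rule expresses column \<open>m\<close>
  through column \<open>m - 1\<close>.\<close>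

lemma leibniz_triangle:
  assumes "1 \<le> m" "m \<le> a"
  shows "1 / (real (Suc a) * real (a choose m)) =
    1 / (real a * real ((a - 1) choose (m - 1))) - 1 / (real (Suc a) * real (a choose (m - 1)))"
proof -
  obtain b j where ab: "a = Suc b" "m = Suc j" "j \<le> b"
    using assms by (metis Suc_le_D Suc_le_mono One_nat_def)
  have 1: "real (Suc j) * real (Suc b choose Suc j) = real (Suc b) * real (b choose j)"
    using Suc_times_binomial_eq[of b j] by (metis mult.commute of_nat_mult)
  have 2: "real (Suc b - j) * real (Suc b choose j) = real (Suc b) * real (b choose j)"
    using binomial_absorb_comp[of "Suc b" j] by (metis diff_Suc_1 of_nat_mult)
  have pos: "real (b choose j) > 0" "real (Suc b choose Suc j) > 0" "real (Suc b choose j) > 0"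
    using ab by (simp_all del: binomial_Suc_Suc)
  have 3: "1 / real (Suc b choose Suc j) = real (Suc j) / (real (Suc b) * real (b choose j))"
    using 1 pos by (simp add: field_simps del: binomial_Suc_Suc of_nat_Suc)
  have 4: "1 / real (Suc b choose j) = real (Suc b - j) / (real (Suc b) * real (b choose j))"
    using 2 pos ab by (simp add: field_simps del: binomial_Suc_Suc of_nat_Suc)
  have split: "1 / (x * y) = (1 / y) / x" for x y :: real by simp
  have "1 / (real (Suc a) * real (a choose m)) = (real (Suc j) / (real (Suc b) * real (b choose j))) / real (Suc a)"
    unfolding split using 3 ab by simp
  moreover have "1 / (real (Suc a) * real (a choose (m - 1)))
      = (real (Suc b - j) / (real (Suc b) * real (b choose j))) / real (Suc a)"
    unfolding split using 4 ab by simp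
  moreover have "1 / (real a * real ((a - 1) choose (m - 1))) = (real (Suc a) / (real (Suc b) * real (b choose j))) / real (Suc a)"
    using ab by simp
  moreover have "real (Suc a) = real (Suc j) + real (Suc b - j)"
    using ab by simp
  ultimately show ?thesis
    by (simp only: add_divide_distrib)
qed

text \<open>Column 0 of the triangle consists of the numbers 1 / i, whose denominators divide
  \<open>Q\<close>; the difference rule carries integrality from each column to the next.\<close>

lemma leibniz_triangle_dvd:
  assumes "\<And>i. 1 \<le> i \<Longrightarrow> i \<le> n \<Longrightarrow> i dvd Q"
  shows "j < i \<Longrightarrow> i \<le> n \<Longrightarrow> real Q / (real i * real ((i - 1) choose j)) \<in> \<int>"
proof (induction j arbitrary: i)
  case 0
  then show ?case using assms[of i] by (auto elim!: dvdE)
next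
  case (Suc j)
  obtain a where i: "i = Suc a" using Suc.prems by (cases i) auto
  have eq: "real Q / (real i * real ((i - 1) choose Suc j)) =
    real Q / (real a * real ((a - 1) choose j)) - real Q / (real i * real ((i - 1) choose j))"
    using leibniz_triangle[of "Suc j" a] Suc.prems i
    by (simp add: divide_inverse flip: right_diff_distrib)
  have "real Q / (real a * real ((a - 1) choose j)) \<in> \<int>" 
    using Suc.IH[of a] Suc.prems i by simp
  moreover have "real Q / (real i * real ((i - 1) choose j)) \<in> \<int>"
    using Suc.IH[of i] Suc.prems by simp
  ultimately show ?case unfolding eq by (rule Ints_diff)
qed

text \<open>By integrality each n * (n - 1 choose j) divides \<open>Q\<close> and is therefore at
  most \<open>Q\<close>; the average of these n numbers over j < n is 2 ^ (n - 1).\<close>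

lemma common_multiple_ge:
  assumes "\<And>i. 1 \<le> i \<Longrightarrow> i \<le> n \<Longrightarrow> i dvd Q" "Q > 0" "n > 0"
  shows "2 ^ (n - 1) \<le> Q"
proof -
  have le: "n * ((n - 1) choose j) \<le> Q" if j: "j < n" for j
  proof -
    have pos: "real n * real ((n - 1) choose j) > 0" using j by simp
    have "real Q / (real n * real ((n - 1) choose j)) \<in> \<int>"
      using leibniz_triangle_dvd[OF assms(1), where i = n and n = n and j = j] j by simp
    moreover have "real Q / (real n * real ((n - 1) choose j)) > 0"
      using pos assms by simp
    ultimately have "1 \<le> real Q / (real n * real ((n - 1) choose j))"
      by (auto elim!: Ints_cases)
    then have "real (n * ((n - 1) choose j)) \<le> real Q"
      using pos by (simp add: field_simps)
    then show ?thesis by linarith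
  qed
  have "n * 2 ^ (n - 1) = (\<Sum>j<n. n * ((n - 1) choose j))"
    using choose_row_sum[of "n - 1"] \<open>n > 0\<close>
    by (simp add: sum_distrib_left[symmetric] lessThan_Suc_atMost[symmetric])
  also have "\<dots> \<le> (\<Sum>j<n. Q)" by (intro sum_mono le) auto
  finally show ?thesis using \<open>n > 0\<close> by simp
qed

text \<open>A bound of Chebyshev type, \<pi>(n) log2 n >= n - 1. The product over p of the largest
  power of p not exceeding n is a common multiple of 1, ..., n, and each of its \<pi>(n) factors is
  at most n.\<close>

lemma prime_counting_lower_bound:
  assumes "n > 0"
  shows "2 ^ (n - 1) \<le> n ^ card {p. prime p \<and> p \<le> n}"
proof -
  define P where "P = {p. prime p \<and> p \<le> n}"
  have fin: "finite P" unfolding P_def by (rule finite_subset[of _ "{..n}"]) auto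
  define f where "f p = (GREATEST e. p ^ e \<le> n)" for p
  have f: "p ^ e \<le> n \<Longrightarrow> e \<le> f p" "p ^ f p \<le> n" if p: "p \<in> P" for p e
  proof -
    have p2: "p \<ge> 2" using p prime_ge_2_nat by (auto simp: P_def)
    have bound: "\<And>e. p ^ e \<le> n \<Longrightarrow> e \<le> n"
    proof -
      fix e assume "p ^ e \<le> n"
      moreover have "e < 2 ^ e" by (rule less_exp)
      moreover have "2 ^ e \<le> p ^ e" using p2 by (rule power_mono) simp
      ultimately show "e \<le> n" by linarith
    qed
    show "p ^ e \<le> n \<Longrightarrow> e \<le> f p"
      unfolding f_def by (rule Greatest_le_nat[of _ _ n]) (auto intro: bound)
    show "p ^ f p \<le> n"
      unfolding f_def by (rule GreatestI_nat[of "\<lambda>e. p ^ e \<le> n" 0 n]) (use assms bound in auto)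
  qed
  define Q where "Q = (\<Prod>p\<in>P. p ^ f p)"
  have "i dvd Q" if i: "1 \<le> i" "i \<le> n" for i
  proof -
    have sub: "prime_factors i \<subseteq> P"
      using i by (auto simp: P_def prime_factors_dvd dest!: dvd_imp_le)
    have "i = (\<Prod>p\<in>prime_factors i. p ^ multiplicity p i)"
      using i by (simp add: prod_prime_factors)
    also have "\<dots> dvd (\<Prod>p\<in>prime_factors i. p ^ f p)"
    proof (rule prod_dvd_prod, rule le_imp_power_dvd)
      fix p assume p: "p \<in> prime_factors i"
      have "p ^ multiplicity p i \<le> i"
        using i by (intro dvd_imp_le multiplicity_dvd) auto
      then show "multiplicity p i \<le> f p"
        using f(1)[of p] p sub i by auto
    qed
    also have "\<dots> dvd Q"
      unfolding Q_def by (rule prod_dvd_prod_subset[OF fin sub])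
    finally show ?thesis .
  qed
  moreover have "Q > 0"
    unfolding Q_def using prime_gt_0_nat by (intro prod_pos) (auto simp: P_def)
  ultimately have "2 ^ (n - 1) \<le> Q" using assms by (rule common_multiple_ge)
  also have "Q \<le> (\<Prod>p\<in>P. n)"
    unfolding Q_def by (rule prod_mono) (use f(2) in auto)
  also have "\<dots> = n ^ card P" by simp
  finally show ?thesis unfolding P_def .
qed

section \<open>Averages over prime dilations\<close>

text \<open>The integral is a sum over coincidences p k = p' k'. Given (p, k), the prime p' divides
  the nonzero number p k of size at most H K, so it has at most log2 (H K) values, and it determines
  k'. Up to this logarithm the dilates behave like orthogonal functions. Frequency 0 is left out
  because it would make all pairs of primes coincide.\<close>

lemma variance_prime_dilations:
  fixes P :: "nat set" and c :: "int \<Rightarrow> complex" and H K :: nat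
  assumes fin: "finite P" and P: "\<And>p. p \<in> P \<Longrightarrow> prime p \<and> p \<le> H" and "K \<ge> 1" "H \<ge> 1"
  defines "F \<equiv> {- int K..int K} - {0}"
  obtains v where
    "((\<lambda>t. (cmod (\<Sum>p\<in>P. \<Sum>k\<in>F. c k * ee (of_int k * (of_nat p * t))))\<^sup>2) has_integral v) {a..a + 1}"
    "v \<le> card P * log 2 (H * K) * (\<Sum>k\<in>F. (cmod (c k))\<^sup>2)"
proof -
  let ?I = "P \<times> F"
  define \<phi> where "\<phi> z = int (fst z) * snd z" for z :: "nat \<times> int"
  define w where "w z = c (snd z)" for z :: "nat \<times> int"
  define Z where "Z = {z\<in>?I \<times> ?I. \<phi> (fst z) = \<phi> (snd z)}"
  have finI: "finite ?I" using fin by (simp add: F_def)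
  have finZ: "finite Z" unfolding Z_def using finI by simp
  have eq: "(\<Sum>p\<in>P. \<Sum>k\<in>F. c k * ee (of_int k * (of_nat p * t))) = (\<Sum>z\<in>?I. w z * ee (of_int (\<phi> z) * t))" for t
    unfolding sum.cartesian_product by (intro sum.cong) (auto simp: w_def \<phi>_def mult_ac)
  have "((\<lambda>t. (cmod (\<Sum>p\<in>P. \<Sum>k\<in>F. c k * ee (of_int k * (of_nat p * t))))\<^sup>2) has_integral
      (\<Sum>z\<in>Z. Re (w (fst z) * cnj (w (snd z))))) {a..a + 1}"
    unfolding eq Z_def by (rule has_integral_norm_square_exp_sum[OF finI])
  moreover have "(\<Sum>z\<in>Z. Re (w (fst z) * cnj (w (snd z)))) \<le> card P * log 2 (H * K) * (\<Sum>k\<in>F. (cmod (c k))\<^sup>2)"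
  proof -
    \<comment> \<open>Bounding each product by two squares reduces the sum to counting, for every
      pair (p, k), its partners.\<close>
    have amgm: "Re (u * cnj v) \<le> ((cmod u)\<^sup>2 + (cmod v)\<^sup>2) / 2" for u v
    proof -
      have "Re (u * cnj v) \<le> cmod u * cmod v"
        using complex_Re_le_cmod[of "u * cnj v"] by (simp add: norm_mult)
      also have "\<dots> \<le> ((cmod u)\<^sup>2 + (cmod v)\<^sup>2) / 2"
        using sum_squares_bound[of "cmod u" "cmod v"] by simp
      finally show ?thesis .
    qed
    have "(\<Sum>z\<in>Z. Re (w (fst z) * cnj (w (snd z)))) \<le> (\<Sum>z\<in>Z. ((cmod (w (fst z)))\<^sup>2 + (cmod (w (snd z)))\<^sup>2) / 2)"
      by (intro sum_mono amgm)
    also have "\<dots> = (\<Sum>z\<in>Z. (cmod (w (fst z)))\<^sup>2) / 2 + (\<Sum>z\<in>Z. (cmod (w (snd z)))\<^sup>2) / 2"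
      by (simp add: sum_divide_distrib add_divide_distrib sum.distrib)
    also have "(\<Sum>z\<in>Z. (cmod (w (snd z)))\<^sup>2) = (\<Sum>z\<in>Z. (cmod (w (fst z)))\<^sup>2)"
      by (rule sum.reindex_bij_witness[of _ prod.swap prod.swap]) (auto simp: Z_def)
    also have "(\<Sum>z\<in>Z. (cmod (w (fst z)))\<^sup>2) / 2 + (\<Sum>z\<in>Z. (cmod (w (fst z)))\<^sup>2) / 2 = (\<Sum>z\<in>Z. (cmod (w (fst z)))\<^sup>2)"
      by simp
    also have "\<dots> = (\<Sum>y\<in>?I. \<Sum>z\<in>{z\<in>Z. fst z = y}. (cmod (w (fst z)))\<^sup>2)"
      by (rule sum.group[symmetric]) (use finI finZ in \<open>auto simp: Z_def\<close>)
    also have "\<dots> \<le> (\<Sum>y\<in>?I. log 2 (H * K) * (cmod (w y))\<^sup>2)"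
    proof (rule sum_mono)
      fix y assume y: "y \<in> ?I"
      define n where "n = nat \<bar>\<phi> y\<bar>"
      have ynz: "snd y \<noteq> 0" "\<bar>snd y\<bar> \<le> int K" "prime (fst y)" "fst y \<le> H"
        using y P by (auto simp: F_def)
      have "n > 0" 
        using ynz prime_gt_0_nat[of "fst y"] by (simp add: n_def \<phi>_def)
      have "\<bar>\<phi> y\<bar> \<le> int H * int K"
        unfolding \<phi>_def abs_mult using ynz by (intro mult_mono) auto
      then have "n \<le> H * K" unfolding n_def
        by (metis nat_le_iff of_nat_mult)
      define R where "R = {p\<in>P. p dvd n}"
      have "finite R" using fin by (simp add: R_def)
      have "2 ^ card R \<le> n"
        by (rule prime_divisors_card_le) (use \<open>n > 0\<close> fin P in \<open>auto simp: R_def\<close>)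
      then have "2 ^ card R \<le> H * K" using \<open>n \<le> H * K\<close> by linarith
      then have "real (card R) \<le> log 2 (H * K)"
        using le_log2_of_power[of "card R" "H * K"] by simp
      moreover have "card {z\<in>Z. fst z = y} \<le> card R"
      proof (rule card_inj_on_le[of "\<lambda>z. fst (snd z)"])
        have key: "fst (snd z) \<in> P \<and> snd (snd z) \<noteq> 0 \<and> int (fst (snd z)) * snd (snd z) = \<phi> y"
          if "z \<in> {z\<in>Z. fst z = y}" for z
          using that by (auto simp: Z_def F_def \<phi>_def)
        show "inj_on (\<lambda>z. fst (snd z)) {z\<in>Z. fst z = y}"
        proof (rule inj_onI)
          fix z z' assume z: "z \<in> {z\<in>Z. fst z = y}" and z': "z' \<in> {z\<in>Z. fst z = y}"
            and e: "fst (snd z) = fst (snd z')"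
          have "int (fst (snd z)) \<noteq> 0" using key[OF z] P prime_gt_0_nat by fastforce
          then have "snd (snd z) = snd (snd z')"
            using key[OF z] key[OF z'] e by (metis mult_left_cancel)
          then show "z = z'" using e z z' by (simp add: prod_eq_iff)
        qed
        show "(\<lambda>z. fst (snd z)) ` {z\<in>Z. fst z = y} \<subseteq> R"
        proof (rule image_subsetI)
          fix z assume z: "z \<in> {z\<in>Z. fst z = y}"
          from key[OF z] have "int (fst (snd z)) dvd \<phi> y" by (metis dvd_triv_left)
          then have "fst (snd z) dvd n" unfolding n_def by (simp add: int_dvd_int_iff[symmetric])
          then show "fst (snd z) \<in> R" using key[OF z] by (simp add: R_def)
        qed
      qed fact
      ultimately have "real (card {z\<in>Z. fst z = y}) \<le> log 2 (H * K)" by linarith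
      moreover have "(\<Sum>z\<in>{z\<in>Z. fst z = y}. (cmod (w (fst z)))\<^sup>2) = real (card {z\<in>Z. fst z = y}) * (cmod (w y))\<^sup>2"
        by (subst sum.cong[OF refl, where h = "\<lambda>_. (cmod (w y))\<^sup>2"]) auto
      ultimately show "(\<Sum>z\<in>{z\<in>Z. fst z = y}. (cmod (w (fst z)))\<^sup>2) \<le> log 2 (H * K) * (cmod (w y))\<^sup>2"
        by (simp add: mult_right_mono)
    qed
    also have "\<dots> = log 2 (H * K) * (\<Sum>y\<in>?I. (cmod (w y))\<^sup>2)"
      by (simp add: sum_distrib_left)
    also have "(\<Sum>y\<in>?I. (cmod (w y))\<^sup>2) = (\<Sum>p\<in>P. \<Sum>k\<in>F. (cmod (c k))\<^sup>2)"
      unfolding sum.cartesian_product by (intro sum.cong) (auto simp: w_def)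
    finally show ?thesis by (simp add: mult_ac)
  qed
  ultimately show ?thesis by (rule that)
qed

section \<open>Large values of exponential sums at multiples of a point\<close>

text \<open>The mean of a real function is real, so coefficient 0 is a real \<mu>, the same on every
  period; the last conclusion is Parseval's identity.\<close>

lemma trig_poly_mean:
  assumes "trig_poly K (\<lambda>t. complex_of_real (f t))"
  obtains c \<mu> where "\<And>t. complex_of_real (f t) = (\<Sum>k\<in>{- int K..int K}. c k * ee (of_int k * t))"
    "c 0 = of_real \<mu>" "\<And>a. (f has_integral \<mu>) {a..a + 1}"
    "\<And>a. ((\<lambda>t. (f t)\<^sup>2) has_integral (\<Sum>k\<in>{- int K..int K}. (cmod (c k))\<^sup>2)) {a..a + 1}"
proof -
  obtain c where "(\<lambda>t. complex_of_real (f t)) = (\<lambda>t. \<Sum>k\<in>{- int K..int K}. c k * ee (of_int k * t))"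
    using assms unfolding trig_poly_def by blast
  then have c: "complex_of_real (f t) = (\<Sum>k\<in>{- int K..int K}. c k * ee (of_int k * t))" for t
    by meson
  have int: "((\<lambda>t. complex_of_real (f t)) has_integral c 0) {a..a + 1}" for a
  proof -
    have "((\<lambda>t. \<Sum>k\<in>{- int K..int K}. c k * ee (of_int k * t)) has_integral
       (\<Sum>k\<in>{- int K..int K}. c k * (if k = 0 then 1 else 0))) {a..a + 1}"
      by (intro has_integral_sum has_integral_mult_right has_integral_ee) auto
    moreover have "(\<Sum>k\<in>{- int K..int K}. c k * (if k = 0 then 1 else 0)) = c 0"
      by (subst sum.remove[of _ 0]) auto
    ultimately show ?thesis by (simp add: c)
  qed
  have re: "(f has_integral Re (c 0)) {a..a + 1}" for a
    using has_integral_linear[OF int[of a] bounded_linear_Re] by (simp add: o_def)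
  have "((\<lambda>t. Im (complex_of_real (f t))) has_integral Im (c 0)) {0..0 + 1}"
    using has_integral_linear[OF int[of 0] bounded_linear_Im] by (simp add: o_def)
  then have "Im (c 0) = 0"
    using has_integral_unique by fastforce
  then have "c 0 = of_real (Re (c 0))" by (simp add: complex_eq_iff)
  moreover have "((\<lambda>t. (f t)\<^sup>2) has_integral (\<Sum>k\<in>{- int K..int K}. (cmod (c k))\<^sup>2)) {a..a + 1}" for a
    using has_integral_norm_square_trig_sum[of "{- int K..int K}" c a] by (simp flip: c)
  ultimately show ?thesis using that c re by blast
qed

section \<open>Polynomial approximation of a level set\<close>

text \<open>The polynomial \<open>1 - (1 - x) ^ n\<close> jumps from \<open>0\<close> to \<open>1\<close> near \<open>x = 1 / n\<close>, but decays only
  linearly at \<open>0\<close>; the outer power makes it negligible for \<open>x\<close> slightly below the threshold.\<close>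

definition threshold :: "nat \<Rightarrow> nat \<Rightarrow> real \<Rightarrow> real" where
  "threshold n r x = (1 - (1 - x) ^ n) ^ r"

text \<open>The last bound is Bernoulli's inequality. It makes the value tiny as soon as x is below
  1 / n by a factor that, raised to the power \<open>r\<close>, is large.\<close>

lemma threshold_bounds:
  assumes "0 \<le> x" "x \<le> 1"
  shows "0 \<le> threshold n r x" "threshold n r x \<le> 1" "threshold n r x \<le> (real n * x) ^ r"
proof -
  have *: "0 \<le> 1 - (1 - x) ^ n" "1 - (1 - x) ^ n \<le> 1"
    using assms by (simp_all add: power_le_one)
  show "0 \<le> threshold n r x" "threshold n r x \<le> 1"
    unfolding threshold_def using * by (simp_all add: power_le_one)
  have "1 + real n * (- x) \<le> (1 + (- x)) ^ n"
    by (rule Bernoulli_inequality) (use assms in simp)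
  then have "1 - (1 - x) ^ n \<le> real n * x" by simp
  then show "threshold n r x \<le> (real n * x) ^ r"
    unfolding threshold_def using * by (intro power_mono) auto
qed

text \<open>Past the threshold (1 - x)^n <= exp (- n x) <= 1 / (2 r), and by Bernoulli's inequality
  the outer power loses at most r / (2 r); hence the factor 2 in the hypothesis.\<close>

lemma threshold_ge_half:
  assumes "0 \<le> x" "x \<le> 1" "real n * x \<ge> 2 * real r"
  shows "threshold n r x \<ge> 1 / 2"
proof (cases "r = 0")
  case False
  have "(1 - x) ^ n \<le> exp (- x) ^ n"
    using exp_ge_add_one_self[of "- x"] assms by (intro power_mono) auto
  also have "\<dots> = 1 / exp (real n * x)"
    by (simp add: exp_of_nat_mult[symmetric] exp_minus field_simps)
  also have "\<dots> \<le> 1 / (2 * real r)"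
  proof (intro divide_left_mono mult_pos_pos)
    show "2 * real r \<le> exp (real n * x)"
      using exp_ge_add_one_self[of "real n * x"] assms(3) by linarith
  qed (use False in auto)
  finally have y: "(1 - x) ^ n \<le> 1 / (2 * real r)" .
  have "1 / 2 \<le> 1 + real r * (- ((1 - x) ^ n))"
    using mult_left_mono[OF y, of "real r"] False by (simp add: field_simps)
  also have "\<dots> \<le> (1 + (- ((1 - x) ^ n))) ^ r"
    by (rule Bernoulli_inequality) (use assms in \<open>simp add: power_le_one\<close>)
  finally show ?thesis by (simp add: threshold_def)
qed (simp add: threshold_def)

lemma trig_poly_exp_sum:
  assumes "finite I" "\<And>i. i \<in> I \<Longrightarrow> \<bar>k i\<bar> \<le> int A"
  shows "trig_poly A (\<lambda>t. \<Sum>i\<in>I. ee (of_int (k i) * t))"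
  using assms by (intro trig_polyI[of I k A _ "\<lambda>_. 1"]) auto

text \<open>The squared modulus is the sum times its conjugate, of degree at most 2 A, and
  \<open>threshold n r\<close> is a polynomial of degree n r in it.\<close>

lemma trig_poly_threshold:
  assumes "finite I" "\<And>i. i \<in> I \<Longrightarrow> \<bar>k i\<bar> \<le> int A"
  shows "trig_poly (r * (n * (2 * A)))
    (\<lambda>t. complex_of_real (threshold n r ((cmod (\<Sum>i\<in>I. ee (of_int (k i) * t)))\<^sup>2 / w)))"
proof -
  let ?S = "\<lambda>t. \<Sum>i\<in>I. ee (of_int (k i) * t)"
  let ?S' = "\<lambda>t. \<Sum>i\<in>I. ee (of_int (- k i) * t)"
  have S': "cnj (?S t) = ?S' t" for t by (simp add: cnj_ee)
  have "trig_poly (A + A) (\<lambda>t. ?S t * ?S' t)"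
    by (intro trig_poly_mult trig_poly_exp_sum) (use assms in auto)
  then have "trig_poly (2 * A) (\<lambda>t. of_real (1 / w) * (?S t * ?S' t))"
    using trig_poly_mult[OF trig_poly_const[of 0 "of_real (1 / w)"]] by (simp add: mult_2)
  then have "trig_poly (n * (2 * A)) (\<lambda>t. (1 - of_real (1 / w) * (?S t * ?S' t)) ^ n)"
    by (rule trig_poly_power[OF trig_poly_diff[OF trig_poly_const]])
  then have "trig_poly (r * (n * (2 * A))) (\<lambda>t. (1 - (1 - of_real (1 / w) * (?S t * ?S' t)) ^ n) ^ r)"
    by (rule trig_poly_power[OF trig_poly_diff[OF trig_poly_const]])
  moreover have "(1 - (1 - of_real (1 / w) * (?S t * ?S' t)) ^ n) ^ r
      = complex_of_real (threshold n r ((cmod (?S t))\<^sup>2 / w))" for t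
    unfolding S'[symmetric] complex_norm_square[symmetric] threshold_def by simp
  ultimately show ?thesis by simp
qed

text \<open>Chebyshev's inequality. On \<open>B\<close> the sum over \<open>P\<close> of f (p t) -
  \<mu> is at most - card P * \<mu> / 2, while its square has integral at most card P * log2 (H K) *
  \<mu>. The quotient is small once card P exceeds 1 / \<mu> by more than a logarithm.\<close>

lemma small_on_prime_dilations_measure:
  fixes P :: "nat set" and H K :: nat and \<mu> \<eta> :: real
  assumes trig: "trig_poly K (\<lambda>t. complex_of_real (f t))"
    and f: "\<And>t. 0 \<le> f t" "\<And>t. f t \<le> 1" and mean: "(f has_integral \<mu>) {a..a + 1}"
    and P: "finite P" "\<And>p. p \<in> P \<Longrightarrow> prime p \<and> p \<le> H" "P \<noteq> {}" and HK: "K \<ge> 1" "H \<ge> 1"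
    and "\<mu> > 0" "\<eta> \<le> \<mu> / 2"
  defines "B \<equiv> {t\<in>{a..a + 1}. \<forall>p\<in>P. f (of_nat p * t) \<le> \<eta>}"
  shows "B \<in> lmeasurable" "measure lebesgue B \<le> 4 * log 2 (H * K) / (card P * \<mu>)"
proof -
  obtain c \<mu>' where c: "\<And>t. complex_of_real (f t) = (\<Sum>k\<in>{- int K..int K}. c k * ee (of_int k * t))"
    and c0: "c 0 = of_real \<mu>'" and \<mu>': "\<And>a. (f has_integral \<mu>') {a..a + 1}"
    and sq: "\<And>a. ((\<lambda>t. (f t)\<^sup>2) has_integral (\<Sum>k\<in>{- int K..int K}. (cmod (c k))\<^sup>2)) {a..a + 1}"
  proof (rule trig_poly_mean[OF trig])
  qed (rule that)
  have \<mu>_eq: "\<mu>' = \<mu>" using mean \<mu>' has_integral_unique by blast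
  have cont: "continuous_on UNIV (\<lambda>t. f (of_nat p * t))" for p
  proof -
    have "continuous_on UNIV (\<lambda>t. Re (\<Sum>k\<in>{- int K..int K}. c k * ee (of_int k * (of_nat p * t))))"
      by (intro continuous_intros)
    then show ?thesis by (simp flip: c)
  qed
  have "B = {a..a + 1} \<inter> (\<Inter>p\<in>P. {t. f (of_nat p * t) \<le> \<eta>})"
    by (auto simp: B_def)
  moreover have "closed {t. f (of_nat p * t) \<le> \<eta>}" for p
    by (rule closed_Collect_le[OF cont continuous_on_const])
  ultimately have "compact B"
    by (auto intro!: compact_Int_closed)
  then show B: "B \<in> lmeasurable" by (rule lmeasurable_compact)
  define F where "F = {- int K..int K} - {0}"
  obtain v where v: "((\<lambda>t. (cmod (\<Sum>p\<in>P. \<Sum>k\<in>F. c k * ee (of_int k * (of_nat p * t))))\<^sup>2) has_integral v) {a..a + 1}"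
    and vle: "v \<le> card P * log 2 (H * K) * (\<Sum>k\<in>F. (cmod (c k))\<^sup>2)"
    by (rule variance_prime_dilations[OF P(1,2) HK, where c = c and a = a, folded F_def])
  have "(\<Sum>k\<in>F. (cmod (c k))\<^sup>2) \<le> (\<Sum>k\<in>{- int K..int K}. (cmod (c k))\<^sup>2)"
    unfolding F_def by (rule sum_mono2) auto
  \<comment> \<open>As 0 <= f <= 1, the square of f is at most f. So the sum of the squared
    coefficients is bounded by \<mu> itself; a bound by 1 would cost a factor 1 / \<mu>.\<close>
  also have "\<dots> \<le> \<mu>"
    by (rule has_integral_le[OF sq mean]) (use f in \<open>auto simp: power2_eq_square mult_left_le\<close>)
  finally have "(\<Sum>k\<in>F. (cmod (c k))\<^sup>2) \<le> \<mu>" .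
  moreover have "log 2 (H * K) \<ge> 0"
    using HK mult_mono[of 1 "real H" 1 "real K"] by (simp add: zero_le_log_cancel_iff)
  ultimately have vle: "v \<le> card P * log 2 (H * K) * \<mu>"
    using vle by (meson mult_left_mono mult_nonneg_nonneg of_nat_0_le_iff order_trans)
  define W where "W = card P * \<mu> / 2"
  have cP: "card P > 0" using P by (simp add: card_gt_0_iff)
  have "W > 0" unfolding W_def using cP \<open>\<mu> > 0\<close> by simp
  have large: "W\<^sup>2 \<le> (cmod (\<Sum>p\<in>P. \<Sum>k\<in>F. c k * ee (of_int k * (of_nat p * t))))\<^sup>2" if "t \<in> B" for t
  proof -
    have "(\<Sum>k\<in>F. c k * ee (of_int k * (of_nat p * t))) = of_real (f (of_nat p * t) - \<mu>)" for p
      unfolding F_def using c[of "of_nat p * t"] c0 \<mu>_eq by (subst (asm) sum.remove[of _ 0]) auto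
    then have eq: "(\<Sum>p\<in>P. \<Sum>k\<in>F. c k * ee (of_int k * (of_nat p * t))) = of_real (\<Sum>p\<in>P. f (of_nat p * t) - \<mu>)"
      by simp
    have "(\<Sum>p\<in>P. f (of_nat p * t) - \<mu>) \<le> (\<Sum>p\<in>P. - \<mu> / 2)"
      using that \<open>\<eta> \<le> \<mu> / 2\<close> by (intro sum_mono) (force simp: B_def)
    then have "(\<Sum>p\<in>P. f (of_nat p * t) - \<mu>) \<le> - W" by (simp add: W_def)
    then have "W \<le> \<bar>\<Sum>p\<in>P. f (of_nat p * t) - \<mu>\<bar>" by linarith
    then show ?thesis
      unfolding eq norm_of_real using \<open>W > 0\<close> by (intro power_mono) auto
  qed
  have "((\<lambda>t. W\<^sup>2 * indicator B t) has_integral (W\<^sup>2 * measure lebesgue B)) UNIV"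
    using B by (intro has_integral_mult_right) (simp add: lmeasurable_iff_has_integral)
  moreover have "((\<lambda>t. if t \<in> {a..a+1} then (cmod (\<Sum>p\<in>P. \<Sum>k\<in>F. c k * ee (of_int k * (of_nat p * t))))\<^sup>2 else 0)
     has_integral v) UNIV"
    using v by (simp only: has_integral_restrict_UNIV)
  ultimately have "W\<^sup>2 * measure lebesgue B \<le> v"
  proof (rule has_integral_le)
    fix t
    show "W\<^sup>2 * indicator B t \<le> (if t \<in> {a..a+1} then (cmod (\<Sum>p\<in>P. \<Sum>k\<in>F. c k * ee (of_int k * (of_nat p * t))))\<^sup>2 else 0)"
      using large[of t] by (cases "t \<in> B") (auto simp: B_def)
  qed
  also have "v \<le> W\<^sup>2 * (4 * log 2 (H * K) / (card P * \<mu>))"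
  proof -
    have "W\<^sup>2 * (4 * log 2 (H * K) / (card P * \<mu>)) = card P * log 2 (H * K) * \<mu>"
      using cP \<open>\<mu> > 0\<close> by (simp add: W_def power2_eq_square field_simps)
    then show ?thesis using vle by simp
  qed
  finally show "measure lebesgue B \<le> 4 * log 2 (H * K) / (card P * \<mu>)"
    by (rule mult_left_le_imp_le) (use \<open>W > 0\<close> in simp)
qed

text \<open>Take \<open>T\<close> about sqrt (2 E / m). By the fourth moment, values of
  \<bar>S\<bar> above \<open>T\<close> carry at most half of the second moment, so the mean of
  \<bar>S\<bar> is at least m / (2 T). Splitting \<bar>S\<bar> / m at the levels 2^(-j) and choosing
  the best of \<open>J\<close> levels gives 2^(-j) \<mu> >= 1 / (16 T J). Here \<mu> is the mean of
  a smoothed indicator; the factor 2 * r * 4 ^ j places its threshold at x = 4^(-j).\<close>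

lemma energy_dyadic_level:
  fixes T :: real
  assumes fin: "finite I" and "I \<noteq> {}" and inj: "inj_on k I" and T: "T > 0"
    and E: "2 * energy k I \<le> T\<^sup>2 * card I" and J: "4 * T \<le> 2 ^ J" "J \<ge> 1"
  defines "x \<equiv> \<lambda>t. (cmod (\<Sum>i\<in>I. ee (of_int (k i) * t)))\<^sup>2 / (real (card I))\<^sup>2"
  obtains j \<mu> where "1 \<le> j" "j \<le> J" "\<And>a. ((\<lambda>t. threshold (2 * r * 4 ^ j) r (x t)) has_integral \<mu>) {a..a + 1}"
    "\<mu> \<ge> 2 ^ j / (16 * T * J)"
proof -
  define M where "M = real (card I)"
  have M: "M > 0" unfolding M_def using fin \<open>I \<noteq> {}\<close> by (simp add: card_gt_0_iff)
  define y where "y t = cmod (\<Sum>i\<in>I. ee (of_int (k i) * t))" for t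
  have y0: "y t \<ge> 0" for t by (simp add: y_def)
  have "y t \<le> M" for t
    unfolding y_def M_def using norm_sum[of "\<lambda>i. ee (of_int (k i) * t)" I] by simp
  then have x01: "0 \<le> x t" "x t \<le> 1" for t
    using y0[of t] M by (auto simp: x_def y_def M_def power_mono divide_simps)
  have yx: "y t = M * sqrt (x t)" for t
    using M by (simp add: x_def y_def M_def real_sqrt_divide)
  define g where "g j t = threshold (2 * r * 4 ^ j) r (x t)" for j t
  have g0: "g j t \<ge> 0" for j t unfolding g_def using threshold_bounds x01 by simp
  have "\<exists>\<mu>. \<forall>a. (g j has_integral \<mu>) {a..a + 1}" for j
  proof -
    define A where "A = (\<Sum>i\<in>I. nat \<bar>k i\<bar>)"
    have "\<bar>k i\<bar> \<le> int A" if "i \<in> I" for i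
      using member_le_sum[of i I "\<lambda>i. nat \<bar>k i\<bar>"] that fin by (simp add: A_def nat_le_iff)
    then have "trig_poly (r * (2 * r * 4 ^ j * (2 * A))) (\<lambda>t. complex_of_real (g j t))"
      unfolding g_def x_def by (rule trig_poly_threshold[OF fin])
    then show ?thesis by (rule trig_poly_mean) blast
  qed
  then obtain \<mu> where \<mu>: "\<And>j a. (g j has_integral \<mu> j) {a..a + 1}" by metis
  \<comment> \<open>If 4^(-j) < x <= 4^(-(j - 1)) then sqrt x <= 2 / 2^j. The factor 4 in place of 2
    compensates for the smoothed indicator being only known to be at least 1/2 there.\<close>
  have sqrt_le: "sqrt (x t) \<le> 1 / 2 ^ J + (\<Sum>j=1..J. 4 / 2 ^ j * g j t)" for t
  proof (cases "x t \<le> 1 / 4 ^ J")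
    case True
    then have "sqrt (x t) \<le> sqrt (1 / 4 ^ J)" by simp
    also have "\<dots> = 1 / 2 ^ J"
      by (simp add: real_sqrt_divide real_sqrt_power)
    finally show ?thesis using sum_nonneg[of "{1..J}" "\<lambda>j. 4 / 2 ^ j * g j t"] g0 by force
  next
    case False
    define j where "j = (LEAST j. 1 / 4 ^ j < x t)"
    have j: "1 / 4 ^ j < x t" "j \<le> J"
      unfolding j_def using False by (auto intro: LeastI[of _ J] Least_le)
    then have "j \<noteq> 0" using x01[of t] by (auto simp: not_less intro!: gr0I)
    then obtain i where i: "j = Suc i" by (cases j) auto
    then have "\<not> 1 / 4 ^ i < x t" unfolding j_def using not_less_Least[of i "\<lambda>j. 1 / 4 ^ j < x t"] j_def by simp
    then have "sqrt (x t) \<le> sqrt (1 / 4 ^ i)" by simp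
    also have "\<dots> = 1 / 2 ^ i"
      by (simp add: real_sqrt_divide real_sqrt_power)
    also have "\<dots> = 2 / 2 ^ j" by (simp add: i)
    also have "\<dots> \<le> 4 / 2 ^ j * g j t"
    proof -
      have "2 * real r \<le> real (2 * r * 4 ^ j) * x t"
        using j(1) mult_left_mono[of "1 / 4 ^ j" "x t" "2 * real r * 4 ^ j"] by simp
      then have "g j t \<ge> 1 / 2" unfolding g_def using x01 by (intro threshold_ge_half) auto
      then show ?thesis by (simp add: divide_simps)
    qed
    also have "\<dots> \<le> (\<Sum>j=1..J. 4 / 2 ^ j * g j t)"
      by (rule member_le_sum) (use j i g0 in auto)
    finally show ?thesis using zero_le_divide_1_iff[of "(2::real) ^ J"] zero_le_power[of "2::real" J] by linarith
  qed
  \<comment> \<open>A pointwise substitute for Hoelder's inequality: if y <= T then y^2 <= T y, and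
    if y > T the left side is at most 0.\<close>
  have pointwise: "(y t)\<^sup>2 - 1 / T\<^sup>2 * y t ^ 4 \<le> T * M / 2 ^ J + (\<Sum>j=1..J. T * M * (4 / 2 ^ j) * g j t)" for t
  proof -
    have "(y t)\<^sup>2 - 1 / T\<^sup>2 * y t ^ 4 \<le> T * y t"
    proof (cases "y t \<le> T")
      case True
      then have "(y t)\<^sup>2 \<le> T * y t" using y0[of t] by (simp add: power2_eq_square mult_right_mono)
      moreover have "1 / T\<^sup>2 * y t ^ 4 \<ge> 0" using y0[of t] by simp
      ultimately show ?thesis by linarith
    next
      case False
      then have "T\<^sup>2 * (y t)\<^sup>2 \<le> (y t)\<^sup>2 * (y t)\<^sup>2" using T by (intro mult_right_mono power_mono) auto
      then have "(y t)\<^sup>2 \<le> 1 / T\<^sup>2 * y t ^ 4" using T by (simp add: field_simps power4_eq_xxxx power2_eq_square)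
      moreover have "T * y t \<ge> 0" using T y0[of t] by simp
      ultimately show ?thesis by linarith
    qed
    also have "\<dots> \<le> T * (M * (1 / 2 ^ J + (\<Sum>j=1..J. 4 / 2 ^ j * g j t)))"
      unfolding yx using sqrt_le[of t] T M by (intro mult_left_mono) auto
    also have "\<dots> = T * M / 2 ^ J + (\<Sum>j=1..J. T * M * (4 / 2 ^ j) * g j t)"
      by (simp add: distrib_left sum_distrib_left mult_ac)
    finally show ?thesis .
  qed
  have "((\<lambda>t. (y t)\<^sup>2 - 1 / T\<^sup>2 * y t ^ 4) has_integral (M - 1 / T\<^sup>2 * energy k I)) {0..0 + 1}"
    unfolding y_def M_def
    by (intro has_integral_diff has_integral_mult_right has_integral_norm_square_inj has_integral_norm_fourth_power fin inj)
  moreover have "((\<lambda>t. T * M / 2 ^ J + (\<Sum>j=1..J. T * M * (4 / 2 ^ j) * g j t)) has_integral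
      (T * M / 2 ^ J + (\<Sum>j=1..J. T * M * (4 / 2 ^ j) * \<mu> j))) {0..0 + 1}"
  proof (intro has_integral_add has_integral_sum has_integral_mult_right \<mu>)
    show "((\<lambda>t. T * M / 2 ^ J) has_integral (T * M / 2 ^ J)) {0..0 + (1::real)}"
      using has_integral_const_real[of "T * M / 2 ^ J" 0 "0 + 1"] by simp
  qed auto
  ultimately have "M - 1 / T\<^sup>2 * energy k I \<le> T * M / 2 ^ J + (\<Sum>j=1..J. T * M * (4 / 2 ^ j) * \<mu> j)"
    by (rule has_integral_le) (rule pointwise)
  moreover have "1 / T\<^sup>2 * energy k I \<le> M / 2"
    using E T by (simp add: field_simps M_def)
  \<comment> \<open>The condition 4 T <= 2^J serves here: cutting off at level \<open>J\<close>
    costs at most a quarter of \<open>M\<close>.\<close>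
  moreover have "T * M / 2 ^ J \<le> M / 4"
    using mult_right_mono[OF J(1), of M] M by (simp add: field_simps)
  ultimately have "M / 4 \<le> (\<Sum>j=1..J. T * M * (4 / 2 ^ j) * \<mu> j)" by linarith
  also have "\<dots> = 4 * T * M * (\<Sum>j=1..J. \<mu> j / 2 ^ j)" by (simp add: sum_distrib_left mult_ac)
  finally have sum_ge: "1 / (16 * T) \<le> (\<Sum>j=1..J. \<mu> j / 2 ^ j)"
    using M T by (simp add: field_simps)
  have "\<exists>j\<in>{1..J}. \<mu> j / 2 ^ j \<ge> 1 / (16 * T * J)"
  proof (rule ccontr)
    assume "\<not> ?thesis"
    then have "(\<Sum>j=1..J. \<mu> j / 2 ^ j) < (\<Sum>j=1..J. 1 / (16 * T * J))"
      using J by (intro sum_strict_mono) (auto simp: not_le)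
    then show False using sum_ge J T by (simp add: field_simps)
  qed
  then obtain j where "j \<in> {1..J}" "\<mu> j / 2 ^ j \<ge> 1 / (16 * T * J)" by blast
  moreover from this have "\<mu> j \<ge> 2 ^ j / (16 * T * J)" by (simp add: field_simps)
  ultimately show ?thesis using that[of j "\<mu> j"] \<mu>[of j] by (simp add: g_def[abs_def])
qed

text \<open>The primes up to H, about Y^2 / \<mu>, number at least (H - 1) / log2 H, which makes the
  exceptional set of size L^2 / Y^2 with a logarithm L. Elsewhere some prime p <= H has f (p t) >
  \<eta>; owing to the slow decay of \<open>threshold\<close> this only yields x > 1 / (Y 4^j).
  After division by p, two factors Y are lost through H and one through this lower level. The
  constant 48 is 3 * 16, from H <= 3 Y^2 / \<mu> and \<mu> >= 2^j / (16 T J).\<close>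

lemma exp_sum_large_at_multiple:
  fixes k :: "'i \<Rightarrow> int" and T Y :: real and A J r :: nat
  assumes fin: "finite I" and "I \<noteq> {}" and inj: "inj_on k I" and A: "\<And>i. i \<in> I \<Longrightarrow> \<bar>k i\<bar> \<le> int A" "A \<ge> 1"
    and T: "T \<ge> 1" and E: "2 * energy k I \<le> T\<^sup>2 * card I" and J: "4 * T \<le> 2 ^ J" "J \<ge> 1"
    and "r \<ge> 1" and Y: "Y \<ge> 1" "(2 * r / Y) ^ r \<le> 1 / (16 * T * J)"
  obtains B where "B \<in> lmeasurable"
    "measure lebesgue B \<le> 4 * (log 2 (96 * T * J * Y\<^sup>2 * A * r\<^sup>2 * 4 ^ J))\<^sup>2 / Y\<^sup>2"
    "\<And>t. t \<in> {a..a + 1} - B \<Longrightarrow>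
       \<exists>p\<ge>1. cmod (\<Sum>i\<in>I. ee (of_int (k i) * (of_nat p * t))) \<ge> p * (card I / (48 * T * J * Y ^ 3))"
proof -
  define M where "M = real (card I)"
  have M: "M > 0" unfolding M_def using fin \<open>I \<noteq> {}\<close> by (simp add: card_gt_0_iff)
  define y where "y t = cmod (\<Sum>i\<in>I. ee (of_int (k i) * t))" for t
  have y0: "y t \<ge> 0" for t by (simp add: y_def)
  have yM: "y t \<le> M" for t
    unfolding y_def M_def using norm_sum[of "\<lambda>i. ee (of_int (k i) * t)" I] by simp
  define x where "x t = (y t)\<^sup>2 / M\<^sup>2" for t
  have x01: "0 \<le> x t" "x t \<le> 1" for t
    using y0[of t] yM[of t] M by (auto simp: x_def power_mono divide_simps)
  obtain j \<mu> where j: "1 \<le> j" "j \<le> J"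
    and \<mu>: "\<And>a. ((\<lambda>t. threshold (2 * r * 4 ^ j) r (x t)) has_integral \<mu>) {a..a + 1}"
    and \<mu>_ge: "\<mu> \<ge> 2 ^ j / (16 * T * J)"
    using energy_dyadic_level[OF fin \<open>I \<noteq> {}\<close> inj _ E J, where r = r] T
    unfolding x_def y_def M_def by auto
  define f where "f t = threshold (2 * r * 4 ^ j) r (x t)" for t
  have f01: "0 \<le> f t" "f t \<le> 1" for t unfolding f_def using threshold_bounds x01 by auto
  have mean: "(f has_integral \<mu>) {b..b + 1}" for b unfolding f_def by (rule \<mu>)
  have TJ: "16 * T * J > 0" using T J by simp
  have "\<mu> \<ge> 1 / (16 * T * J)"
    using \<mu>_ge TJ divide_right_mono[of 1 "2 ^ j" "16 * T * J"] by simp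
  have \<mu>0: "\<mu> > 0" using \<mu>_ge TJ by (smt (verit) divide_pos_pos zero_less_power)
  have \<mu>1: "\<mu> \<le> 1"
  proof -
    have "((\<lambda>t::real. 1::real) has_integral 1) {0..0 + 1}" using has_integral_const_real[of "1::real" 0 "0 + 1"] by simp
    with mean[of 0] show ?thesis by (rule has_integral_le) (use f01 in auto)
  qed
  define H where "H = nat \<lceil>Y\<^sup>2 / \<mu>\<rceil> + 1"
  have Y2: "1 \<le> Y\<^sup>2 / \<mu>" using Y \<mu>0 \<mu>1 by (simp add: field_simps) (smt (verit) one_le_power)
  have H: "real H - 1 \<ge> Y\<^sup>2 / \<mu>" "real H \<le> 3 * (Y\<^sup>2 / \<mu>)" "H \<ge> 2"
    using Y2 unfolding H_def by (auto simp: of_nat_nat) linarith+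
  define K where "K = r * (2 * r * 4 ^ j * (2 * A))"
  have K: "K \<ge> 1" unfolding K_def using \<open>r \<ge> 1\<close> A by simp
  define P where "P = {p. prime p \<and> p \<le> H}"
  have P: "finite P" "\<And>p. p \<in> P \<Longrightarrow> prime p \<and> p \<le> H" "P \<noteq> {}"
    using H(3) two_is_prime_nat by (auto simp: P_def intro!: exI[of _ 2])
  define \<eta> where "\<eta> = (2 * r / Y) ^ r"
  \<comment> \<open>As j >= 1, \<mu> is at least 2 / (16 T J), twice the bound assumed for (2 r /
    Y)^r.\<close>
  have \<eta>: "\<eta> \<le> \<mu> / 2"
  proof -
    have "(2::real) ^ 1 \<le> 2 ^ j" using j by (intro power_increasing) auto
    then have "2 / (16 * T * J) \<le> \<mu>"
      using \<mu>_ge TJ divide_right_mono[of 2 "2 ^ j" "16 * T * J"] by simp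
    then show ?thesis using Y(2) unfolding \<eta>_def by simp
  qed
  define B where "B = {t\<in>{a..a + 1}. \<forall>p\<in>P. f (of_nat p * t) \<le> \<eta>}"
  have trig: "trig_poly K (\<lambda>t. complex_of_real (f t))"
    unfolding f_def x_def y_def K_def by (rule trig_poly_threshold[OF fin A(1)])
  have "H \<ge> 1" using H(3) by linarith
  note B = small_on_prime_dilations_measure[OF trig f01 mean P K \<open>H \<ge> 1\<close> \<mu>0 \<eta>, of a, folded B_def]
  have HK: "real (H * K) \<le> 96 * T * J * Y\<^sup>2 * A * r\<^sup>2 * 4 ^ J"
  proof -
    have "1 / \<mu> \<le> 16 * T * J / 2 ^ j"
      using \<mu>_ge \<mu>0 TJ by (simp add: field_simps)
    then have "real H \<le> 3 * (Y\<^sup>2 * (16 * T * J / 2 ^ j))"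
      using H(2) mult_left_mono[of "1 / \<mu>" "16 * T * J / 2 ^ j" "Y\<^sup>2"] by simp
    then have "real H * real K \<le> 3 * (Y\<^sup>2 * (16 * T * J / 2 ^ j)) * (4 * A * r\<^sup>2 * 4 ^ j)"
      unfolding K_def by (intro mult_mono) (auto simp: power2_eq_square)
    also have "\<dots> = 3 * (Y\<^sup>2 * (16 * T * J)) * (4 * A * r\<^sup>2) * 2 ^ j"
      by (simp add: field_simps flip: power_mult_distrib)
    also have "\<dots> \<le> 3 * (Y\<^sup>2 * (16 * T * J)) * (4 * A * r\<^sup>2) * (4 ^ J / 2)"
    proof -
      have "(2::real) ^ j \<le> 2 ^ J" "(2::real) ^ 1 \<le> 2 ^ J"
        using j J by (intro power_increasing; simp)+
      then have "2 * 2 ^ j \<le> (2::real) ^ J * 2 ^ J" by (intro mult_mono) auto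
      then show ?thesis using T by (intro mult_left_mono) (auto simp flip: power_mult_distrib)
    qed
    finally show ?thesis by (simp add: mult_ac)
  qed
  define L where "L = log 2 (96 * T * J * Y\<^sup>2 * A * r\<^sup>2 * 4 ^ J)"
  show ?thesis
  proof
    show "B \<in> lmeasurable" by (rule B(1))
    have cP: "card P > 0" using P by (simp add: card_gt_0_iff)
    have HH: "1 \<le> real H" "real H \<le> real (H * K)"
      using H(3) K by (auto simp: mult_le_cancel_left1)
    have logs: "0 \<le> log 2 (H * K)" "log 2 (H * K) \<le> L" "0 \<le> log 2 H" "log 2 H \<le> L"
    proof -
      have mono: "0 < u \<Longrightarrow> u \<le> v \<Longrightarrow> log 2 u \<le> log 2 v" for u v :: real by simp
      show "0 \<le> log 2 (H * K)" "0 \<le> log 2 H"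
        using mono[of 1 "real (H * K)"] mono[of 1 "real H"] HH by (simp_all only: log_one zero_less_one)
      show "log 2 (H * K) \<le> L" "log 2 H \<le> L"
        unfolding L_def by (rule mono; use HH HK in linarith)+
    qed
    have "2 ^ (H - 1) \<le> H ^ card P"
      unfolding P_def using H by (intro prime_counting_lower_bound) simp
    then have "(2::real) ^ (H - 1) \<le> real H ^ card P"
      by (metis of_nat_le_iff of_nat_numeral of_nat_power)
    then have "log 2 ((2::real) ^ (H - 1)) \<le> log 2 (real H ^ card P)"
      using H by (subst log_le_cancel_iff) auto
    then have cP_ge: "real H - 1 \<le> card P * log 2 H"
      using H by (simp add: log_nat_power of_nat_diff)
    have "Y\<^sup>2 \<le> (real H - 1) * \<mu>" using H(1) \<mu>0 by (simp add: field_simps)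
    also have "\<dots> \<le> card P * log 2 H * \<mu>" using cP_ge \<mu>0 by (intro mult_right_mono) auto
    also have "\<dots> \<le> card P * L * \<mu>" using logs \<mu>0 by (intro mult_right_mono mult_left_mono) auto
    finally have "1 / (card P * \<mu>) \<le> L / Y\<^sup>2"
      using cP \<mu>0 Y by (simp add: field_simps)
    then have "4 * log 2 (H * K) * (1 / (card P * \<mu>)) \<le> 4 * L * (L / Y\<^sup>2)"
      using logs \<mu>0 by (intro mult_mono) auto
    moreover have "measure lebesgue B \<le> 4 * log 2 (H * K) / (card P * \<mu>)"
      by (rule B(2))
    ultimately show "measure lebesgue B \<le> 4 * (log 2 (96 * T * J * Y\<^sup>2 * A * r\<^sup>2 * 4 ^ J))\<^sup>2 / Y\<^sup>2"
      by (simp add: L_def power2_eq_square)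
  next
    fix t assume t: "t \<in> {a..a + 1} - B"
    then obtain p where p: "p \<in> P" and fp: "f (of_nat p * t) > \<eta>"
      unfolding B_def by force
    let ?s = "of_nat p * t"
    have "p \<ge> 1" using p P(2) prime_ge_1_nat by blast
    have "2 * r / Y < real (2 * r * 4 ^ j) * x ?s"
    proof (rule ccontr)
      assume "\<not> ?thesis"
      then have "(real (2 * r * 4 ^ j) * x ?s) ^ r \<le> \<eta>"
        unfolding \<eta>_def using x01 by (intro power_mono) auto
      then show False using fp threshold_bounds(3)[OF x01, of "2 * r * 4 ^ j" r ?s] unfolding f_def by linarith
    qed
    then have "1 / (Y * 4 ^ j) < x ?s"
      using \<open>r \<ge> 1\<close> Y by (simp add: field_simps)
    \<comment> \<open>A factor sqrt Y is given away here so that the level for \<bar>S\<bar>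
      contains no square root.\<close>
    moreover have "1 / (Y * 2 ^ j)\<^sup>2 \<le> 1 / (Y * 4 ^ j)"
    proof -
      have "(Y * 2 ^ j)\<^sup>2 = Y * Y * 4 ^ j"
        by (simp add: power_mult_distrib power2_eq_square flip: power_mult_distrib)
      moreover have "Y * 4 ^ j \<le> Y * Y * 4 ^ j" using Y by (intro mult_right_mono) auto
      ultimately show ?thesis using Y by (intro divide_left_mono) auto
    qed
    ultimately have "M\<^sup>2 * (1 / (Y * 2 ^ j)\<^sup>2) \<le> M\<^sup>2 * x ?s"
      using M by (intro mult_left_mono) auto
    then have "(M / (Y * 2 ^ j))\<^sup>2 \<le> (y ?s)\<^sup>2"
      unfolding x_def using M by (simp add: power_divide)
    then have y_ge: "M / (Y * 2 ^ j) \<le> y ?s"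
      using y0 by (rule power2_le_imp_le)
    have "p * (M / (48 * T * J * Y ^ 3)) \<le> H * (M / (48 * T * J * Y ^ 3))"
      using p P(2) M T Y by (intro mult_right_mono) auto
    also have "\<dots> \<le> 3 * (Y\<^sup>2 / \<mu>) * (M / (48 * T * J * Y ^ 3))"
      using H(2) M T Y by (intro mult_right_mono) auto
    also have "\<dots> = M / Y / (16 * T * J * \<mu>)"
      using Y T \<mu>0 by (simp add: field_simps power2_eq_square power3_eq_cube)
    also have "\<dots> \<le> M / Y / 2 ^ j"
      using \<mu>_ge TJ M Y \<mu>0 J T by (intro divide_left_mono mult_pos_pos) (auto simp: field_simps)
    also have "\<dots> \<le> y ?s" using y_ge by simp
    finally show "\<exists>p\<ge>1. cmod (\<Sum>i\<in>I. ee (of_int (k i) * (of_nat p * t))) \<ge> p * (card I / (48 * T * J * Y ^ 3))"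
      using \<open>p \<ge> 1\<close> unfolding y_def M_def by blast
  qed
qed

section \<open>Star-discrepancy and exponential sums\<close>

lemma star_discrepancy_upper:
  assumes "0 < \<beta>" "\<beta> \<le> 1"
  shows "\<bar>real (count_below x N \<beta>) / real N - \<beta>\<bar> \<le> star_discrepancy x N"
proof -
  have "bdd_above ((\<lambda>\<beta>. \<bar>real (count_below x N \<beta>) / real N - \<beta>\<bar>) ` {0<..1})"
  proof (rule bdd_aboveI2)
    fix \<beta> :: real assume \<beta>: "\<beta> \<in> {0<..1}"
    have "count_below x N \<beta> \<le> card {1..N}"
      unfolding count_below_def by (rule card_mono) auto
    then have "real (count_below x N \<beta>) / real N \<le> 1" by (cases "N = 0") (simp_all add: divide_le_eq_1)
    then show "\<bar>real (count_below x N \<beta>) / real N - \<beta>\<bar> \<le> 1"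
      using \<beta> by (simp add: abs_le_iff) (smt (verit) divide_nonneg_nonneg of_nat_0_le_iff)
  qed
  then show ?thesis
    unfolding star_discrepancy_def by (rule cSUP_upper2) (use assms in auto)
qed

text \<open>Koksma's inequality by integration: the counting function minus N \<beta>, integrated
  against the derivative of e(p \<beta>), gives minus the exponential sum, because the boundary
  terms cancel by periodicity. The derivative has constant modulus 2 pi p.\<close>

lemma exp_sum_le_star_discrepancy:
  assumes x: "\<And>n. n \<in> {1..N} \<Longrightarrow> 0 \<le> x n \<and> x n < 1" and "p \<ge> 1"
  shows "cmod (\<Sum>n=1..N. ee (of_nat p * x n)) \<le> 2 * pi * p * (real N * star_discrepancy x N)"
proof (cases "N = 0")
  case False
  define e where "e \<beta> = ee (of_nat p * \<beta>)" for \<beta>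
  define e' where "e' \<beta> = 2 * pi * \<i> * of_nat p * e \<beta>" for \<beta>
  have e': "(e has_vector_derivative e' \<beta>) (at \<beta> within X)" for \<beta> X
    using ee_has_vector_derivative[of "of_nat p" \<beta> X] unfolding e_def e'_def by simp
  have e1: "e 1 = 1" "e 0 = 1"
    unfolding e_def using ee_of_int[of "int p"] by simp_all
  have int_id: "((\<lambda>\<beta>. of_real \<beta> * e' \<beta>) has_integral 1) {0..1}"
  proof -
    define F where "F \<beta> = of_real \<beta> * e \<beta> - e \<beta> / (2 * pi * \<i> * of_nat p)" for \<beta>
    have "((\<lambda>\<beta>. of_real \<beta> * e' \<beta>) has_integral F 1 - F 0) {0..1}"
    proof (rule fundamental_theorem_of_calculus)
      fix \<beta> :: real
      have "(F has_vector_derivative (of_real \<beta> * e' \<beta> + of_real 1 * e \<beta> - e' \<beta> / (2 * pi * \<i> * of_nat p))) (at \<beta> within {0..1})"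
        unfolding F_def
        by (intro has_vector_derivative_diff has_vector_derivative_mult has_vector_derivative_of_real
              has_vector_derivative_divide e' DERIV_ident)
      then show "(F has_vector_derivative (of_real \<beta> * e' \<beta>)) (at \<beta> within {0..1})"
        using \<open>p \<ge> 1\<close> by (simp add: e'_def)
    qed auto
    then show ?thesis by (simp add: F_def e1)
  qed
  have int_ind: "((\<lambda>\<beta>. (if y < \<beta> then 1 else 0) * e' \<beta>) has_integral 1 - e y) {0..1}"
    if "0 \<le> y" "y < 1" for y
  proof -
    have "(e' has_integral e 1 - e y) {y..1}"
      using that by (intro fundamental_theorem_of_calculus e') auto
    then have "((\<lambda>\<beta>. if \<beta> \<in> {y..1} then e' \<beta> else 0) has_integral 1 - e y) {0..1}"
      using that by (subst has_integral_restrict) (auto simp: e1)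
    \<comment> \<open>The strict inequality y < \<beta> matches the half-open intervals of
      \<open>count_below\<close>; it differs from the closed interval at the single point y.\<close>
    then show ?thesis
      by (rule has_integral_spike[OF negligible_sing[of y], rotated]) auto
  qed
  define D where "D = real N * star_discrepancy x N"
  have "((\<lambda>\<beta>. \<Sum>n=1..N. (if x n < \<beta> then 1 else 0) * e' \<beta> - of_real \<beta> * e' \<beta>) has_integral
     (\<Sum>n=1..N. 1 - e (x n) - 1)) {0..1}"
    using x by (intro has_integral_sum has_integral_diff int_ind int_id) auto
  then have "((\<lambda>\<beta>. of_real (real (count_below x N \<beta>) - real N * \<beta>) * e' \<beta>) has_integral
     (\<Sum>n=1..N. - e (x n))) {0..1}"
  proof (subst has_integral_cong)
    fix \<beta> :: real assume \<beta>: "\<beta> \<in> {0..1}"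
    have "(\<Sum>n=1..N. (if x n < \<beta> then 1 else 0)) = (of_nat (card {n\<in>{1..N}. x n < \<beta>}) :: complex)"
      by (simp add: sum.If_cases Int_def)
    also have "{n\<in>{1..N}. x n < \<beta>} = {n \<in> {1..N}. x n \<in> {0..<\<beta>}}" using x by auto
    finally have "(\<Sum>n=1..N. (if x n < \<beta> then 1 else 0)) = (of_nat (count_below x N \<beta>) :: complex)"
      by (simp add: count_below_def)
    then show "of_real (real (count_below x N \<beta>) - real N * \<beta>) * e' \<beta> =
       (\<Sum>n=1..N. (if x n < \<beta> then 1 else 0) * e' \<beta> - of_real \<beta> * e' \<beta>)"
      by (simp add: sum_subtractf left_diff_distrib flip: sum_distrib_right)
  qed simp
  then have "cmod (\<Sum>n=1..N. - e (x n)) \<le> (D * (2 * pi * p)) * measure lborel {0..1::real}"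
    unfolding cbox_interval[symmetric]
  proof (rule has_integral_bound[rotated])
    show "0 \<le> D * (2 * pi * p)"
      using star_discrepancy_upper[of 1 x N] by (simp add: D_def)
    fix \<beta> :: real assume \<beta>: "\<beta> \<in> cbox 0 1"
    have "\<bar>real (count_below x N \<beta>) - real N * \<beta>\<bar> \<le> D"
    \<comment> \<open>The supremum is over \<beta> > 0 only; at 0 both the count and N \<beta>
      vanish.\<close>
    proof (cases "\<beta> = 0")
      case True
      then show ?thesis using star_discrepancy_upper[of 1 x N] by (simp add: D_def count_below_def)
    next
      case F: False
      have "real N * \<bar>real (count_below x N \<beta>) / real N - \<beta>\<bar> \<le> D"
        unfolding D_def by (intro mult_left_mono star_discrepancy_upper) (use \<beta> F in auto)
      also have "real N * \<bar>real (count_below x N \<beta>) / real N - \<beta>\<bar>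
          = \<bar>real N * (real (count_below x N \<beta>) / real N - \<beta>)\<bar>" by (simp add: abs_mult)
      finally show ?thesis using False by (simp add: right_diff_distrib)
    qed
    moreover have "cmod (e' \<beta>) = 2 * pi * p"
      by (simp add: e'_def e_def norm_mult)
    ultimately show "cmod (of_real (real (count_below x N \<beta>) - real N * \<beta>) * e' \<beta>) \<le> D * (2 * pi * p)"
      by (simp only: norm_mult norm_of_real) (intro mult_right_mono; simp)
  qed
  then show ?thesis by (simp add: e_def sum_negf D_def mult_ac)
qed simp

text \<open>Replacing \<alpha> by p \<alpha> amounts to testing the unchanged points with frequency
  p, so a large sum at p \<alpha> says something about \<alpha> itself, at the price of a factor p.
  The block is a difference of two initial segments.\<close>

lemma block_exp_sum_le_star_discrepancy:
  fixes a :: "nat \<Rightarrow> int" and \<alpha> :: real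
  assumes "p \<ge> 1"
  defines "D \<equiv> \<lambda>N. real N * star_discrepancy (\<lambda>n. frac (real_of_int (a n) * \<alpha>)) N"
  shows "cmod (\<Sum>n\<in>{N<..N + m}. ee (of_int (a n) * (of_nat p * \<alpha>))) \<le> 2 * pi * p * (D (N + m) + D N)"
proof -
  define s where "s N = (\<Sum>n=1..N. ee (of_nat p * frac (real_of_int (a n) * \<alpha>)))" for N
  have s_le: "cmod (s N) \<le> 2 * pi * p * D N" for N
    unfolding s_def D_def using assms(1) by (intro exp_sum_le_star_discrepancy) (auto simp: frac_lt_1)
  have "ee (of_int (a n) * (of_nat p * \<alpha>)) = ee (of_nat p * frac (real_of_int (a n) * \<alpha>))" for n
    by (simp add: ee_frac mult_ac)
  moreover have "{1..N + m} = {1..N} \<union> {N<..N + m}" by auto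
  ultimately have "(\<Sum>n\<in>{N<..N + m}. ee (of_int (a n) * (of_nat p * \<alpha>))) = s (N + m) - s N"
    unfolding s_def by (simp only:) (subst sum.union_disjoint, auto)
  also have "cmod \<dots> \<le> cmod (s (N + m)) + cmod (s N)" by (rule norm_triangle_ineq4)
  finally show ?thesis using s_le[of N] s_le[of "N + m"] by (simp add: distrib_left)
qed

section \<open>The metric lower bound\<close>

lemma eventually_ge_powr:
  assumes "\<epsilon> > 0"
  shows "\<forall>\<^sub>F N in sequentially. (C::real) \<le> real N powr \<epsilon>"
  using assms by real_asymp

lemma eventually_log_le_powr:
  fixes \<epsilon> C b B :: real
  assumes "\<epsilon> > 0" "B > 0"
  shows "\<forall>\<^sub>F N in sequentially. log 2 (B * real N powr b) \<le> real N powr \<epsilon>"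
proof -
  have "\<forall>\<^sub>F N in sequentially. log 2 B + b * log 2 (real N) \<le> real N powr \<epsilon>"
    using assms by real_asymp
  moreover have "\<forall>\<^sub>F N in sequentially. N > (0::nat)" by (rule eventually_gt_at_top)
  ultimately show ?thesis
  proof eventually_elim
    case (elim N)
    then have "log 2 (B * real N powr b) = log 2 B + b * log 2 (real N)"
      using assms by (simp add: log_mult log_powr)
    then show ?case using elim by simp
  qed
qed

text \<open>The diagonal quadruples alone; this is used to see that T >= 1.\<close>

lemma card_le_energy:
  assumes "finite I"
  shows "card I \<le> energy k I"
proof -
  have "(\<lambda>i. ((i, i), (i, i))) ` I \<subseteq> {z \<in> (I \<times> I) \<times> I \<times> I.
     k (fst (fst z)) + k (snd (fst z)) = k (fst (snd z)) + k (snd (snd z))}"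
    by auto
  then have "card ((\<lambda>i. ((i, i), (i, i))) ` I) \<le> energy k I"
    unfolding energy_def using assms by (intro card_mono) auto
  then show ?thesis by (simp add: card_image inj_on_def)
qed

text \<open>Choice of parameters. \<open>T\<close> is the value for which the energy hypothesis
  reads 2 E <= T^2 m, and N^\<delta> dominates all logarithms. With Y = N^(\<epsilon>/12) the loss
  48 J Y^3 is at most N^(\<epsilon>/2), which together with the \<epsilon>/2 inside \<open>T\<close>
  makes up \<epsilon>; the exceptional measure is at most 4 N^(2 \<delta> - \<epsilon>/6).\<close>

lemma block_exp_sums_large:
  fixes a :: "nat \<Rightarrow> int" and m :: "nat \<Rightarrow> nat" and \<tau> \<epsilon> z :: real
  assumes m: "\<forall>\<^sub>F N in sequentially. 1 \<le> m N \<and> m N \<le> N"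
    and inj: "\<forall>\<^sub>F N in sequentially. inj_on a {N<..N + m N}"
    and size: "\<forall>\<^sub>F N in sequentially. \<forall>n\<in>{N<..N + m N}. \<bar>a n\<bar> \<le> int N ^ q"
    and "\<epsilon> > 0"
    and energy: "\<forall>\<^sub>F N in sequentially. 2 * energy a {N<..N + m N} * real N powr (2 * \<tau> - \<epsilon>) \<le> real (m N) ^ 3"
  shows "\<exists>B. (\<forall>\<^sub>F N in sequentially. B N \<in> lmeasurable \<and>
        (\<forall>t\<in>{z..z + 1} - B N. \<exists>p\<ge>1. cmod (\<Sum>n\<in>{N<..N + m N}. ee (of_int (a n) * (of_nat p * t)))
           \<ge> real p * real N powr (\<tau> - \<epsilon>))) \<and>
      (\<lambda>N. measure lebesgue (B N)) \<longlonglongrightarrow> 0"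
proof -
  \<comment> \<open>Chosen so that T <= N^C, by m <= N.\<close>
  define C where "C = 1 + \<bar>\<tau>\<bar> + \<epsilon>"
  define T where "T N = real (m N) / real N powr (\<tau> - \<epsilon> / 2)" for N
  define J where "J N = nat \<lceil>log 2 (4 * T N)\<rceil>" for N
  define \<delta> where "\<delta> = \<epsilon> / 48"
  define Y where "Y N = real N powr (\<epsilon> / 12)" for N
  \<comment> \<open>A constant independent of N, so large that Y^r is at least N^(C + 1 + \<delta>);
    this exceeds 16 T J (2 r)^r for large N although Y is only a small power of N.\<close>
  define r where "r = nat \<lceil>12 * (C + 1 + \<delta>) / \<epsilon>\<rceil>"
  define L where "L N = 96 * T N * J N * (Y N)\<^sup>2 * real (N ^ q) * r\<^sup>2 * 4 ^ J N" for N
  have C: "C > 1" and \<delta>: "\<delta> > 0" using \<open>\<epsilon> > 0\<close> by (auto simp: C_def \<delta>_def)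
  have r: "r \<ge> 1" "r * (\<epsilon> / 12) \<ge> C + 1 + \<delta>"
  proof -
    have *: "12 * (C + 1 + \<delta>) / \<epsilon> > 0" using C \<delta> \<open>\<epsilon> > 0\<close> by simp
    then have "real r \<ge> 12 * (C + 1 + \<delta>) / \<epsilon>" unfolding r_def by (simp add: real_nat_ceiling_ge)
    then show "r * (\<epsilon> / 12) \<ge> C + 1 + \<delta>" using \<open>\<epsilon> > 0\<close> by (simp add: field_simps)
    show "r \<ge> 1" unfolding r_def using * by linarith
  qed
  have E1: "\<forall>\<^sub>F N in sequentially. N \<ge> (2::nat)" by (rule eventually_ge_at_top)
  have E2: "\<forall>\<^sub>F N in sequentially. 1 + log 2 (4 * real N powr C) \<le> real N powr \<delta>"
    using eventually_log_le_powr[OF \<delta>, of "2 * 4" C, OF mult_pos_pos[OF zero_less_numeral zero_less_numeral]]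
      eventually_gt_at_top[of 0]
  proof eventually_elim
    case (elim N)
    have "log 2 (2 * 4 * real N powr C) = 1 + log 2 (4 * real N powr C)"
      unfolding mult.assoc using elim by (subst log_mult) auto
    then show ?case using elim by linarith
  qed
  have E3: "\<forall>\<^sub>F N in sequentially. log 2 ((96 * r\<^sup>2 * 64) * real N powr (3 * C + \<delta> + \<epsilon> / 6 + q)) \<le> real N powr \<delta>"
    using r by (intro eventually_log_le_powr \<delta>) simp
  have E4: "\<forall>\<^sub>F N in sequentially. 16 * (2 * r) ^ r \<le> real N powr 1"
    by (rule eventually_ge_powr) simp
  have E5: "\<forall>\<^sub>F N in sequentially. 48 \<le> real N powr (\<epsilon> / 4 - \<delta>)"
    using \<open>\<epsilon> > 0\<close> by (intro eventually_ge_powr) (simp add: \<delta>_def)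
  have key: "\<forall>\<^sub>F N in sequentially. \<exists>B. B \<in> lmeasurable \<and>
     (\<forall>t\<in>{z..z + 1} - B. \<exists>p\<ge>1. cmod (\<Sum>n\<in>{N<..N + m N}. ee (of_int (a n) * (of_nat p * t)))
           \<ge> real p * real N powr (\<tau> - \<epsilon>)) \<and> measure lebesgue B \<le> 4 * real N powr (2 * \<delta> - \<epsilon> / 6)"
    using m inj size energy E1 E2 E3 E4 E5
  proof eventually_elim
    case (elim N)
    define I where "I = {N<..N + m N}"
    have cI: "card I = m N" and fin: "finite I" and ne: "I \<noteq> {}" using elim by (auto simp: I_def)
    have N: "real N \<ge> 2" using elim by simp
    have En: "2 * energy a I \<le> (T N)\<^sup>2 * card I"
    proof -
      have "(T N)\<^sup>2 * card I = real (m N) ^ 3 / real N powr (2 * \<tau> - \<epsilon>)"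
        unfolding T_def cI
        by (simp add: power_divide power2_eq_square power3_eq_cube powr_add[symmetric])
      moreover have "real (2 * energy a I) \<le> real (m N) ^ 3 / real N powr (2 * \<tau> - \<epsilon>)"
        using elim(4) N unfolding I_def by (subst pos_le_divide_eq) auto
      ultimately show ?thesis by simp
    qed
    have "real (m N) \<le> real (energy a I)"
      using card_le_energy[OF fin, of a] cI by simp
    then have "1 * real (m N) \<le> (T N)\<^sup>2 * real (m N)" using En unfolding cI by simp
    then have "1 \<le> (T N)\<^sup>2" using elim(1) by (simp add: mult_le_cancel_right)
    moreover have "T N \<ge> 0" unfolding T_def by simp
    ultimately have T1: "T N \<ge> 1" using power2_le_imp_le[of 1 "T N"] by simp
    have TC: "T N \<le> real N powr C"
    proof -
      have "T N = real (m N) * real N powr (- (\<tau> - \<epsilon> / 2))"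
        unfolding T_def powr_minus_divide by simp
      also have "\<dots> \<le> real N * real N powr (\<bar>\<tau>\<bar> + \<epsilon>)"
        using elim(1) N \<open>\<epsilon> > 0\<close> by (intro mult_mono powr_mono) auto
      also have "\<dots> = real N powr C" using N by (simp add: C_def powr_add powr_one)
      finally show ?thesis .
    qed
    have logT: "log 2 (4 * T N) \<ge> 2"
    proof -
      have "log 2 4 \<le> log 2 (4 * T N)" using T1 by simp
      moreover have "log 2 4 = (2::real)" using log_pow_cancel[of 2 2] by simp
      ultimately show ?thesis by simp
    qed
    have J1: "J N \<ge> 1" unfolding J_def using logT by linarith
    have Jlog: "log 2 (4 * T N) \<le> J N" "J N \<le> 1 + log 2 (4 * T N)"
      unfolding J_def using logT by linarith+
    have J2: "4 * T N \<le> 2 ^ J N"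
      using Jlog(1) T1 by (simp add: log_le_iff powr_realpow)
    have "log 2 (2 ^ J N) \<le> log 2 (8 * T N)"
    proof -
      have "log 2 (2 * (4 * T N)) = 1 + log 2 (4 * T N)" using T1 by (subst log_mult) auto
      then show ?thesis using Jlog(2) by (simp add: log_nat_power)
    qed
    then have J3: "2 ^ J N \<le> 8 * T N" using T1 by (subst (asm) log_le_cancel_iff) auto
    have JN: "real (J N) \<le> real N powr \<delta>"
    proof -
      have "log 2 (4 * T N) \<le> log 2 (4 * real N powr C)" using T1 TC by (intro log_mono) auto
      then show ?thesis using Jlog(2) elim by linarith
    qed
    have Y1: "Y N \<ge> 1" unfolding Y_def using N \<open>\<epsilon> > 0\<close> by (intro ge_one_powr_ge_zero) auto
    have TJ: "T N * J N \<le> real N powr (C + \<delta>)"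
      unfolding powr_add using TC JN T1 by (intro mult_mono) auto
    have small: "(2 * r / Y N) ^ r \<le> 1 / (16 * T N * J N)"
    proof -
      have "16 * (T N * J N) * (2 * r) ^ r \<le> 16 * real N powr (C + \<delta>) * (2 * r) ^ r"
        using TJ by (intro mult_right_mono mult_left_mono) auto
      also have "\<dots> \<le> real N powr (C + \<delta>) * real N powr 1"
        using elim by (simp add: mult_ac mult_left_mono)
      also have "\<dots> \<le> real N powr (r * (\<epsilon> / 12))"
        unfolding powr_add[symmetric] using r N by (intro powr_mono) auto
      also have "\<dots> = Y N ^ r"
        unfolding Y_def using N by (simp add: powr_power mult.commute)
      finally have "16 * (T N * J N) * (2 * r) ^ r \<le> Y N ^ r" by simp
      then show ?thesis using Y1 T1 J1 by (simp add: power_divide field_simps)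
    qed
    have L_le: "L N \<le> (96 * r\<^sup>2 * 64) * real N powr (3 * C + \<delta> + \<epsilon> / 6 + q)"
    proof -
      have "4 ^ J N = (2 ^ J N) * (2::real) ^ J N" by (simp flip: power_mult_distrib)
      also have "\<dots> \<le> (8 * T N) * (8 * T N)" using J3 T1 by (intro mult_mono) auto
      also have "\<dots> \<le> 64 * (real N powr C * real N powr C)"
        using TC T1 mult_mono[OF TC TC] by simp
      finally have "4 ^ J N \<le> 64 * real N powr (2 * C)" by (simp add: powr_add[symmetric])
      then have "(T N * J N) * 4 ^ J N \<le> real N powr (C + \<delta>) * (64 * real N powr (2 * C))"
        using TJ T1 by (intro mult_mono) auto
      then have "96 * r\<^sup>2 * ((Y N)\<^sup>2 * real (N ^ q)) * ((T N * J N) * 4 ^ J N)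
          \<le> 96 * r\<^sup>2 * ((Y N)\<^sup>2 * real (N ^ q)) * (real N powr (C + \<delta>) * (64 * real N powr (2 * C)))"
        by (intro mult_left_mono) auto
      also have "\<dots> = (96 * r\<^sup>2 * 64) * real N powr (3 * C + \<delta> + \<epsilon> / 6 + q)"
      proof -
        have "(Y N)\<^sup>2 = real N powr (\<epsilon> / 6)" unfolding Y_def by (simp add: power2_eq_square powr_add[symmetric])
        moreover have "real (N ^ q) = real N powr q" using N by (simp add: powr_realpow)
        moreover have "real N powr (3 * C + \<delta> + \<epsilon> / 6 + q)
            = real N powr (C + \<delta>) * real N powr (2 * C) * real N powr (\<epsilon> / 6) * real N powr q"
          by (simp add: powr_add[symmetric])
        ultimately show ?thesis by simp
      qed
      finally show ?thesis unfolding L_def by (simp add: mult_ac)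
    qed
    have A: "\<bar>a i\<bar> \<le> int (N ^ q)" if "i \<in> I" for i using elim that by (simp add: I_def)
    have Aq: "N ^ q \<ge> 1" using N by simp
    obtain B where B: "B \<in> lmeasurable"
      and meas: "measure lebesgue B \<le> 4 * (log 2 (L N))\<^sup>2 / (Y N)\<^sup>2"
      and large: "\<And>t. t \<in> {z..z + 1} - B \<Longrightarrow>
       \<exists>p\<ge>1. cmod (\<Sum>i\<in>I. ee (of_int (a i) * (of_nat p * t))) \<ge> p * (card I / (48 * T N * J N * Y N ^ 3))"
      unfolding L_def
      by (rule exp_sum_large_at_multiple[OF fin ne _ A Aq T1 En J2 J1 r(1) Y1 small, of z])
         (use elim in \<open>auto simp: I_def\<close>)
    have "measure lebesgue B \<le> 4 * real N powr (2 * \<delta> - \<epsilon> / 6)"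
    proof -
      have L1: "L N \<ge> 1"
      proof -
        have "1 \<le> (real r)\<^sup>2" "1 \<le> (Y N)\<^sup>2" "1 \<le> real (N ^ q)" "1 \<le> (4::real) ^ J N" "1 \<le> real (J N)"
          using r Y1 Aq J1 by (simp_all add: one_le_power del: of_nat_power)
        then have "1 * 1 * 1 * 1 * 1 * 1 * 1 \<le> L N"
          unfolding L_def using T1 by (intro mult_mono) auto
        then show ?thesis by simp
      qed
      have "log 2 (L N) \<le> log 2 ((96 * r\<^sup>2 * 64) * real N powr (3 * C + \<delta> + \<epsilon> / 6 + q))"
        using L_le L1 by (subst log_le_cancel_iff) linarith+
      then have "log 2 (L N) \<le> real N powr \<delta>" using elim by linarith
      moreover have "0 \<le> log 2 (L N)" using L1 by simp
      ultimately have "(log 2 (L N))\<^sup>2 \<le> (real N powr \<delta>)\<^sup>2" by (intro power_mono)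
      then have "4 * (log 2 (L N))\<^sup>2 / (Y N)\<^sup>2 \<le> 4 * (real N powr \<delta>)\<^sup>2 / (Y N)\<^sup>2"
        by (intro divide_right_mono mult_left_mono) auto
      also have "\<dots> = 4 * real N powr (2 * \<delta> - \<epsilon> / 6)"
        unfolding Y_def power2_eq_square powr_add[symmetric] by (simp add: powr_diff)
      finally show ?thesis using meas by linarith
    qed
    moreover have "\<exists>p\<ge>1. cmod (\<Sum>n\<in>{N<..N + m N}. ee (of_int (a n) * (of_nat p * t)))
           \<ge> real p * real N powr (\<tau> - \<epsilon>)" if t: "t \<in> {z..z + 1} - B" for t
    proof -
      obtain p where p: "p \<ge> 1" 
        "cmod (\<Sum>i\<in>I. ee (of_int (a i) * (of_nat p * t))) \<ge> p * (card I / (48 * T N * J N * Y N ^ 3))"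
        using large[OF t] by blast
      have "real N powr (\<tau> - \<epsilon>) \<le> card I / (48 * T N * J N * Y N ^ 3)"
      proof -
        have "48 * real (J N) * Y N ^ 3 \<le> real N powr (\<epsilon> / 4 - \<delta>) * real N powr \<delta> * real N powr (\<epsilon> / 4)"
        proof (rule mult_mono)
          show "Y N ^ 3 \<le> real N powr (\<epsilon> / 4)"
            unfolding Y_def using N by (simp add: powr_power)
          show "48 * real (J N) \<le> real N powr (\<epsilon> / 4 - \<delta>) * real N powr \<delta>"
            using elim JN by (intro mult_mono) auto
        qed (use Y1 in auto)
        also have "\<dots> = real N powr (\<epsilon> / 2)" by (simp add: powr_add[symmetric])
        finally have le: "48 * real (J N) * Y N ^ 3 \<le> real N powr (\<epsilon> / 2)" .
        have "real N powr (\<tau> - \<epsilon>) = real N powr (\<tau> - \<epsilon> / 2) / real N powr (\<epsilon> / 2)"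
          by (simp add: powr_diff[symmetric])
        also have "\<dots> \<le> real N powr (\<tau> - \<epsilon> / 2) / (48 * real (J N) * Y N ^ 3)"
          using le J1 Y1 N by (intro divide_left_mono mult_pos_pos) auto
        also have "real N powr (\<tau> - \<epsilon> / 2) = card I / T N"
          using elim(1) N unfolding T_def cI by simp
        finally show ?thesis by (simp add: mult_ac)
      qed
      then have "p * real N powr (\<tau> - \<epsilon>) \<le> p * (card I / (48 * T N * J N * Y N ^ 3))"
        by (intro mult_left_mono) auto
      then show ?thesis using p unfolding I_def by (meson order_trans)
    qed
    ultimately show ?case using B by blast
  qed
  define B where "B N = (SOME B. B \<in> lmeasurable \<and>
     (\<forall>t\<in>{z..z + 1} - B. \<exists>p\<ge>1. cmod (\<Sum>n\<in>{N<..N + m N}. ee (of_int (a n) * (of_nat p * t)))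
           \<ge> real p * real N powr (\<tau> - \<epsilon>)) \<and> measure lebesgue B \<le> 4 * real N powr (2 * \<delta> - \<epsilon> / 6))" for N
  have B: "\<forall>\<^sub>F N in sequentially. B N \<in> lmeasurable \<and>
     (\<forall>t\<in>{z..z + 1} - B N. \<exists>p\<ge>1. cmod (\<Sum>n\<in>{N<..N + m N}. ee (of_int (a n) * (of_nat p * t)))
           \<ge> real p * real N powr (\<tau> - \<epsilon>)) \<and> measure lebesgue (B N) \<le> 4 * real N powr (2 * \<delta> - \<epsilon> / 6)"
    using key unfolding B_def by eventually_elim (rule someI_ex)
  have "(\<lambda>N. measure lebesgue (B N)) \<longlonglongrightarrow> 0"
  proof (rule tendsto_sandwich)
    show "\<forall>\<^sub>F N in sequentially. 0 \<le> measure lebesgue (B N)" by simp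
    show "\<forall>\<^sub>F N in sequentially. measure lebesgue (B N) \<le> 4 * real N powr (2 * \<delta> - \<epsilon> / 6)"
      using B by eventually_elim simp
    have "2 * \<delta> - \<epsilon> / 6 < 0" using \<open>\<epsilon> > 0\<close> by (simp add: \<delta>_def)
    then show "(\<lambda>N. 4 * real N powr (2 * \<delta> - \<epsilon> / 6)) \<longlonglongrightarrow> 0"
      by real_asymp
  qed simp
  moreover have "\<forall>\<^sub>F N in sequentially. B N \<in> lmeasurable \<and>
        (\<forall>t\<in>{z..z + 1} - B N. \<exists>p\<ge>1. cmod (\<Sum>n\<in>{N<..N + m N}. ee (of_int (a n) * (of_nat p * t)))
           \<ge> real p * real N powr (\<tau> - \<epsilon>))"
    using B by eventually_elim blast
  ultimately show ?thesis by blast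
qed

lemma powr_le_scale:
  fixes N \<zeta> s :: real
  assumes "0 < N" "N \<le> \<zeta>" "\<zeta> \<le> 2 * N"
  shows "\<zeta> powr s \<le> 2 powr \<bar>s\<bar> * N powr s"
proof (cases "s \<ge> 0")
  case True
  then have "\<zeta> powr s \<le> (2 * N) powr s" using assms by (intro powr_mono2) auto
  then show ?thesis using True assms by (simp add: powr_mult)
next
  case False
  then have "\<zeta> powr s \<le> N powr s" using assms by (intro powr_mono2') auto
  also have "\<dots> \<le> 2 powr \<bar>s\<bar> * N powr s"
    using ge_one_powr_ge_zero[of 2 "\<bar>s\<bar>"] mult_right_mono[of 1 "2 powr \<bar>s\<bar>" "N powr s"] by simp
  finally show ?thesis .
qed

text \<open>If the lower bound fails at \<alpha>, then \<alpha> lies in \<open>B N\<close> for all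
  large N. For each n the intersection of the \<open>B N\<close> with N >= n is contained in every
  one of them, so it is null as soon as the measures tend to 0.\<close>

lemma Omega_fails_negligible:
  fixes a :: "nat \<Rightarrow> int" and m :: "nat \<Rightarrow> nat" and \<tau> \<epsilon> z :: real
  assumes m: "\<forall>\<^sub>F N in sequentially. 1 \<le> m N \<and> m N \<le> N"
    and inj: "\<forall>\<^sub>F N in sequentially. inj_on a {N<..N + m N}"
    and size: "\<forall>\<^sub>F N in sequentially. \<forall>n\<in>{N<..N + m N}. \<bar>a n\<bar> \<le> int N ^ q"
    and "\<epsilon> > 0"
    and energy: "\<forall>\<^sub>F N in sequentially. 2 * energy a {N<..N + m N} * real N powr (2 * \<tau> - \<epsilon>) \<le> real (m N) ^ 3"
  defines "D \<equiv> \<lambda>\<alpha> N. real N * star_discrepancy (\<lambda>n. frac (real_of_int (a n) * \<alpha>)) N"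
  shows "negligible {\<alpha>\<in>{z..z + 1}. \<not> Omega_infinitely_often (D \<alpha>) (\<lambda>N. real N powr (\<tau> - \<epsilon>))}"
proof -
  define s where "s = \<tau> - \<epsilon>"
  obtain B where B: "\<forall>\<^sub>F N in sequentially. B N \<in> lmeasurable \<and>
      (\<forall>t\<in>{z..z + 1} - B N. \<exists>p\<ge>1. cmod (\<Sum>n\<in>{N<..N + m N}. ee (of_int (a n) * (of_nat p * t)))
           \<ge> real p * real N powr s)" and lim: "(\<lambda>N. measure lebesgue (B N)) \<longlonglongrightarrow> 0"
    using block_exp_sums_large[OF m inj size \<open>\<epsilon> > 0\<close> energy, of z] unfolding s_def by blast
  obtain N\<^sub>1 where N\<^sub>1: "\<forall>N\<ge>N\<^sub>1. (1 \<le> m N \<and> m N \<le> N) \<and> B N \<in> lmeasurable \<and>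
      (\<forall>t\<in>{z..z + 1} - B N. \<exists>p\<ge>1. cmod (\<Sum>n\<in>{N<..N + m N}. ee (of_int (a n) * (of_nat p * t)))
           \<ge> real p * real N powr s)"
    using eventually_conj[OF m B] unfolding eventually_sequentially by blast
  have N1: "1 \<le> m N \<and> m N \<le> N" "B N \<in> lmeasurable" if "N \<ge> N\<^sub>1" for N
    using N\<^sub>1 that by simp_all
  have large: "\<exists>p\<ge>1. cmod (\<Sum>n\<in>{N<..N + m N}. ee (of_int (a n) * (of_nat p * t))) \<ge> real p * real N powr s"
    if "N \<ge> N\<^sub>1" "t \<in> {z..z + 1} - B N" for N t
    using N\<^sub>1 that by blast
  have "negligible (\<Inter>N\<in>{max n N\<^sub>1..}. B N)" for n
  proof (subst negligible_outer_le, intro allI impI)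
    fix e :: real assume "e > 0"
    then have "\<forall>\<^sub>F N in sequentially. measure lebesgue (B N) < e"
      using lim by (rule order_tendstoD(2)[rotated])
    then obtain N where "N \<ge> max n N\<^sub>1" "measure lebesgue (B N) < e"
      unfolding eventually_sequentially by (meson linorder_linear)
    then show "\<exists>T. (\<Inter>N\<in>{max n N\<^sub>1..}. B N) \<subseteq> T \<and> T \<in> lmeasurable \<and> measure lebesgue T \<le> e"
      using N1(2)[of N] by (intro exI[of _ "B N"]) (auto simp: INF_lower)
  qed
  then have "negligible (\<Union>n. \<Inter>N\<in>{max n N\<^sub>1..}. B N)"
    by (intro negligible_countable_Union) auto
  moreover have "{\<alpha>\<in>{z..z + 1}. \<not> Omega_infinitely_often (D \<alpha>) (\<lambda>N. real N powr s)} \<subseteq> (\<Union>n. \<Inter>N\<in>{max n N\<^sub>1..}. B N)"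
  proof (rule subsetI, rule ccontr)
    fix \<alpha> assume \<alpha>: "\<alpha> \<in> {\<alpha>\<in>{z..z + 1}. \<not> Omega_infinitely_often (D \<alpha>) (\<lambda>N. real N powr s)}"
      and notin: "\<alpha> \<notin> (\<Union>n. \<Inter>N\<in>{max n N\<^sub>1..}. B N)"
    \<comment> \<open>One of the two discrepancies carries half of N^s / (2 pi). The power of 2
      allows for its being the one at N + m, which is at most 2 N.\<close>
    define c where "c = 1 / (4 * pi * 2 powr \<bar>s\<bar>)"
    have c: "c > 0" by (simp add: c_def)
    have "\<exists>N'\<ge>n. N' \<in> {N. D \<alpha> N \<ge> c * real N powr s}" for n
    proof -
      \<comment> \<open>Starting from \<open>max n 1\<close> excludes N = 0.\<close>
      obtain N where N: "N \<ge> max n (max 1 N\<^sub>1)" "\<alpha> \<notin> B N"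
        using notin by (auto dest!: spec[of _ "max n 1"])
      then obtain p where p: "p \<ge> 1" "real p * real N powr s \<le> cmod (\<Sum>n\<in>{N<..N + m N}. ee (of_int (a n) * (of_nat p * \<alpha>)))"
        using large[of N \<alpha>] \<alpha> by auto
      have mN: "m N \<le> N" "N \<ge> 1" "N \<ge> n" using N1(1)[of N] N by auto
      have "real p * real N powr s \<le> 2 * pi * p * (D \<alpha> (N + m N) + D \<alpha> N)"
        using p block_exp_sum_le_star_discrepancy[OF p(1), of a \<alpha> N "m N"] unfolding D_def by linarith
      then have "real p * real N powr s \<le> real p * (2 * pi * (D \<alpha> (N + m N) + D \<alpha> N))"
        by (simp add: mult_ac)
      then have "real N powr s \<le> 2 * pi * (D \<alpha> (N + m N) + D \<alpha> N)"
        using p(1) by simp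
      then have sum_ge: "real N powr s / (2 * pi) \<le> D \<alpha> (N + m N) + D \<alpha> N"
        by (simp add: field_simps)
      have scale: "c * real N' powr s \<le> real N powr s / (4 * pi)" if "N \<le> N'" "N' \<le> 2 * N" for N'
      proof -
        have "real N' powr s \<le> 2 powr \<bar>s\<bar> * real N powr s"
          using that mN by (intro powr_le_scale) auto
        then show ?thesis unfolding c_def by (simp add: field_simps)
      qed
      have half: "real N powr s / (2 * pi) = real N powr s / (4 * pi) + real N powr s / (4 * pi)"
        by (simp add: field_simps)
      show ?thesis
      proof (cases "D \<alpha> N \<ge> real N powr s / (4 * pi)")
        case True
        then have "c * real N powr s \<le> D \<alpha> N" using scale[of N] by simp
        then show ?thesis using mN by blast
      next
        case False
        then have "D \<alpha> (N + m N) \<ge> real N powr s / (4 * pi)" using sum_ge half by linarith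
        then have "c * real (N + m N) powr s \<le> D \<alpha> (N + m N)" using scale[of "N + m N"] mN by linarith
        then show ?thesis using mN by (intro exI[of _ "N + m N"]) simp
      qed
    qed
    then have "Omega_infinitely_often (D \<alpha>) (\<lambda>N. real N powr s)"
      unfolding Omega_infinitely_often_def infinite_nat_iff_unbounded_le using c by blast
    then show False using \<alpha> by simp
  qed
  ultimately show ?thesis unfolding s_def by (rule negligible_subset)
qed

text \<open>Countably many null sets suffice: a smaller \<epsilon> gives a stronger bound, so the
  values 1 / (k + 1) cover all \<epsilon>, and the line is covered by unit intervals with integer
  endpoints.\<close>

lemma AE_star_discrepancy_Omega:
  fixes a :: "nat \<Rightarrow> int" and m :: "nat \<Rightarrow> nat" and \<tau> :: real
  assumes m: "\<forall>\<^sub>F N in sequentially. 1 \<le> m N \<and> m N \<le> N"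
    and inj: "\<forall>\<^sub>F N in sequentially. inj_on a {N<..N + m N}"
    and size: "\<forall>\<^sub>F N in sequentially. \<forall>n\<in>{N<..N + m N}. \<bar>a n\<bar> \<le> int N ^ q"
    and energy: "\<And>\<epsilon>. \<epsilon> > 0 \<Longrightarrow> \<forall>\<^sub>F N in sequentially.
      2 * energy a {N<..N + m N} * real N powr (2 * \<tau> - \<epsilon>) \<le> real (m N) ^ 3"
  shows "AE \<alpha> in lebesgue. \<forall>\<epsilon>>0. Omega_infinitely_often
    (\<lambda>N. real N * star_discrepancy (\<lambda>n. frac (real_of_int (a n) * \<alpha>)) N) (\<lambda>N. real N powr (\<tau> - \<epsilon>))"
proof -
  define D where "D \<alpha> N = real N * star_discrepancy (\<lambda>n. frac (real_of_int (a n) * \<alpha>)) N" for \<alpha> N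
  define Z where "Z = (\<lambda>(k, z). {\<alpha>\<in>{of_int z..of_int z + 1}.
      \<not> Omega_infinitely_often (D \<alpha>) (\<lambda>N. real N powr (\<tau> - 1 / Suc k))})"
  have "negligible (Z x)" for x
    unfolding Z_def case_prod_unfold D_def
    by (rule Omega_fails_negligible[OF m inj size _ energy]) auto
  then have "negligible (\<Union>(range Z))"
    by (intro negligible_countable_Union) auto
  then have "AE \<alpha> in lebesgue. \<alpha> \<notin> \<Union>(range Z)"
    by (intro AE_not_in) (simp add: negligible_iff_null_sets)
  then show ?thesis
  proof (rule AE_mp, intro AE_I2 impI allI)
    fix \<alpha> \<epsilon> :: real assume \<alpha>: "\<alpha> \<notin> \<Union>(range Z)" and "\<epsilon> > 0"
    obtain k where k: "1 / Suc k < \<epsilon>" using nat_approx_posE[OF \<open>\<epsilon> > 0\<close>] by blast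
    have "\<alpha> \<in> {of_int \<lfloor>\<alpha>\<rfloor>..of_int \<lfloor>\<alpha>\<rfloor> + 1}" by (simp add: less_imp_le)
    moreover have "\<alpha> \<notin> Z (k, \<lfloor>\<alpha>\<rfloor>)" using \<alpha> by blast
    ultimately have "Omega_infinitely_often (D \<alpha>) (\<lambda>N. real N powr (\<tau> - 1 / Suc k))"
      unfolding Z_def by auto
    then obtain c where c: "c > 0" "infinite {N. D \<alpha> N \<ge> c * real N powr (\<tau> - 1 / Suc k)}"
      unfolding Omega_infinitely_often_def by blast
    \<comment> \<open>Powers increase with the exponent only for bases at least 1, so 0 is
      removed.\<close>
    have "infinite ({N. D \<alpha> N \<ge> c * real N powr (\<tau> - 1 / Suc k)} - {0})" using c(2) by simp
    moreover have "{N. D \<alpha> N \<ge> c * real N powr (\<tau> - 1 / Suc k)} - {0} \<subseteq> {N. D \<alpha> N \<ge> c * real N powr (\<tau> - \<epsilon>)}"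
    proof
      fix N assume N: "N \<in> {N. D \<alpha> N \<ge> c * real N powr (\<tau> - 1 / Suc k)} - {0}"
      then have "c * real N powr (\<tau> - \<epsilon>) \<le> c * real N powr (\<tau> - 1 / Suc k)"
        using c k by (intro mult_left_mono powr_mono) auto
      then show "N \<in> {N. D \<alpha> N \<ge> c * real N powr (\<tau> - \<epsilon>)}" using N by auto
    qed
    ultimately have "infinite {N. D \<alpha> N \<ge> c * real N powr (\<tau> - \<epsilon>)}"
      using finite_subset by blast
    then show "Omega_infinitely_often (\<lambda>N. real N * star_discrepancy (\<lambda>n. frac (real_of_int (a n) * \<alpha>)) N)
       (\<lambda>N. real N powr (\<tau> - \<epsilon>))"
      unfolding Omega_infinitely_often_def D_def using c(1) by blast
  qed
qed

section \<open>Differences of real powers\<close>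

lemma powr_deriv:
  "0 < x \<Longrightarrow> ((\<lambda>x. x powr s) has_real_derivative (s * x powr (s - 1))) (at x)"
  by (rule has_real_derivative_powr)

lemma powr_mean_value:
  fixes x y s :: real
  assumes "0 < x" "x < y"
  obtains \<xi> where "x < \<xi>" "\<xi> < y" "y powr s - x powr s = (y - x) * (s * \<xi> powr (s - 1))"
  using MVT2[OF assms(2), of "\<lambda>t. t powr s" "\<lambda>t. s * t powr (s - 1)"] assms powr_deriv by fastforce

lemma powr_mean_value':
  fixes x y s a b :: real
  assumes "0 < a" "x \<in> {a..b}" "y \<in> {a..b}"
  obtains \<xi> where "\<xi> \<in> {a..b}" "y powr s - x powr s = (y - x) * (s * \<xi> powr (s - 1))"
proof -
  consider "x < y" | "y < x" | "x = y" by linarith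
  then show ?thesis
  proof cases
    case 1
    then obtain \<xi> where "x < \<xi>" "\<xi> < y" "y powr s - x powr s = (y - x) * (s * \<xi> powr (s - 1))"
      using powr_mean_value[of x y s] assms by auto
    then show ?thesis using assms by (intro that[of \<xi>]) auto
  next
    case 2
    then obtain \<xi> where \<xi>: "y < \<xi>" "\<xi> < x" "x powr s - y powr s = (x - y) * (s * \<xi> powr (s - 1))"
      using powr_mean_value[of y x s] assms by auto
    then have "y powr s - x powr s = (y - x) * (s * \<xi> powr (s - 1))" by (simp add: algebra_simps)
    then show ?thesis using assms \<xi> by (intro that[of \<xi>]) auto
  next
    case 3
    then show ?thesis using assms by (intro that[of x]) auto
  qed
qed

text \<open>The mean value theorem twice, once in the position and once in the shift
  \<open>h\<close>.\<close>

lemma powr_second_difference: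
  fixes x y h s :: real
  assumes "0 < x" "x < y" "0 < h"
  obtains \<zeta> where "x < \<zeta>" "\<zeta> < y + h"
    "(y + h) powr s - y powr s - ((x + h) powr s - x powr s) = (y - x) * h * (s * (s - 1) * \<zeta> powr (s - 2))"
proof -
  define \<phi> where "\<phi> t = (t + h) powr s - t powr s" for t
  have "DERIV \<phi> t :> s * (t + h) powr (s - 1) - s * t powr (s - 1)" if "x \<le> t" "t \<le> y" for t
    unfolding \<phi>_def using assms that by (auto intro!: derivative_eq_intros)
  then obtain \<xi> where \<xi>: "x < \<xi>" "\<xi> < y" "\<phi> y - \<phi> x = (y - x) * (s * (\<xi> + h) powr (s - 1) - s * \<xi> powr (s - 1))"
    using MVT2[OF assms(2), of \<phi> "\<lambda>t. s * (t + h) powr (s - 1) - s * t powr (s - 1)"] by blast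
  obtain \<zeta> where \<zeta>: "\<xi> < \<zeta>" "\<zeta> < \<xi> + h" "(\<xi> + h) powr (s - 1) - \<xi> powr (s - 1) = (\<xi> + h - \<xi>) * ((s - 1) * \<zeta> powr (s - 1 - 1))"
    using powr_mean_value[of \<xi> "\<xi> + h" "s - 1"] assms \<xi> by auto
  have "\<phi> y - \<phi> x = (y - x) * (s * ((\<xi> + h) powr (s - 1) - \<xi> powr (s - 1)))"
    using \<xi>(3) by (simp add: right_diff_distrib)
  also have "\<dots> = (y - x) * h * (s * (s - 1) * \<zeta> powr (s - 2))"
    unfolding \<zeta>(3) by simp
  finally show ?thesis
    using \<xi> \<zeta> that[of \<zeta>] by (simp add: \<phi>_def)
qed

text \<open>Times N powr (s - 3), this bounds the third derivative of t powr s on [N, 2 N]; the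
  power of 2 serves both signs of s - 3.\<close>

definition midpoint_const :: "real \<Rightarrow> real" where
  "midpoint_const s = \<bar>s * (s - 1) * (s - 2)\<bar> * 2 powr \<bar>s - 3\<bar>"

lemma midpoint_const_nonneg: "midpoint_const s \<ge> 0"
  by (simp add: midpoint_const_def)

text \<open>Taylor expansion about the midpoint: the terms of even order cancel, which leaves an
  error of third order in v - u. A factor 1/24 has been rounded up to 1.\<close>

lemma powr_midpoint:
  fixes N u v s :: real
  assumes "0 < N" "N \<le> u" "u \<le> v" "v \<le> 2 * N"
  shows "\<bar>v powr s - u powr s - (v - u) * (s * ((u + v) / 2) powr (s - 1))\<bar>
    \<le> midpoint_const s * (v - u) ^ 3 * N powr (s - 3)"
proof (cases "u = v")
  case False
  define w where "w = (u + v) / 2"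
  define t where "t = (v - u) / 2"
  have t: "t > 0" "u = w - t" "v = w + t" "w - t > 0" using assms False by (auto simp: t_def w_def field_simps)
  \<comment> \<open>Falling factorials of s; the last branch is meant for j = 3, the order of the
    Taylor remainder.\<close>
  define q where "q j = (if j = 0 then 1 else if j = 1 then s else if j = 2 then s * (s - 1)
    else s * (s - 1) * (s - 2))" for j :: nat
  define df where "df j x = q j * x powr (s - real j)" for j x
  have der: "\<forall>j x. j < 3 \<and> u \<le> x \<and> x \<le> v \<longrightarrow> DERIV (df j) x :> df (Suc j) x"
  proof (intro allI impI)
    fix j :: nat and x assume *: "j < 3 \<and> u \<le> x \<and> x \<le> v"
    then have "0 < x" using assms by linarith
    have qj: "q (Suc j) = q j * (s - j)"
      using * by (auto simp: q_def less_Suc_eq numeral_3_eq_3 numeral_2_eq_2)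
    have "df (Suc j) x = q j * ((s - real j) * x powr (s - real j - 1))"
      by (simp add: df_def qj diff_diff_eq add.commute)
    then show "DERIV (df j) x :> df (Suc j) x"
      unfolding df_def[of j] using DERIV_cmult[OF powr_deriv[OF \<open>0 < x\<close>, of "s - real j"], of "q j"] by simp
  qed
  have df0: "df 0 = (\<lambda>x. x powr s)" by (rule ext) (simp add: df_def q_def)
  obtain \<xi>\<^sub>1 where \<xi>\<^sub>1: "w < \<xi>\<^sub>1" "\<xi>\<^sub>1 < v"
    "v powr s = (\<Sum>j<3. df j w / fact j * (v - w) ^ j) + df 3 \<xi>\<^sub>1 / fact 3 * (v - w) ^ 3"
    using Taylor[of 3 df "\<lambda>x. x powr s" u v w v] der df0 t by auto
  obtain \<xi>\<^sub>2 where \<xi>\<^sub>2: "u < \<xi>\<^sub>2" "\<xi>\<^sub>2 < w"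
    "u powr s = (\<Sum>j<3. df j w / fact j * (u - w) ^ j) + df 3 \<xi>\<^sub>2 / fact 3 * (u - w) ^ 3"
    using Taylor[of 3 df "\<lambda>x. x powr s" u v w u] der df0 t by auto
  have vw: "v - w = t" "u - w = - t" using t by auto
  have "v powr s = df 0 w + df 1 w * t + df 2 w / 2 * t\<^sup>2 + df 3 \<xi>\<^sub>1 / 6 * t ^ 3"
    unfolding \<xi>\<^sub>1(3) vw by (simp add: numeral_3_eq_3 numeral_2_eq_2)
  moreover have "u powr s = df 0 w - df 1 w * t + df 2 w / 2 * t\<^sup>2 - df 3 \<xi>\<^sub>2 / 6 * t ^ 3"
    unfolding \<xi>\<^sub>2(3) vw by (simp add: numeral_3_eq_3 numeral_2_eq_2)
  ultimately have "v powr s - u powr s = 2 * t * df 1 w + (df 3 \<xi>\<^sub>1 + df 3 \<xi>\<^sub>2) / 6 * t ^ 3"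
    by (simp add: algebra_simps add_divide_distrib)
  then have eq: "v powr s - u powr s - (v - u) * (s * w powr (s - 1)) = (df 3 \<xi>\<^sub>1 + df 3 \<xi>\<^sub>2) / 6 * t ^ 3"
    using t by (simp add: df_def q_def)
  have bd: "\<bar>df 3 \<xi>\<bar> \<le> midpoint_const s * N powr (s - 3)" if "u < \<xi>" "\<xi> < v" for \<xi>
  proof -
    have "\<bar>df 3 \<xi>\<bar> = \<bar>s * (s - 1) * (s - 2)\<bar> * \<xi> powr (s - 3)"
      by (simp add: df_def q_def abs_mult)
    also have "\<dots> \<le> \<bar>s * (s - 1) * (s - 2)\<bar> * (2 powr \<bar>s - 3\<bar> * N powr (s - 3))"
      using that assms by (intro mult_left_mono powr_le_scale) auto
    finally show ?thesis by (simp add: midpoint_const_def)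
  qed
  have "\<bar>(df 3 \<xi>\<^sub>1 + df 3 \<xi>\<^sub>2) / 6 * t ^ 3\<bar> \<le> (midpoint_const s * N powr (s - 3)) * (8 * t ^ 3)"
  proof -
    have "\<bar>df 3 \<xi>\<^sub>1 + df 3 \<xi>\<^sub>2\<bar> \<le> 2 * (midpoint_const s * N powr (s - 3))"
      using bd[of \<xi>\<^sub>1] bd[of \<xi>\<^sub>2] \<xi>\<^sub>1 \<xi>\<^sub>2 t by linarith
    then have "\<bar>df 3 \<xi>\<^sub>1 + df 3 \<xi>\<^sub>2\<bar> / 6 \<le> 8 * (midpoint_const s * N powr (s - 3))"
      using midpoint_const_nonneg[of s] mult_nonneg_nonneg[OF midpoint_const_nonneg, of "N powr (s - 3)" s]
      by simp
    then have "\<bar>df 3 \<xi>\<^sub>1 + df 3 \<xi>\<^sub>2\<bar> / 6 * t ^ 3 \<le> 8 * (midpoint_const s * N powr (s - 3)) * t ^ 3"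
      using t by (intro mult_right_mono) auto
    then show ?thesis using t by (simp add: abs_mult)
  qed
  moreover have "8 * t ^ 3 = (v - u) ^ 3" unfolding t_def by (simp add: power_divide)
  ultimately show ?thesis unfolding eq w_def[symmetric] by (simp add: mult_ac)
qed simp

section \<open>Coincidences of differences over unequal gaps\<close>

text \<open>Two differences of \<open>t powr c\<close> over gaps \<open>h > k\<close> can only agree if the midpoints are
  \<open>N (h - k) / ((c - 1) h)\<close> apart, up to a small error.\<close>

lemma gap_relation:
  fixes c :: real
  assumes c: "c \<ge> 2"
  obtains A D \<eta> :: real where "A > 0" "D > 0" "\<eta> > 0"
    "\<And>N M x x' y y' h k \<delta> :: real. \<lbrakk>N \<ge> 1; 0 \<le> M; M \<le> \<eta> * N; M ^ 3 \<ge> N;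
      N \<le> x; N \<le> y; x' \<le> N + M; y' \<le> N + M; h = x' - x; k = y' - y; 1 \<le> k; k + 1 \<le> h;
      \<delta> = (y + y') / 2 - (x + x') / 2; \<bar>(x' powr c - x powr c) - (y' powr c - y powr c)\<bar> \<le> 2\<rbrakk>
      \<Longrightarrow> \<bar>h * \<delta> - (h - k) * N / (c - 1)\<bar> \<le> A * M ^ 3 / N \<and> h - k \<le> D * M\<^sup>2 / N"
proof -
  define K where "K = midpoint_const c"
  define A\<^sub>1 where "A\<^sub>1 = (2 * K + 2) / (c * (c - 1))"
  define B where "B = (c - 1) * 2 powr (c - 2)"
  define D where "D = (2 + 2 * A\<^sub>1) * (c - 1)"
  define A where "A = (2 + 2 * A\<^sub>1) * B + A\<^sub>1"
  \<comment> \<open>Ensures M <= N and B M <= N / 2. The latter keeps N - B M nonnegative and lets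
    half of d N absorb the error d B M.\<close>
  define \<eta> where "\<eta> = min 1 (1 / (2 * B))"
  have K: "K \<ge> 0" by (simp add: K_def midpoint_const_nonneg)
  have cc: "c * (c - 1) > 0" "c - 1 > 0" using c by auto
  have A1: "A\<^sub>1 > 0" unfolding A\<^sub>1_def using K cc by simp
  have B: "B > 0" unfolding B_def using c by simp
  have "A > 0" unfolding A_def using A1 B by (simp add: add_pos_pos)
  moreover have "D > 0" unfolding D_def using A1 c by simp
  moreover have "\<eta> > 0" unfolding \<eta>_def using B by simp
  moreover have "\<bar>h * \<delta> - (h - k) * N / (c - 1)\<bar> \<le> A * M ^ 3 / N \<and> h - k \<le> D * M\<^sup>2 / N"
    if N: "N \<ge> 1" and M: "0 \<le> M" "M \<le> \<eta> * N" "M ^ 3 \<ge> N" and xy: "N \<le> x" "N \<le> y" "x' \<le> N + M" "y' \<le> N + M"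
      and h: "h = x' - x" and k: "k = y' - y" "1 \<le> k" "k + 1 \<le> h"
      and \<delta>: "\<delta> = (y + y') / 2 - (x + x') / 2"
      and sol: "\<bar>(x' powr c - x powr c) - (y' powr c - y powr c)\<bar> \<le> 2"
    for N M x x' y y' h k \<delta> :: real
  proof -
    have "\<eta> * N \<le> 1 * N" using N by (intro mult_right_mono) (auto simp: \<eta>_def)
    then have MN: "M \<le> N" using M by linarith
    have "\<eta> * N \<le> 1 / (2 * B) * N" using N by (intro mult_right_mono) (auto simp: \<eta>_def)
    then have "M \<le> 1 / (2 * B) * N" using M by linarith
    then have BM: "B * M \<le> N / 2" using B by (simp add: field_simps)
    \<comment> \<open>The order of the midpoint error. Since M^3 >= N and c >= 2 it is at least 1,
      so it also absorbs the rounding error 2.\<close>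
    define W where "W = M ^ 3 * N powr (c - 3)"
    have W1: "1 \<le> W"
    proof -
      have "1 \<le> N powr (c - 2)" using N c by (intro ge_one_powr_ge_zero) auto
      also have "\<dots> = N * N powr (c - 3)" using N powr_add[of N 1 "c - 3"] by simp
      also have "\<dots> \<le> W" unfolding W_def using M by (intro mult_right_mono) auto
      finally show ?thesis .
    qed
    define \<mu> \<nu> where "\<mu> = (x + x') / 2" and "\<nu> = (y + y') / 2"
    have hM: "0 \<le> h" "h \<le> M" "0 \<le> k" "k \<le> M" using h k xy by auto
    have "\<bar>x' powr c - x powr c - h * (c * \<mu> powr (c - 1))\<bar> \<le> K * h ^ 3 * N powr (c - 3)"
      unfolding K_def h \<mu>_def using xy MN N h k by (intro powr_midpoint) auto
    also have "\<dots> \<le> K * M ^ 3 * N powr (c - 3)"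
      using K hM by (intro mult_right_mono mult_left_mono power_mono) auto
    finally have 1: "\<bar>x' powr c - x powr c - h * (c * \<mu> powr (c - 1))\<bar> \<le> K * W" by (simp add: W_def)
    have "\<bar>y' powr c - y powr c - k * (c * \<nu> powr (c - 1))\<bar> \<le> K * k ^ 3 * N powr (c - 3)"
      unfolding K_def k(1) \<nu>_def using xy MN N k by (intro powr_midpoint) auto
    also have "\<dots> \<le> K * M ^ 3 * N powr (c - 3)"
      using K hM by (intro mult_right_mono mult_left_mono power_mono) auto
    finally have 2: "\<bar>y' powr c - y powr c - k * (c * \<nu> powr (c - 1))\<bar> \<le> K * W" by (simp add: W_def)
    have 3: "\<bar>h * (c * \<mu> powr (c - 1)) - k * (c * \<nu> powr (c - 1))\<bar> \<le> (2 * K + 2) * W"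
      using 1 2 sol W1 by (simp add: distrib_right)
    have \<mu>\<nu>: "\<mu> \<in> {N..N + M}" "\<nu> \<in> {N..N + M}"
      unfolding \<mu>_def \<nu>_def using xy h k by auto
    obtain \<zeta> where \<zeta>: "\<zeta> \<in> {N..N + M}" "\<nu> powr (c - 1) - \<mu> powr (c - 1) = (\<nu> - \<mu>) * ((c - 1) * \<zeta> powr (c - 1 - 1))"
      using powr_mean_value'[of N \<mu> "N + M" \<nu> "c - 1"] N \<mu>\<nu> by auto
    define Z where "Z = \<zeta> powr (c - 2)"
    have "\<nu> powr (c - 1) - \<mu> powr (c - 1) = \<delta> * ((c - 1) * Z)"
      using \<zeta>(2) by (simp add: \<delta> \<mu>_def \<nu>_def Z_def)
    then have \<mu>_eq: "\<mu> powr (c - 1) = \<nu> powr (c - 1) - \<delta> * ((c - 1) * Z)" by simp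
    have Z: "Z \<ge> N powr (c - 2)" "Z > 0" "Z \<le> (N + M) powr (c - 2)"
      unfolding Z_def using \<zeta> N c by (auto intro!: powr_mono2)
    \<comment> \<open>Expressing the power at one midpoint through that at the other isolates h
      \<delta> against (h - k) / (c - 1) times a quotient that turns out to be N + O(M).\<close>
    have "h * (c * \<mu> powr (c - 1)) - k * (c * \<nu> powr (c - 1))
        = c * (c - 1) * Z * ((h - k) / (c - 1) * (\<nu> powr (c - 1) / Z) - h * \<delta>)"
      unfolding \<mu>_eq using Z cc by (simp add: field_simps)
    then have "c * (c - 1) * Z * \<bar>(h - k) / (c - 1) * (\<nu> powr (c - 1) / Z) - h * \<delta>\<bar> \<le> (2 * K + 2) * W"
      using 3 cc Z by (simp add: abs_mult)
    moreover have "c * (c - 1) * N powr (c - 2) \<le> c * (c - 1) * Z"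
      using cc Z by (intro mult_left_mono) auto
    ultimately have "c * (c - 1) * N powr (c - 2) * \<bar>(h - k) / (c - 1) * (\<nu> powr (c - 1) / Z) - h * \<delta>\<bar> \<le> (2 * K + 2) * W"
      by (meson abs_ge_zero mult_right_mono order_trans)
    moreover have "W = N powr (c - 2) * (M ^ 3 / N)"
      using N powr_diff[of N "c - 2" 1] by (simp add: W_def)
    ultimately have "N powr (c - 2) * (c * (c - 1) * \<bar>(h - k) / (c - 1) * (\<nu> powr (c - 1) / Z) - h * \<delta>\<bar>)
        \<le> N powr (c - 2) * ((2 * K + 2) * (M ^ 3 / N))" by (simp add: mult_ac)
    then have "c * (c - 1) * \<bar>(h - k) / (c - 1) * (\<nu> powr (c - 1) / Z) - h * \<delta>\<bar> \<le> (2 * K + 2) * (M ^ 3 / N)"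
      by (rule mult_left_le_imp_le) (use N in simp)
    then have 4: "\<bar>(h - k) / (c - 1) * (\<nu> powr (c - 1) / Z) - h * \<delta>\<bar> \<le> A\<^sub>1 * (M ^ 3 / N)"
      unfolding A\<^sub>1_def times_divide_eq_left using cc by (subst pos_le_divide_eq) (simp_all add: mult_ac)
    have ratio: "\<bar>\<nu> powr (c - 1) / Z - N\<bar> \<le> B * M"
    proof -
      have pw: "(N + M) powr (c - 1) \<le> (N + B * M) * N powr (c - 2)"
      proof -
        obtain \<xi> where \<xi>: "\<xi> \<in> {N..N + M}" "(N + M) powr (c - 1) - N powr (c - 1) = (N + M - N) * ((c - 1) * \<xi> powr (c - 1 - 1))"
          using powr_mean_value'[of N N "N + M" "N + M" "c - 1"] N M by auto
        have "\<xi> powr (c - 2) \<le> 2 powr \<bar>c - 2\<bar> * N powr (c - 2)"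
          using \<xi> N MN by (intro powr_le_scale) auto
        then have "M * ((c - 1) * \<xi> powr (c - 2)) \<le> M * ((c - 1) * (2 powr (c - 2) * N powr (c - 2)))"
          using M c by (intro mult_left_mono) auto
        then have "(N + M) powr (c - 1) \<le> N powr (c - 1) + B * M * N powr (c - 2)"
          using \<xi>(2) by (simp add: B_def mult_ac)
        moreover have "N powr (c - 1) = N * N powr (c - 2)" using N powr_add[of N 1 "c - 2"] by simp
        ultimately show ?thesis by (simp add: distrib_right)
      qed
      have "\<nu> powr (c - 1) \<le> (N + M) powr (c - 1)" using \<mu>\<nu> N c by (intro powr_mono2) auto
      also note pw
      also have "(N + B * M) * N powr (c - 2) \<le> (N + B * M) * Z" using Z N M B by (intro mult_left_mono) auto
      finally have up: "\<nu> powr (c - 1) / Z \<le> N + B * M" using Z by (simp add: field_simps)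
      have "Z * (N + M) \<le> (N + M) powr (c - 2) * (N + M)" using Z N M by (intro mult_right_mono) auto
      also have "\<dots> = (N + M) powr (c - 1)" using N M powr_add[of "N + M" "c - 2" 1] by simp
      also note pw
      finally have "Z * N \<le> (N + B * M) * N powr (c - 2)"
        using Z M mult_left_mono[of N "N + M" Z] by linarith
      then have "(N - B * M) * (Z * N) \<le> (N - B * M) * ((N + B * M) * N powr (c - 2))"
        using BM N by (intro mult_left_mono) auto
      also have "\<dots> = (N\<^sup>2 - (B * M)\<^sup>2) * N powr (c - 2)" by (simp add: power2_eq_square algebra_simps)
      also have "\<dots> \<le> N\<^sup>2 * N powr (c - 2)" by (intro mult_right_mono) auto
      also have "\<dots> = N * N powr (c - 1)" using N powr_add[of N 1 "c - 2"] by (simp add: power2_eq_square)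
      also have "\<dots> \<le> N * \<nu> powr (c - 1)" using \<mu>\<nu> N c by (intro mult_left_mono powr_mono2) auto
      finally have "N * ((N - B * M) * Z) \<le> N * \<nu> powr (c - 1)" by (simp add: mult_ac)
      then have "(N - B * M) * Z \<le> \<nu> powr (c - 1)" using N by simp
      then have "N - B * M \<le> \<nu> powr (c - 1) / Z" using Z by (simp add: field_simps)
      then show ?thesis using up by linarith
    qed
    define d where "d = (h - k) / (c - 1)"
    have d: "d > 0" unfolding d_def using k cc by simp
    have "\<bar>d * (\<nu> powr (c - 1) / Z) - d * N\<bar> \<le> d * (B * M)"
    proof -
      have "\<bar>d * (\<nu> powr (c - 1) / Z - N)\<bar> \<le> d * (B * M)"
        unfolding abs_mult using ratio d by (simp add: mult_left_mono)
      then show ?thesis by (simp only: right_diff_distrib)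
    qed
    note dX = this
    have triangle: "\<bar>p - q\<bar> \<le> u \<Longrightarrow> \<bar>p - r\<bar> \<le> v \<Longrightarrow> \<bar>q - r\<bar> \<le> v + u" for p q r u v :: real
      by linarith
    have 5: "\<bar>h * \<delta> - d * N\<bar> \<le> d * (B * M) + A\<^sub>1 * (M ^ 3 / N)"
      using 4 dX unfolding d_def[symmetric] by (rule triangle)
    have M3: "M ^ 3 / N \<le> M\<^sup>2"
    proof -
      have "M ^ 3 \<le> M\<^sup>2 * N" unfolding power3_eq_cube power2_eq_square using MN M by (intro mult_left_mono) auto
      then show ?thesis using N by (simp add: field_simps)
    qed
    \<comment> \<open>A bootstrap: the trivial bound \<delta> <= M gives d = O(M^2 / N), and with
      this the error d B M drops to the order M^3 / N.\<close>
    have "\<delta> \<le> M" using \<mu>\<nu> unfolding \<delta> \<mu>_def \<nu>_def atLeastAtMost_iff by linarith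
    then have "h * \<delta> \<le> h * M" using hM by (intro mult_left_mono) auto
    also have "\<dots> \<le> M\<^sup>2" unfolding power2_eq_square using hM by (intro mult_right_mono) auto
    finally have "h * \<delta> \<le> M\<^sup>2" .
    moreover have "d * (B * M) \<le> d * (N / 2)" using BM d by (intro mult_left_mono) auto
    moreover have "A\<^sub>1 * (M ^ 3 / N) \<le> A\<^sub>1 * M\<^sup>2" using M3 A1 by (intro mult_left_mono) auto
    moreover have "d * N / 2 = d * N - d * (N / 2)" by simp
    ultimately have "d * N / 2 \<le> M\<^sup>2 + A\<^sub>1 * M\<^sup>2"
      using 5 by linarith
    then have dN: "d * N \<le> (2 + 2 * A\<^sub>1) * M\<^sup>2" by (simp add: algebra_simps)
    then have d_le: "d \<le> (2 + 2 * A\<^sub>1) * M\<^sup>2 / N" using N by (simp add: field_simps)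
    then have "d * (c - 1) \<le> (2 + 2 * A\<^sub>1) * M\<^sup>2 / N * (c - 1)" using cc by (intro mult_right_mono) auto
    moreover have "d * (c - 1) = h - k" using cc by (simp add: d_def)
    ultimately have "h - k \<le> D * M\<^sup>2 / N" by (simp add: D_def mult_ac)
    moreover have "\<bar>h * \<delta> - (h - k) * N / (c - 1)\<bar> \<le> A * M ^ 3 / N"
    proof -
      have "d * (B * M) \<le> (2 + 2 * A\<^sub>1) * M\<^sup>2 / N * (B * M)" using d_le B M by (intro mult_right_mono) auto
      also have "\<dots> = (2 + 2 * A\<^sub>1) * B * (M ^ 3 / N)" by (simp add: power2_eq_square power3_eq_cube)
      finally have "\<bar>h * \<delta> - d * N\<bar> \<le> (2 + 2 * A\<^sub>1) * B * (M ^ 3 / N) + A\<^sub>1 * (M ^ 3 / N)" using 5 by linarith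
      also have "\<dots> = A * M ^ 3 / N" by (simp add: A_def distrib_right add_divide_distrib)
      finally show ?thesis by (simp add: d_def)
    qed
    ultimately show ?thesis by blast
  qed
  ultimately show ?thesis by (rule that)
qed

text \<open>With the gaps h, k and the offset e fixed, consider the difference of the two
  differences as a function of the position. Its derivative is about c (c - 1) (h \<mu>^(c-2) - k
  \<nu>^(c-2)) for the midpoints \<mu>, \<nu>. As \<nu> - \<mu> = \<delta> is at most about (h - k)
  N / ((c - 1) h), moving from \<mu> to \<nu> cancels at most a share (c - 2) / (c - 1) of the main
  term (h - k) N^(c-2). The remaining share \<kappa> = 1 / (c - 1) keeps the derivative at least
  1/2, so two positions with values in [-2, 2] are at most 8 apart.\<close>

lemma gap_solutions_close:
  fixes c A :: real
  assumes c: "c \<ge> 2" and A: "A > 0"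
  obtains \<eta> :: real where "\<eta> > 0"
    "\<And>N M h k e \<delta> x z :: real. \<lbrakk>N \<ge> 1; 0 \<le> M; M \<le> \<eta> * N; M ^ 3 \<le> \<eta> * N\<^sup>2; 1 \<le> k; k + 1 \<le> h;
      \<delta> = e - (h - k) / 2; \<delta> \<ge> 0; h * \<delta> \<le> (h - k) * N / (c - 1) + A * M ^ 3 / N;
      N \<le> x; N \<le> x + e; x + h \<le> N + M; x + e + k \<le> N + M;
      N \<le> z; N \<le> z + e; z + h \<le> N + M; z + e + k \<le> N + M;
      \<bar>((x + h) powr c - x powr c) - ((x + e + k) powr c - (x + e) powr c)\<bar> \<le> 2;
      \<bar>((z + h) powr c - z powr c) - ((z + e + k) powr c - (z + e) powr c)\<bar> \<le> 2; x < z\<rbrakk>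
      \<Longrightarrow> z - x \<le> 8"
proof -
  define \<kappa> where "\<kappa> = 1 / (c - 1)"
  define K where "K = midpoint_const (c - 1)"
  \<comment> \<open>Chosen so that (1 + \<open>\<eta>\<^sub>1\<close>)^(c - 1) = 1 + \<kappa> / 4, a
    bound for the factor by which t^(c - 2) grows along the block.\<close>
  define \<eta>\<^sub>1 where "\<eta>\<^sub>1 = (1 + \<kappa> / 4) powr (1 / (c - 1)) - 1"
  define \<eta> where "\<eta> = min 1 (min \<eta>\<^sub>1 (min (\<kappa> / (8 * (c * A))) (1 / (8 * (K + 1)))))"
  have c1: "c - 1 > 0" using c by simp
  have \<kappa>: "\<kappa> > 0" "(c - 2) * \<kappa> = 1 - \<kappa>" "\<kappa> \<le> 1" unfolding \<kappa>_def using c by (auto simp: field_simps)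
  have K: "K \<ge> 0" by (simp add: K_def midpoint_const_nonneg)
  have "(1::real) < (1 + \<kappa> / 4) powr (1 / (c - 1))" using \<kappa> c by (intro gr_one_powr) auto
  then have "\<eta>\<^sub>1 > 0" by (simp add: \<eta>\<^sub>1_def)
  then have \<eta>: "\<eta> > 0" unfolding \<eta>_def using \<kappa> c A K by (auto intro!: divide_pos_pos mult_pos_pos)
  have \<eta>_le: "\<eta> \<le> 1" "\<eta> \<le> \<eta>\<^sub>1" "\<eta> \<le> \<kappa> / (8 * (c * A))" "\<eta> \<le> 1 / (8 * (K + 1))" by (auto simp: \<eta>_def)
  have cA\<eta>: "(c - 2) * (A * \<eta>) * 2 \<le> \<kappa> / 4"
  proof -
    have "(c - 2) * (A * \<eta>) * 2 \<le> c * (A * \<eta>) * 2" using A \<eta> by (intro mult_right_mono) auto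
    also have "\<dots> \<le> c * (A * (\<kappa> / (8 * (c * A)))) * 2"
      using \<eta>_le A c by (intro mult_right_mono mult_left_mono) auto
    also have "\<dots> = \<kappa> / 4" using A c by (simp add: field_simps)
    finally show ?thesis .
  qed
  have K\<eta>: "2 * K * \<eta> \<le> 1 / 4"
  proof -
    have "2 * K * \<eta> \<le> 2 * (K + 1) * (1 / (8 * (K + 1)))" using \<eta>_le K \<eta> by (intro mult_mono) auto
    also have "\<dots> = 1 / 4" using K by (simp add: field_simps)
    finally show ?thesis .
  qed
  have "z - x \<le> 8"
    if N: "N \<ge> 1" and M: "0 \<le> M" "M \<le> \<eta> * N" "M ^ 3 \<le> \<eta> * N\<^sup>2" and hk: "1 \<le> k" "k + 1 \<le> h"
      and \<delta>: "\<delta> = e - (h - k) / 2" "\<delta> \<ge> 0" "h * \<delta> \<le> (h - k) * N / (c - 1) + A * M ^ 3 / N"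
      and x: "N \<le> x" "N \<le> x + e" "x + h \<le> N + M" "x + e + k \<le> N + M"
      and z: "N \<le> z" "N \<le> z + e" "z + h \<le> N + M" "z + e + k \<le> N + M"
      and sol: "\<bar>((x + h) powr c - x powr c) - ((x + e + k) powr c - (x + e) powr c)\<bar> \<le> 2"
        "\<bar>((z + h) powr c - z powr c) - ((z + e + k) powr c - (z + e) powr c)\<bar> \<le> 2"
      and "x < z"
    for N M h k e \<delta> x z :: real
  proof -
    define G where "G s = ((s + h) powr c - s powr c) - ((s + e + k) powr c - (s + e) powr c)" for s
    define g where "g s = c * ((s + h) powr (c - 1) - s powr (c - 1) - ((s + e + k) powr (c - 1) - (s + e) powr (c - 1)))" for s
    have "DERIV G s :> g s" if "x \<le> s" "s \<le> z" for s
      unfolding G_def g_def using that x N hk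
      by (auto intro!: derivative_eq_intros simp: algebra_simps)
    then obtain \<xi> where \<xi>: "x < \<xi>" "\<xi> < z" "G z - G x = (z - x) * g \<xi>"
      using MVT2[OF \<open>x < z\<close>, of G g] by blast
    have "\<eta> * N \<le> 1 * N" using N \<eta>_le by (intro mult_right_mono) auto
    then have MN: "M \<le> N" using M by linarith
    define W where "W = N powr (c - 2)"
    have W1: "W \<ge> 1" unfolding W_def using N c by (intro ge_one_powr_ge_zero) auto
    define d where "d = h - k"
    have d: "d \<ge> 1" using hk by (simp add: d_def)
    define \<mu> \<nu> where "\<mu> = \<xi> + h / 2" and "\<nu> = \<xi> + e + k / 2"
    have \<nu>\<mu>: "\<nu> - \<mu> = \<delta>" unfolding \<mu>_def \<nu>_def \<delta> by (simp add: field_simps)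
    have range: "\<mu> \<in> {N..N + M}" "\<nu> \<in> {N..N + M}"
      unfolding \<mu>_def \<nu>_def using \<xi> x z hk by auto
    have hM: "h \<le> M" "k \<le> M" using x hk by auto
    have err: "K * u ^ 3 * N powr (c - 1 - 3) \<le> K * (\<eta> * W)" if "0 \<le> u" "u \<le> M" for u
    proof -
      have "u ^ 3 \<le> \<eta> * N\<^sup>2" using power_mono[OF that(2,1), of 3] M by linarith
      then have "K * u ^ 3 * N powr (c - 1 - 3) \<le> K * (\<eta> * N\<^sup>2) * N powr (c - 1 - 3)"
        using K by (intro mult_right_mono mult_left_mono) auto
      also have "\<dots> = K * (\<eta> * (N powr 2 * N powr (c - 1 - 3)))" using N by simp
      also have "N powr 2 * N powr (c - 1 - 3) = W" unfolding W_def powr_add[symmetric] by simp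
      finally show ?thesis .
    qed
    have "\<bar>(\<xi> + h) powr (c - 1) - \<xi> powr (c - 1) - (\<xi> + h - \<xi>) * ((c - 1) * ((\<xi> + (\<xi> + h)) / 2) powr (c - 1 - 1))\<bar>
       \<le> midpoint_const (c - 1) * (\<xi> + h - \<xi>) ^ 3 * N powr (c - 1 - 3)"
      using \<xi> x z hk N MN by (intro powr_midpoint) auto
    moreover have "(\<xi> + (\<xi> + h)) / 2 = \<mu>" by (simp add: \<mu>_def)
    ultimately have 1: "\<bar>(\<xi> + h) powr (c - 1) - \<xi> powr (c - 1) - h * ((c - 1) * \<mu> powr (c - 2))\<bar> \<le> K * (\<eta> * W)"
      using err[of h] hk hM by (simp add: K_def)
    have "\<bar>(\<xi> + e + k) powr (c - 1) - (\<xi> + e) powr (c - 1) - (\<xi> + e + k - (\<xi> + e)) * ((c - 1) * ((\<xi> + e + (\<xi> + e + k)) / 2) powr (c - 1 - 1))\<bar>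
       \<le> midpoint_const (c - 1) * (\<xi> + e + k - (\<xi> + e)) ^ 3 * N powr (c - 1 - 3)"
      using \<xi> x z hk N MN by (intro powr_midpoint) auto
    moreover have "(\<xi> + e + (\<xi> + e + k)) / 2 = \<nu>" by (simp add: \<nu>_def)
    ultimately have 2: "\<bar>(\<xi> + e + k) powr (c - 1) - (\<xi> + e) powr (c - 1) - k * ((c - 1) * \<nu> powr (c - 2))\<bar> \<le> K * (\<eta> * W)"
      using err[of k] hk hM by (simp add: K_def)
    \<comment> \<open>The budget in units of W: from d, at most d (1 - 3/4 \<kappa>) + \<kappa> / 4
      is lost between \<mu> and \<nu>, and d >= 1 leaves at least d \<kappa> / 2.\<close>
    have main: "h * \<mu> powr (c - 2) - k * \<nu> powr (c - 2) \<ge> d * (\<kappa> / 2) * W"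
    proof -
      obtain \<zeta> where \<zeta>: "\<zeta> \<in> {N..N + M}" "\<nu> powr (c - 2) - \<mu> powr (c - 2) = (\<nu> - \<mu>) * ((c - 2) * \<zeta> powr (c - 2 - 1))"
        using powr_mean_value'[of N \<mu> "N + M" \<nu> "c - 2"] range N by auto
      define \<theta> where "\<theta> = (1 + \<eta>\<^sub>1) powr (c - 2)"
      have \<theta>: "0 \<le> \<theta>" "\<theta> \<le> 1 + \<kappa> / 4"
      proof -
        have "\<theta> \<le> (1 + \<eta>\<^sub>1) powr (c - 1)" unfolding \<theta>_def using \<open>\<eta>\<^sub>1 > 0\<close> by (intro powr_mono) auto
        also have "\<dots> = 1 + \<kappa> / 4" unfolding \<eta>\<^sub>1_def using c1 \<kappa> by (simp add: powr_powr)
        finally show "\<theta> \<le> 1 + \<kappa> / 4" .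
      qed (simp add: \<theta>_def)
      have "\<zeta> powr (c - 2 - 1) = \<zeta> powr (c - 2) / \<zeta>" using \<zeta> N powr_diff[of \<zeta> "c - 2" 1] by simp
      also have "\<dots> \<le> (\<theta> * W) / N"
      proof (rule frac_le)
        have "\<zeta> \<le> N + M" using \<zeta> by simp
        also have "\<dots> \<le> (1 + \<eta>\<^sub>1) * N"
          using M(2) mult_right_mono[OF \<eta>_le(2), of N] N unfolding distrib_right by linarith
        finally have "\<zeta> powr (c - 2) \<le> ((1 + \<eta>\<^sub>1) * N) powr (c - 2)" using \<zeta> N c by (intro powr_mono2) auto
        also have "\<dots> = \<theta> * W" using \<open>\<eta>\<^sub>1 > 0\<close> N by (simp add: \<theta>_def W_def powr_mult)
        finally show "\<zeta> powr (c - 2) \<le> \<theta> * W" .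
      qed (use \<zeta> N \<theta> W1 in auto)
      finally have \<zeta>_le: "\<zeta> powr (c - 2 - 1) \<le> (\<theta> * W) / N" .
      have "k * \<delta> \<le> h * \<delta>" using \<delta> hk by (intro mult_right_mono) auto
      also have "\<dots> \<le> d * \<kappa> * N + A * (\<eta> * N)"
      proof -
        have "M ^ 3 / N \<le> \<eta> * N" using M N by (simp add: field_simps power2_eq_square)
        then have "A * (M ^ 3 / N) \<le> A * (\<eta> * N)" using A by (intro mult_left_mono) auto
        then show ?thesis using \<delta>(3) by (simp add: d_def \<kappa>_def)
      qed
      finally have k\<delta>: "k * \<delta> \<le> (d * \<kappa> + A * \<eta>) * N" by (simp add: algebra_simps)
      have "k * (\<nu> powr (c - 2) - \<mu> powr (c - 2)) = (k * \<delta>) * ((c - 2) * \<zeta> powr (c - 2 - 1))"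
        unfolding \<zeta>(2) \<nu>\<mu> by simp
      also have "\<dots> \<le> ((d * \<kappa> + A * \<eta>) * N) * ((c - 2) * ((\<theta> * W) / N))"
      proof (rule mult_mono)
        show "(c - 2) * \<zeta> powr (c - 2 - 1) \<le> (c - 2) * ((\<theta> * W) / N)"
          using \<zeta>_le c by (intro mult_left_mono) auto
      qed (use k\<delta> c \<kappa> A \<eta> d N in auto)
      also have "\<dots> = (d * ((c - 2) * \<kappa>) * \<theta> + (c - 2) * (A * \<eta>) * \<theta>) * W"
        using N by (simp add: field_simps)
      also have "\<dots> \<le> (d * (1 - 3 / 4 * \<kappa>) + \<kappa> / 4) * W"
      proof (rule mult_right_mono)
        have "(c - 2) * \<kappa> * \<theta> \<le> (1 - \<kappa>) * (1 + \<kappa> / 4)"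
          unfolding \<kappa>(2) using \<theta> \<kappa> by (intro mult_left_mono) auto
        also have "\<dots> \<le> 1 - 3 / 4 * \<kappa>" using \<kappa> by (simp add: algebra_simps)
        finally have "d * ((c - 2) * \<kappa> * \<theta>) \<le> d * (1 - 3 / 4 * \<kappa>)" using d by (intro mult_left_mono) auto
        moreover have "(c - 2) * (A * \<eta>) * \<theta> \<le> (c - 2) * (A * \<eta>) * 2"
          using \<theta> \<kappa> c A \<eta> by (intro mult_left_mono) auto
        ultimately show "d * ((c - 2) * \<kappa>) * \<theta> + (c - 2) * (A * \<eta>) * \<theta> \<le> d * (1 - 3 / 4 * \<kappa>) + \<kappa> / 4"
          using cA\<eta> by (simp add: mult.assoc)
      qed (use W1 in simp)
      finally have up: "k * (\<nu> powr (c - 2) - \<mu> powr (c - 2)) \<le> (d * (1 - 3 / 4 * \<kappa>) + \<kappa> / 4) * W" .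
      have "W \<le> \<mu> powr (c - 2)" unfolding W_def using range N c by (intro powr_mono2) auto
      then have "d * W \<le> d * \<mu> powr (c - 2)" using d by (intro mult_left_mono) auto
      moreover have "h * \<mu> powr (c - 2) - k * \<nu> powr (c - 2) = d * \<mu> powr (c - 2) - k * (\<nu> powr (c - 2) - \<mu> powr (c - 2))"
        by (simp add: d_def algebra_simps)
      moreover have "(d * (1 - 3 / 4 * \<kappa>) + \<kappa> / 4) * W = d * W - (d * (3 / 4 * \<kappa>) - \<kappa> / 4) * W"
        by (simp add: algebra_simps)
      moreover have "(d * (3 / 4 * \<kappa>) - \<kappa> / 4) * W \<ge> d * (\<kappa> / 2) * W"
      proof (rule mult_right_mono)
        have "1 * \<kappa> \<le> d * \<kappa>" using d \<kappa> by (intro mult_right_mono) auto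
        moreover have "d * (3 / 4 * \<kappa>) - \<kappa> / 4 - d * (\<kappa> / 2) = (d * \<kappa> - 1 * \<kappa>) / 4"
          by (simp add: field_simps)
        ultimately show "d * (\<kappa> / 2) \<le> d * (3 / 4 * \<kappa>) - \<kappa> / 4" by linarith
      qed (use W1 in simp)
      ultimately show ?thesis using up by linarith
    qed
    have "(c - 1) * (d * (\<kappa> / 2) * W) = d * W / 2" unfolding \<kappa>_def using c1 by (simp add: field_simps)
    moreover have "(c - 1) * (d * (\<kappa> / 2) * W) \<le> (c - 1) * (h * \<mu> powr (c - 2) - k * \<nu> powr (c - 2))"
      using main c1 by (intro mult_left_mono) auto
    moreover have "(c - 1) * (h * \<mu> powr (c - 2) - k * \<nu> powr (c - 2)) = h * ((c - 1) * \<mu> powr (c - 2)) - k * ((c - 1) * \<nu> powr (c - 2))"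
      by (simp add: algebra_simps)
    moreover have "W \<le> d * W" using d W1 mult_right_mono[of 1 d W] by simp
    moreover have "2 * (K * (\<eta> * W)) \<le> W / 4" using mult_right_mono[OF K\<eta>, of W] W1 by simp
    ultimately have "W / 4 \<le> (\<xi> + h) powr (c - 1) - \<xi> powr (c - 1) - ((\<xi> + e + k) powr (c - 1) - (\<xi> + e) powr (c - 1))"
      using 1 2 by linarith
    then have "1 / 4 \<le> (\<xi> + h) powr (c - 1) - \<xi> powr (c - 1) - ((\<xi> + e + k) powr (c - 1) - (\<xi> + e) powr (c - 1))"
      using W1 by linarith
    then have "2 * (1 / 4) \<le> g \<xi>" unfolding g_def using c by (intro mult_mono) auto
    then have "(z - x) * (1 / 2) \<le> G z - G x" unfolding \<xi>(3) using \<open>x < z\<close> by (intro mult_left_mono) auto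
    moreover have "G z - G x \<le> 4" using sol unfolding G_def by linarith
    ultimately have "(z - x) * (1 / 2) \<le> 4" by (rule order_trans)
    then show ?thesis by simp
  qed
  with \<eta> show ?thesis by (rule that)
qed

section \<open>Counting by fibres\<close>

lemma card_le_fibers:
  fixes K :: real
  assumes "finite Z" "finite A" "\<pi> ` Z \<subseteq> A" "\<And>b. b \<in> A \<Longrightarrow> real (card {z\<in>Z. \<pi> z = b}) \<le> K"
  shows "real (card Z) \<le> K * real (card A)"
proof -
  have "card Z = (\<Sum>b\<in>A. card {z\<in>Z. \<pi> z = b})"
    using sum.group[OF assms(1-3), of "\<lambda>_. 1::nat"] by simp
  then have "real (card Z) = (\<Sum>b\<in>A. real (card {z\<in>Z. \<pi> z = b}))" by simp
  also have "\<dots> \<le> (\<Sum>b\<in>A. K)" by (intro sum_mono assms)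
  finally show ?thesis by (simp add: mult.commute)
qed

lemma card_int_diameter:
  fixes S :: "int set" and L :: real
  assumes "finite S" "L \<ge> 0" "\<And>s t. s \<in> S \<Longrightarrow> t \<in> S \<Longrightarrow> s < t \<Longrightarrow> real_of_int (t - s) \<le> L"
  shows "real (card S) \<le> L + 1"
proof (cases "S = {}")
  case False
  have "S \<subseteq> {Min S..Min S + \<lfloor>L\<rfloor>}"
  proof
    fix t assume t: "t \<in> S"
    then have m: "Min S \<in> S" "Min S \<le> t" using Min_in[OF assms(1) False] Min_le[OF assms(1)] by auto
    have "t - Min S \<le> \<lfloor>L\<rfloor>"
      using assms(3)[OF m(1) t] m assms(2) by (cases "Min S = t") (auto simp: le_floor_iff)
    then show "t \<in> {Min S..Min S + \<lfloor>L\<rfloor>}" using m by auto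
  qed
  then have "card S \<le> card {Min S..Min S + \<lfloor>L\<rfloor>}" by (intro card_mono) auto
  also have "\<dots> = nat (\<lfloor>L\<rfloor> + 1)" by simp
  finally show ?thesis using assms(2) by linarith
qed (use assms in simp)

section \<open>Additive energy\<close>

text \<open>The longer gap stands first; the opposite order is recovered by symmetry.\<close>

definition unequal_gaps :: "(nat \<Rightarrow> int) \<Rightarrow> nat set \<Rightarrow> (nat \<times> nat \<times> nat \<times> nat) set" where
  "unequal_gaps a I = {(x, x', y, y') \<in> I \<times> I \<times> I \<times> I.
     x < x' \<and> y < y' \<and> y' - y < x' - x \<and> a x' - a x = a y' - a y}"

text \<open>The trivial quadruples with x = y are included.\<close>

definition equal_gaps :: "(nat \<Rightarrow> int) \<Rightarrow> nat set \<Rightarrow> (nat \<times> nat \<times> nat \<times> nat) set" where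
  "equal_gaps a I = {(x, x', y, y') \<in> I \<times> I \<times> I \<times> I.
     x < x' \<and> y < y' \<and> y' - y = x' - x \<and> a x' - a x = a y' - a y}"

lemma finite_gaps: "finite I \<Longrightarrow> finite (unequal_gaps a I)" "finite I \<Longrightarrow> finite (equal_gaps a I)"
  by (rule finite_subset[of _ "I \<times> I \<times> I \<times> I"], force simp: unequal_gaps_def equal_gaps_def, simp)+

text \<open>A solution of a u + a v = a u' + a v' either has u = u' and then v = v', at most m^2
  cases, or is an equality of two positive differences in one of two orientations. Unequal gaps
  occur in two orders besides, whence the coefficients 2 and 4.\<close>

lemma energy_le_gaps:
  assumes fin: "finite I" and mono: "strict_mono_on I a"
  shows "energy a I \<le> (card I)\<^sup>2 + 2 * card (equal_gaps a I) + 4 * card (unequal_gaps a I)"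
proof -
  have less: "a x < a y \<longleftrightarrow> x < y" if "x \<in> I" "y \<in> I" for x y
    using strict_mono_on_less[OF mono that] .
  have eq: "a x = a y \<longleftrightarrow> x = y" if "x \<in> I" "y \<in> I" for x y
    using less[OF that] less[OF that(2,1)] by (metis less_irrefl linorder_neqE_nat)
  define Q where "Q = {(x, x', y, y') \<in> I \<times> I \<times> I \<times> I. x < x' \<and> y < y' \<and> a x' - a x = a y' - a y}"
  define Z where "Z = {z \<in> (I \<times> I) \<times> I \<times> I. a (fst (fst z)) + a (snd (fst z)) = a (fst (snd z)) + a (snd (snd z))}"
  have finQ: "finite Q" by (rule finite_subset[of _ "I \<times> I \<times> I \<times> I"]) (use fin in \<open>auto simp: Q_def\<close>)
  have finZ: "finite Z" unfolding Z_def using fin by simp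
  define Z0 where "Z0 = {z\<in>Z. fst (fst z) = fst (snd z)}"
  define Z1 where "Z1 = {z\<in>Z. fst (snd z) < fst (fst z)}"
  define Z2 where "Z2 = {z\<in>Z. fst (fst z) < fst (snd z)}"
  have "card Z0 \<le> card (I \<times> I)"
  proof (rule card_inj_on_le[of fst])
    have "snd (snd z) = snd (fst z)" if "z \<in> Z0" for z
      using that eq[of "snd (fst z)" "snd (snd z)"] by (auto simp: Z0_def Z_def)
    then show "inj_on fst Z0"
      by (intro inj_onI) (auto simp: Z0_def prod_eq_iff)
  qed (use fin in \<open>auto simp: Z0_def Z_def\<close>)
  then have Z0: "card Z0 \<le> (card I)\<^sup>2" by (simp add: card_cartesian_product power2_eq_square)
  have Z1: "card Z1 \<le> card Q"
  proof (rule card_inj_on_le[of "\<lambda>z. (fst (snd z), fst (fst z), snd (fst z), snd (snd z))"])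
    show "(\<lambda>z. (fst (snd z), fst (fst z), snd (fst z), snd (snd z))) ` Z1 \<subseteq> Q"
    proof (rule image_subsetI)
      fix z assume z: "z \<in> Z1"
      then have I: "fst (fst z) \<in> I" "snd (fst z) \<in> I" "fst (snd z) \<in> I" "snd (snd z) \<in> I"
        and e: "a (fst (fst z)) + a (snd (fst z)) = a (fst (snd z)) + a (snd (snd z))"
        and l: "fst (snd z) < fst (fst z)" by (auto simp: Z1_def Z_def)
      have "a (fst (snd z)) < a (fst (fst z))" using less I l by simp
      then have "snd (fst z) < snd (snd z)" using less[of "snd (fst z)" "snd (snd z)"] e I by linarith
      then show "(fst (snd z), fst (fst z), snd (fst z), snd (snd z)) \<in> Q"
        using I e l by (simp add: Q_def)
    qed
  qed (use finQ in \<open>auto intro!: inj_onI simp: prod_eq_iff\<close>)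
  have Z2: "card Z2 \<le> card Q"
  proof (rule card_inj_on_le[of "\<lambda>z. (fst (fst z), fst (snd z), snd (snd z), snd (fst z))"])
    show "(\<lambda>z. (fst (fst z), fst (snd z), snd (snd z), snd (fst z))) ` Z2 \<subseteq> Q"
    proof (rule image_subsetI)
      fix z assume z: "z \<in> Z2"
      then have I: "fst (fst z) \<in> I" "snd (fst z) \<in> I" "fst (snd z) \<in> I" "snd (snd z) \<in> I"
        and e: "a (fst (fst z)) + a (snd (fst z)) = a (fst (snd z)) + a (snd (snd z))"
        and l: "fst (fst z) < fst (snd z)" by (auto simp: Z2_def Z_def)
      have "a (fst (fst z)) < a (fst (snd z))" using less I l by simp
      then have "snd (snd z) < snd (fst z)" using less[of "snd (snd z)" "snd (fst z)"] e I by linarith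
      then show "(fst (fst z), fst (snd z), snd (snd z), snd (fst z)) \<in> Q"
        using I e l by (simp add: Q_def)
    qed
  qed (use finQ in \<open>auto intro!: inj_onI simp: prod_eq_iff\<close>)
  define swap where "swap = (\<lambda>(x, x', y, y'). (y, y', x, x') :: nat \<times> nat \<times> nat \<times> nat)"
  have "Q \<subseteq> equal_gaps a I \<union> (unequal_gaps a I \<union> swap ` unequal_gaps a I)"
  proof
    fix z assume z: "z \<in> Q"
    obtain x x' y y' where xy: "z = (x, x', y, y')" by (metis prod_cases4)
    consider "y' - y = x' - x" | "y' - y < x' - x" | "x' - x < y' - y" by linarith
    then show "z \<in> equal_gaps a I \<union> (unequal_gaps a I \<union> swap ` unequal_gaps a I)"
    proof cases
      case 1
      then show ?thesis using z by (simp add: xy Q_def equal_gaps_def)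
    next
      case 2
      then show ?thesis using z by (simp add: xy Q_def unequal_gaps_def)
    next
      case 3
      then have "(y, y', x, x') \<in> unequal_gaps a I" using z by (simp add: xy Q_def unequal_gaps_def)
      then have "swap (y, y', x, x') \<in> swap ` unequal_gaps a I" by (rule imageI)
      then show ?thesis by (simp add: swap_def xy)
    qed
  qed
  then have "card Q \<le> card (equal_gaps a I \<union> (unequal_gaps a I \<union> swap ` unequal_gaps a I))"
    using finite_gaps[OF fin] by (intro card_mono) auto
  also have "\<dots> \<le> card (equal_gaps a I) + (card (unequal_gaps a I) + card (swap ` unequal_gaps a I))"
    by (meson card_Un_le add_left_mono order_trans)
  also have "card (swap ` unequal_gaps a I) \<le> card (unequal_gaps a I)"
    by (intro card_image_le finite_gaps fin)
  finally have Q: "card Q \<le> card (equal_gaps a I) + 2 * card (unequal_gaps a I)" by simp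
  have "Z = Z0 \<union> (Z1 \<union> Z2)" unfolding Z0_def Z1_def Z2_def by auto
  then have "card Z \<le> card Z0 + (card Z1 + card Z2)"
    by (metis card_Un_le add_left_mono order_trans)
  then have "card Z \<le> (card I)\<^sup>2 + 2 * card Q" using Z0 Z1 Z2 by linarith
  moreover have "energy a I = card Z" by (simp add: energy_def Z_def)
  ultimately show ?thesis using Q by linarith
qed

text \<open>Each h admits at most L / h values of j, and the sum over h is harmonic.\<close>

lemma card_hyperbola_le:
  fixes L :: real
  assumes "L \<ge> 0"
  shows "real (card {(j, h) \<in> {1..m} \<times> {1..m}. real h * real j \<le> L}) \<le> L * harm m"
proof -
  have eq: "{(j, h) \<in> {1..m} \<times> {1..m}. real h * real j \<le> L} = (\<Union>h\<in>{1..m}. (\<lambda>j. (j, h)) ` {j\<in>{1..m}. real h * real j \<le> L})"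
    by auto
  have "card {(j, h) \<in> {1..m} \<times> {1..m}. real h * real j \<le> L} \<le> (\<Sum>h=1..m. card ((\<lambda>j. (j, h)) ` {j\<in>{1..m}. real h * real j \<le> L}))"
    unfolding eq by (rule card_UN_le) simp
  also have "\<dots> = (\<Sum>h=1..m. card {j\<in>{1..m}. real h * real j \<le> L})"
    by (intro sum.cong refl card_image) (auto intro: inj_onI)
  finally have "real (card {(j, h) \<in> {1..m} \<times> {1..m}. real h * real j \<le> L}) \<le> (\<Sum>h=1..m. real (card {j\<in>{1..m}. real h * real j \<le> L}))"
    unfolding of_nat_sum[symmetric] of_nat_le_iff .
  also have "\<dots> \<le> (\<Sum>h=1..m. L * inverse (real h))"
  proof (rule sum_mono)
    fix h assume h: "h \<in> {1..m}"
    have "{j\<in>{1..m}. real h * real j \<le> L} \<subseteq> {1..nat \<lfloor>L / h\<rfloor>}"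
    proof
      fix j assume "j \<in> {j\<in>{1..m}. real h * real j \<le> L}"
      then have "1 \<le> j" "real j \<le> L / h" using h by (auto simp: field_simps)
      then show "j \<in> {1..nat \<lfloor>L / h\<rfloor>}" by (simp add: le_nat_floor)
    qed
    then have "card {j\<in>{1..m}. real h * real j \<le> L} \<le> card {1..nat \<lfloor>L / h\<rfloor>}" by (intro card_mono) auto
    then have "card {j\<in>{1..m}. real h * real j \<le> L} \<le> nat \<lfloor>L / h\<rfloor>" by simp
    moreover have "real (nat \<lfloor>L / h\<rfloor>) \<le> L / h" using assms by simp
    ultimately show "real (card {j\<in>{1..m}. real h * real j \<le> L}) \<le> L * inverse (real h)"
      by (simp add: divide_inverse)
  qed
  also have "\<dots> = L * harm m" by (simp add: harm_def sum_distrib_left)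
  finally show ?thesis .
qed

text \<open>A quadruple with equal gaps is determined by x, y - x and x' - x. Those with x = y
  number at most m^2; the others, up to exchange of the two pairs, consist of a position and a
  lattice point under a hyperbola.\<close>

lemma card_equal_gaps_le:
  fixes L :: real
  assumes "L \<ge> 0"
    and L: "\<And>x x' y y'. (x, x', y, y') \<in> equal_gaps a {N<..N + m} \<Longrightarrow> x < y \<Longrightarrow> real (x' - x) * real (y - x) \<le> L"
  shows "real (card (equal_gaps a {N<..N + m})) \<le> (real m)\<^sup>2 + 2 * (real m * (L * harm m))"
proof -
  define I where "I = {N<..N + m}"
  have fin: "finite I" by (simp add: I_def)
  define E where "E = equal_gaps a I"
  have finE: "finite E" unfolding E_def by (intro finite_gaps fin)
  define E0 where "E0 = {z\<in>E. fst z = fst (snd (snd z))}"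
  define E1 where "E1 = {z\<in>E. fst z < fst (snd (snd z))}"
  define E2 where "E2 = {z\<in>E. fst (snd (snd z)) < fst z}"
  have finE1: "finite E1" using finE by (simp add: E1_def)
  define S where "S = {(j, h) \<in> {1..m} \<times> {1..m}. real h * real j \<le> L}"
  have finS: "finite S" by (rule finite_subset[of _ "{1..m} \<times> {1..m}"]) (auto simp: S_def)
  have "card E0 \<le> card (I \<times> I)"
    by (rule card_inj_on_le[of "\<lambda>(x, x', y, y'). (x, x')"])
       (use fin in \<open>auto simp: E0_def E_def equal_gaps_def intro!: inj_onI\<close>)
  then have E0: "card E0 \<le> m\<^sup>2" by (simp add: card_cartesian_product power2_eq_square I_def)
  have "card E1 \<le> card (I \<times> S)"
  proof (rule card_inj_on_le[of "\<lambda>(x, x', y, y'). (x, y - x, x' - x)"])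
    show "(\<lambda>(x, x', y, y'). (x, y - x, x' - x)) ` E1 \<subseteq> I \<times> S"
      using L by (auto simp: E1_def S_def E_def I_def) (auto simp: equal_gaps_def)
    show "inj_on (\<lambda>(x, x', y, y'). (x, y - x, x' - x)) E1"
      by (rule inj_onI) (auto simp: E1_def E_def equal_gaps_def)
  qed (use fin finS in auto)
  then have "card E1 \<le> m * card S" by (simp add: card_cartesian_product I_def)
  then have "real (card E1) \<le> real m * real (card S)" by (metis of_nat_le_iff of_nat_mult)
  also have "\<dots> \<le> real m * (L * harm m)"
    unfolding S_def using assms(1) by (intro mult_left_mono card_hyperbola_le) auto
  finally have E1: "real (card E1) \<le> real m * (L * harm m)" .
  have "card E2 \<le> card E1"
    by (rule card_inj_on_le[of "\<lambda>(x, x', y, y'). (y, y', x, x')"])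
       (use finE1 in \<open>auto simp: E1_def E2_def E_def equal_gaps_def intro!: inj_onI\<close>)
  moreover have "card E \<le> card E0 + (card E1 + card E2)"
  proof -
    have "E = E0 \<union> (E1 \<union> E2)" unfolding E0_def E1_def E2_def by auto
    then show ?thesis by (metis card_Un_le add_left_mono order_trans)
  qed
  ultimately have "card E \<le> m\<^sup>2 + 2 * card E1" using E0 by linarith
  then have "real (card E) \<le> real (m\<^sup>2 + 2 * card E1)" by linarith
  then show ?thesis using E1 unfolding E_def I_def by simp
qed

lemma floor_power_bounds:
  "real_of_int (floor_power c n) \<le> real n powr c \<and> real n powr c < real_of_int (floor_power c n) + 1"
  unfolding floor_power_def by linarith+

text \<open>Four rounding errors in [0, 1), two of each sign.\<close>

lemma floor_power_difference:
  assumes "floor_power c x' - floor_power c x = floor_power c y' - floor_power c y"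
  shows "\<bar>(real x' powr c - real x powr c) - (real y' powr c - real y powr c)\<bar> < 2"
proof -
  have "real_of_int (floor_power c x') - floor_power c x = real_of_int (floor_power c y') - floor_power c y"
    using assms by (metis of_int_diff)
  then show ?thesis
    using floor_power_bounds[of c x] floor_power_bounds[of c x'] floor_power_bounds[of c y] floor_power_bounds[of c y']
    by linarith
qed

text \<open>The quadruples are sorted by the gaps (h - k, h), then by the shift y - x, then by x. As
  h - k = O(m^2 / N), there are O(m^3 / N) pairs of gaps. As h \<delta> is known up to O(m^3 / N)
  and h is at least of order N / m, there are O(1 + m^4 / N^2) shifts, and each leaves at most 9
  positions. The total O(m^3 / N + m^7 / N^3) is O(m^2) by m <= N and m^5 <= N^3.\<close>

lemma card_unequal_gaps_le:
  fixes c :: real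
  assumes c: "c \<ge> 2"
  obtains C \<eta> :: real where "\<eta> > 0"
    "\<And>N m :: nat. \<lbrakk>N \<ge> 1; real m \<le> \<eta> * N; real m ^ 3 \<ge> N; real m ^ 3 \<le> \<eta> * (real N)\<^sup>2; real m ^ 5 \<le> real N ^ 3\<rbrakk>
      \<Longrightarrow> real (card (unequal_gaps (floor_power c) {N<..N + m})) \<le> C * (real m)\<^sup>2"
proof -
  obtain A D \<eta>\<^sub>0 :: real where "A > 0" "D > 0" "\<eta>\<^sub>0 > 0"
    and relation: "\<And>N M x x' y y' h k \<delta> :: real. \<lbrakk>N \<ge> 1; 0 \<le> M; M \<le> \<eta>\<^sub>0 * N; M ^ 3 \<ge> N;
      N \<le> x; N \<le> y; x' \<le> N + M; y' \<le> N + M; h = x' - x; k = y' - y; 1 \<le> k; k + 1 \<le> h;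
      \<delta> = (y + y') / 2 - (x + x') / 2; \<bar>(x' powr c - x powr c) - (y' powr c - y powr c)\<bar> \<le> 2\<rbrakk>
      \<Longrightarrow> \<bar>h * \<delta> - (h - k) * N / (c - 1)\<bar> \<le> A * M ^ 3 / N \<and> h - k \<le> D * M\<^sup>2 / N"
    by (rule gap_relation[OF c]) blast
  obtain \<eta>\<^sub>1 where "\<eta>\<^sub>1 > 0"
    and close: "\<And>N M h k e \<delta> x z :: real. \<lbrakk>N \<ge> 1; 0 \<le> M; M \<le> \<eta>\<^sub>1 * N; M ^ 3 \<le> \<eta>\<^sub>1 * N\<^sup>2; 1 \<le> k; k + 1 \<le> h;
      \<delta> = e - (h - k) / 2; \<delta> \<ge> 0; h * \<delta> \<le> (h - k) * N / (c - 1) + A * M ^ 3 / N;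
      N \<le> x; N \<le> x + e; x + h \<le> N + M; x + e + k \<le> N + M;
      N \<le> z; N \<le> z + e; z + h \<le> N + M; z + e + k \<le> N + M;
      \<bar>((x + h) powr c - x powr c) - ((x + e + k) powr c - (x + e) powr c)\<bar> \<le> 2;
      \<bar>((z + h) powr c - z powr c) - ((z + e + k) powr c - (z + e) powr c)\<bar> \<le> 2; x < z\<rbrakk>
      \<Longrightarrow> z - x \<le> 8"
    by (rule gap_solutions_close[OF c \<open>A > 0\<close>]) blast
  define \<kappa> where "\<kappa> = 1 / (c - 1)"
  have \<kappa>: "\<kappa> > 0" using c by (simp add: \<kappa>_def)
  \<comment> \<open>The last entry keeps the error A m^3 / N of the relation below half of its main
    term, which is at least \<kappa> N.\<close>
  define \<eta> where "\<eta> = min (min \<eta>\<^sub>0 \<eta>\<^sub>1) (min 1 (\<kappa> / (2 * A)))"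
  have \<eta>: "\<eta> > 0" "\<eta> \<le> \<eta>\<^sub>0" "\<eta> \<le> \<eta>\<^sub>1" "\<eta> \<le> 1" "\<eta> \<le> \<kappa> / (2 * A)"
    unfolding \<eta>_def using \<open>\<eta>\<^sub>0 > 0\<close> \<open>\<eta>\<^sub>1 > 0\<close> \<kappa> \<open>A > 0\<close> by auto
  define C where "C = 9 * D * (1 + 4 * A / \<kappa>)"
  have "real (card (unequal_gaps (floor_power c) {N<..N + m})) \<le> C * (real m)\<^sup>2"
    if N: "N \<ge> 1" and m: "real m \<le> \<eta> * N" "real m ^ 3 \<ge> N" "real m ^ 3 \<le> \<eta> * (real N)\<^sup>2" "real m ^ 5 \<le> real N ^ 3"
    for N m :: nat
  proof -
    define Q where "Q = unequal_gaps (floor_power c) {N<..N + m}"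
    have finQ: "finite Q" unfolding Q_def by (intro finite_gaps) simp
    have N': "real N \<ge> 1" "real N > 0" using N by auto
    have le: "real m \<le> \<eta>\<^sub>0 * N" "real m \<le> \<eta>\<^sub>1 * N" "real m ^ 3 \<le> \<eta>\<^sub>1 * (real N)\<^sup>2" "real m \<le> N"
      using m \<eta> mult_right_mono[of \<eta> \<eta>\<^sub>0 "real N"] mult_right_mono[of \<eta> \<eta>\<^sub>1 "real N"]
        mult_right_mono[of \<eta> \<eta>\<^sub>1 "(real N)\<^sup>2"] mult_right_mono[of \<eta> 1 "real N"] by auto
    have m0: "real m > 0" using m(2) N' by (cases "m = 0") auto
    have err: "A * real m ^ 3 / N \<le> \<kappa> * N / 2"
    proof -
      have "A * real m ^ 3 \<le> A * (\<eta> * (real N)\<^sup>2)" using m \<open>A > 0\<close> by (intro mult_left_mono) auto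
      also have "\<dots> \<le> A * (\<kappa> / (2 * A) * (real N)\<^sup>2)" using \<eta> \<open>A > 0\<close> by (intro mult_left_mono mult_right_mono) auto
      also have "\<dots> = \<kappa> * N / 2 * N" using \<open>A > 0\<close> by (simp add: power2_eq_square)
      finally show ?thesis using N' by (simp add: pos_divide_le_eq)
    qed
    \<comment> \<open>The range of shifts: an interval of length 2 A m^3 / N for h \<delta>, divided
      by the lower bound \<kappa> N / (2 m) for h.\<close>
    define R where "R = 4 * A / \<kappa> * real m ^ 4 / (real N)\<^sup>2"
    have R: "R \<ge> 0" unfolding R_def using \<open>A > 0\<close> \<kappa> by simp
    have facts: "1 \<le> k \<and> k + 1 \<le> h \<and> \<bar>h * \<delta> - (h - k) * N / (c - 1)\<bar> \<le> A * real m ^ 3 / N \<and> h - k \<le> D * (real m)\<^sup>2 / N \<and>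
        \<bar>(real x' powr c - real x powr c) - (real y' powr c - real y powr c)\<bar> \<le> 2 \<and>
        real N \<le> x \<and> real N \<le> y \<and> real x' \<le> real N + real m \<and> real y' \<le> real N + real m \<and>
        \<delta> > 0 \<and> \<kappa> * N / (2 * m) \<le> h \<and> h \<le> m"
      if z: "(x, x', y, y') \<in> Q" and h: "h = real x' - real x" and k: "k = real y' - real y"
        and \<delta>: "\<delta> = (real y + real y') / 2 - (real x + real x') / 2" for x x' y y' h k \<delta>
    proof -
      have z': "N < x" "N < y" "x' \<le> N + m" "y' \<le> N + m" "x < x'" "y < y'" "y' - y < x' - x"
        "floor_power c x' - floor_power c x = floor_power c y' - floor_power c y"
        using z by (auto simp: Q_def unequal_gaps_def)
      then have hk: "1 \<le> k" "k + 1 \<le> h" unfolding h k by linarith+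
      have bounds: "real N \<le> x" "real N \<le> y" "real x' \<le> real N + real m" "real y' \<le> real N + real m"
        using z' by linarith+
      have sol: "\<bar>(real x' powr c - real x powr c) - (real y' powr c - real y powr c)\<bar> \<le> 2"
        using floor_power_difference[OF z'(8)] by simp
      have rel: "\<bar>h * \<delta> - (h - k) * N / (c - 1)\<bar> \<le> A * real m ^ 3 / N" "h - k \<le> D * (real m)\<^sup>2 / N"
        using relation[OF N'(1) _ le(1) m(2) bounds h k hk \<delta> sol] by auto
      \<comment> \<open>As h - k >= 1, the product h \<delta> is at least of order N; since \<delta>
        <= m, the gap h cannot be small.\<close>
      have "1 * (N / (c - 1)) \<le> (h - k) * (N / (c - 1))" using hk c by (intro mult_right_mono) auto
      then have "\<kappa> * N \<le> (h - k) * N / (c - 1)" by (simp add: \<kappa>_def)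
      then have h\<delta>: "\<kappa> * N / 2 \<le> h * \<delta>" using rel(1) err by linarith
      moreover have "\<kappa> * N / 2 > 0" using \<kappa> N' by simp
      ultimately have "h * \<delta> > 0" by linarith
      then have "\<delta> > 0" using hk by (simp add: zero_less_mult_iff)
      have "real x < real x'" "real y < real y'" using z'(5,6) by auto
      then have "real y + real y' - (real x + real x') \<le> 2 * real m" using bounds by linarith
      then have "\<delta> \<le> m" unfolding \<delta> by (simp add: field_simps)
      then have "h * \<delta> \<le> h * m" using hk by (intro mult_left_mono) auto
      then have "\<kappa> * N / 2 \<le> h * m" using h\<delta> by linarith
      then have "\<kappa> * N / (2 * m) \<le> h" using m0 by (simp add: field_simps)
      moreover have "h \<le> m" unfolding h using bounds z'(1) by linarith
      ultimately show ?thesis using hk rel sol bounds \<open>\<delta> > 0\<close> by blast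
    qed
    \<comment> \<open>On \<open>Q\<close> the natural subtractions do not truncate, and the first
      component is at least 1, as membership in \<open>G\<close> demands.\<close>
    define gap where "gap = (\<lambda>(x, x', y, y'). ((x' - x) - (y' - y), x' - x) :: nat \<times> nat)"
    define shift where "shift = (\<lambda>(x :: nat, x' :: nat, y, y' :: nat). int y - int x)"
    define G where "G = {1..nat \<lfloor>D * (real m)\<^sup>2 / N\<rfloor>} \<times> {1..m}"
    have gapQ: "gap ` Q \<subseteq> G"
    proof (rule image_subsetI)
      fix z assume z: "z \<in> Q"
      obtain x x' y y' where xy: "z = (x, x', y, y')" by (metis prod_cases4)
      have z': "x < x'" "y < y'" "y' - y < x' - x"
        using z by (auto simp: Q_def unequal_gaps_def xy)
      have f: "(real x' - real x) - (real y' - real y) \<le> D * (real m)\<^sup>2 / N" "real x' - real x \<le> m"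
        using facts[OF z[unfolded xy] refl refl refl] by auto
      have "real ((x' - x) - (y' - y)) \<le> D * (real m)\<^sup>2 / N"
        using f(1) z' by (simp add: of_nat_diff)
      then have "(x' - x) - (y' - y) \<le> nat \<lfloor>D * (real m)\<^sup>2 / N\<rfloor>" by (simp add: le_nat_floor)
      moreover have "x' - x \<le> m" using f(2) z' by linarith
      ultimately show "gap z \<in> G" unfolding gap_def G_def xy using z' by auto
    qed
    have inner: "real (card {z\<in>Q. gap z = b \<and> shift z = e}) \<le> 9" for b e
    proof -
      define F where "F = {z\<in>Q. gap z = b \<and> shift z = e}"
      have inj: "inj_on (\<lambda>z. int (fst z)) F"
        by (rule inj_onI) (auto simp: F_def Q_def unequal_gaps_def gap_def shift_def)
      have "real (card ((\<lambda>z. int (fst z)) ` F)) \<le> 8 + 1"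
      proof (rule card_int_diameter)
        show "finite ((\<lambda>z. int (fst z)) ` F)" unfolding F_def using finQ by simp
        fix s t assume "s \<in> (\<lambda>z. int (fst z)) ` F" "t \<in> (\<lambda>z. int (fst z)) ` F" "s < t"
        then obtain z w where zw: "z \<in> F" "w \<in> F" "s = int (fst z)" "t = int (fst w)" by blast
        obtain x x' y y' where z: "z = (x, x', y, y')" by (metis prod_cases4)
        obtain u u' v v' where w: "w = (u, u', v, v')" by (metis prod_cases4)
        define h where "h = real x' - real x"
        define k where "k = real y' - real y"
        define r where "r = real y - real x"
        define \<delta> where "\<delta> = (real y + real y') / 2 - (real x + real x') / 2"
        have zQ: "(x, x', y, y') \<in> Q" and wQ: "(u, u', v, v') \<in> Q" using zw z w by (auto simp: F_def)
        have ord: "x < x'" "y < y'" "y' - y < x' - x" "u < u'" "v < v'" "v' - v < u' - u"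
          using zQ wQ by (auto simp: Q_def unequal_gaps_def)
        have "x' - x = u' - u" "(x' - x) - (y' - y) = (u' - u) - (v' - v)" "int y - int x = int v - int u"
          using zw z w by (auto simp: F_def gap_def shift_def)
        then have same: "real u' = real u + h" "real v' = real v + k" "real v = real u + r"
          unfolding h_def k_def r_def using ord by linarith+
        have xs: "real x' = real x + h" "real y' = real y + k" "real y = real x + r" by (auto simp: h_def k_def r_def)
        note f = facts[OF zQ h_def k_def \<delta>_def]
        note g = facts[OF wQ refl refl refl]
        have \<delta>: "\<delta> = r - (h - k) / 2" unfolding \<delta>_def xs by (simp add: field_simps)
        have "real u - real x \<le> 8"
        proof (rule close[OF N'(1) _ le(2,3) _ _ \<delta>])
          show "real x < real u" using \<open>s < t\<close> zw z w by simp
          show "\<bar>((real u + h) powr c - real u powr c) - ((real u + r + k) powr c - (real u + r) powr c)\<bar> \<le> 2"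
            using g unfolding same by simp
          show "\<bar>((real x + h) powr c - real x powr c) - ((real x + r + k) powr c - (real x + r) powr c)\<bar> \<le> 2"
            using f unfolding xs by simp
          show "h * \<delta> \<le> (h - k) * real N / (c - 1) + A * real m ^ 3 / real N" using f by linarith
        qed (use f g same xs in auto)
        then show "real_of_int (t - s) \<le> 8" using zw z w by simp
      qed simp
      then show ?thesis using card_image[OF inj] by (simp add: F_def)
    qed
    have "real (card {z\<in>Q. gap z = b}) \<le> 9 * (R + 1)" for b
    proof -
      define F where "F = {z\<in>Q. gap z = b}"
      have finF: "finite F" using finQ by (simp add: F_def)
      have "real (card F) \<le> 9 * real (card (shift ` F))"
        by (rule card_le_fibers[of F "shift ` F" shift]) (use finF inner in \<open>auto simp: F_def conj_assoc\<close>)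
      also have "real (card (shift ` F)) \<le> R + 1"
      proof (rule card_int_diameter)
        fix s t assume "s \<in> shift ` F" "t \<in> shift ` F" "s < t"
        then obtain z w where zw: "z \<in> F" "w \<in> F" "s = shift z" "t = shift w" by blast
        obtain x x' y y' where z: "z = (x, x', y, y')" by (metis prod_cases4)
        obtain u u' v v' where w: "w = (u, u', v, v')" by (metis prod_cases4)
        define h where "h = real x' - real x"
        define k where "k = real y' - real y"
        have zQ: "(x, x', y, y') \<in> Q" and wQ: "(u, u', v, v') \<in> Q" using zw z w by (auto simp: F_def)
        have ord: "x < x'" "y < y'" "y' - y < x' - x" "u < u'" "v < v'" "v' - v < u' - u"
          using zQ wQ by (auto simp: Q_def unequal_gaps_def)
        have "x' - x = u' - u" "(x' - x) - (y' - y) = (u' - u) - (v' - v)"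
          using zw z w by (auto simp: F_def gap_def)
        then have same: "h = real u' - real u" "k = real v' - real v"
          unfolding h_def k_def using ord by linarith+
        define \<delta>\<^sub>1 where "\<delta>\<^sub>1 = (real y + real y') / 2 - (real x + real x') / 2"
        define \<delta>\<^sub>2 where "\<delta>\<^sub>2 = (real v + real v') / 2 - (real u + real u') / 2"
        note f = facts[OF zQ h_def k_def \<delta>\<^sub>1_def]
        note g = facts[OF wQ same \<delta>\<^sub>2_def]
        \<comment> \<open>Within one gap class the distance of the midpoints is the shift minus the
          constant (h - k) / 2.\<close>
        have st: "real_of_int (t - s) = \<delta>\<^sub>2 - \<delta>\<^sub>1"
          unfolding zw z w shift_def \<delta>\<^sub>1_def \<delta>\<^sub>2_def using same h_def k_def by (simp add: field_simps)
        have "h * \<delta>\<^sub>2 - h * \<delta>\<^sub>1 \<le> 2 * (A * real m ^ 3 / N)" using f g by linarith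
        then have "h * real_of_int (t - s) \<le> 2 * (A * real m ^ 3 / N)" unfolding st right_diff_distrib .
        moreover have "\<kappa> * N / (2 * m) * real_of_int (t - s) \<le> h * real_of_int (t - s)"
          using f \<open>s < t\<close> by (intro mult_right_mono) auto
        ultimately have "\<kappa> * N / (2 * m) * real_of_int (t - s) \<le> 2 * (A * real m ^ 3 / N)" by linarith
        then have "(2 * m / (\<kappa> * N)) * (\<kappa> * N / (2 * m) * real_of_int (t - s)) \<le> (2 * m / (\<kappa> * N)) * (2 * (A * real m ^ 3 / N))"
          using \<kappa> N' by (intro mult_left_mono) auto
        moreover have "(2 * m / (\<kappa> * N)) * (\<kappa> * N / (2 * m) * real_of_int (t - s)) = real_of_int (t - s)"
          using \<kappa> N' m0 by simp
        moreover have "(2 * m / (\<kappa> * N)) * (2 * (A * real m ^ 3 / N)) = R"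
          unfolding R_def by (simp add: power2_eq_square eval_nat_numeral mult_ac)
        ultimately show "real_of_int (t - s) \<le> R" by simp
      qed (use finF R in auto)
      finally show ?thesis unfolding F_def by simp
    qed
    then have "real (card Q) \<le> 9 * (R + 1) * real (card G)"
      by (intro card_le_fibers[of Q G gap] finQ gapQ) (auto simp: G_def)
    also have "real (card G) \<le> D * (real m)\<^sup>2 / N * m"
    proof -
      have "real (nat \<lfloor>D * (real m)\<^sup>2 / N\<rfloor>) \<le> D * (real m)\<^sup>2 / N" using \<open>D > 0\<close> by simp
      moreover have "card G = nat \<lfloor>D * (real m)\<^sup>2 / N\<rfloor> * m"
        by (simp add: G_def card_cartesian_product)
      ultimately show ?thesis by (simp only: of_nat_mult) (intro mult_right_mono; simp)
    qed
    finally have "real (card Q) \<le> 9 * (R + 1) * (D * (real m)\<^sup>2 / N * m)" using R by simp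
    also have "\<dots> = 9 * D * (real m)\<^sup>2 * ((R + 1) * (m / N))" by simp
    also have "\<dots> \<le> 9 * D * (real m)\<^sup>2 * (1 + 4 * A / \<kappa>)"
    proof (rule mult_left_mono)
      have "R * (m / N) = 4 * A / \<kappa> * (real m ^ 5 / real N ^ 3)"
        unfolding R_def by (simp add: eval_nat_numeral)
      also have "\<dots> \<le> 4 * A / \<kappa> * 1"
        using m(4) N' \<open>A > 0\<close> \<kappa> by (intro mult_left_mono) auto
      finally have "R * (m / N) \<le> 4 * A / \<kappa>" by simp
      moreover have "m / N \<le> 1" using le(4) N' by simp
      moreover have "(R + 1) * (m / N) = R * (m / N) + m / N" by (simp only: distrib_right mult_1)
      ultimately show "(R + 1) * (m / N) \<le> 1 + 4 * A / \<kappa>" by linarith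
    qed (use \<open>D > 0\<close> in simp)
    finally show ?thesis unfolding Q_def C_def by (simp only: mult_ac)
  qed
  with \<eta>(1) show ?thesis by (rule that)
qed

section \<open>The sequence of rounded powers\<close>

text \<open>For c > 1 consecutive powers differ by at least 1, so rounding down keeps them
  distinct.\<close>

lemma strict_mono_floor_power:
  assumes "c > 1"
  shows "strict_mono (floor_power c)"
proof (subst strict_mono_Suc_iff, rule allI)
  fix n :: nat
  have "real n powr c + 1 \<le> real (Suc n) powr c"
  proof (cases "n = 0")
    case False
    then obtain \<xi> where \<xi>: "real n < \<xi>" "real (Suc n) powr c - real n powr c = (real (Suc n) - real n) * (c * \<xi> powr (c - 1))"
      using powr_mean_value[of "real n" "real (Suc n)" c] by auto
    have "1 \<le> \<xi> powr (c - 1)" using False \<xi> assms by (intro ge_one_powr_ge_zero) auto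
    then have "1 * 1 \<le> c * \<xi> powr (c - 1)" using assms by (intro mult_mono) auto
    then show ?thesis using \<xi>(2) by simp
  qed simp
  then show "floor_power c n < floor_power c (Suc n)"
    unfolding floor_power_def by linarith
qed

text \<open>The mixed second difference of t^c equals (y - x) h c (c - 1) \<zeta>^(c-2), and
  equality of the rounded differences forces it below 2.\<close>

lemma equal_gaps_product_le:
  fixes c :: real
  assumes c: "c > 1" and "N \<ge> 1" "m \<le> N"
    and gaps: "(x, x', y, y') \<in> equal_gaps (floor_power c) {N<..N + m}" and "x < y"
  shows "real (x' - x) * real (y - x) \<le> 2 * 2 powr \<bar>2 - c\<bar> / (c * (c - 1)) * real N powr (2 - c)"
proof -
  have z: "N < x" "N < y" "x' \<le> N + m" "y' \<le> N + m" "x < x'" "y < y'" "y' - y = x' - x"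
    "floor_power c x' - floor_power c x = floor_power c y' - floor_power c y"
    using gaps by (auto simp: equal_gaps_def)
  define h where "h = real (x' - x)"
  have h: "h > 0" "real x' = real x + h" "real y' = real y + h" unfolding h_def using z by auto
  obtain \<zeta> where \<zeta>: "real x < \<zeta>" "\<zeta> < real y + h"
    "(real y + h) powr c - real y powr c - ((real x + h) powr c - real x powr c)
       = (real y - real x) * h * (c * (c - 1) * \<zeta> powr (c - 2))"
    using powr_second_difference[of "real x" "real y" h c] z \<open>x < y\<close> h by auto
  have \<zeta>N: "real N \<le> \<zeta>" "\<zeta> \<le> 2 * real N"
    using \<zeta> z(1,4) h(3) \<open>m \<le> N\<close> by linarith+
  have "\<zeta> > 0" using \<zeta>N \<open>N \<ge> 1\<close> by linarith
  have "(real y - real x) * h * (c * (c - 1) * \<zeta> powr (c - 2)) < 2"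
    using floor_power_difference[OF z(8)] unfolding h(2,3) \<zeta>(3)[symmetric] by linarith
  then have "(real y - real x) * h * (c * (c - 1) * \<zeta> powr (c - 2)) * \<zeta> powr (2 - c) \<le> 2 * \<zeta> powr (2 - c)"
    by (intro mult_right_mono) auto
  moreover have "\<zeta> powr (c - 2) * \<zeta> powr (2 - c) = 1"
    using \<open>\<zeta> > 0\<close> by (simp add: powr_add[symmetric])
  ultimately have "(real y - real x) * h * (c * (c - 1)) \<le> 2 * \<zeta> powr (2 - c)"
    by (simp add: mult.assoc)
  also have "\<dots> \<le> 2 * (2 powr \<bar>2 - c\<bar> * real N powr (2 - c))"
    using \<zeta>N \<open>N \<ge> 1\<close> by (intro mult_left_mono powr_le_scale) auto
  finally have "h * (real y - real x) \<le> 2 * (2 powr \<bar>2 - c\<bar> * real N powr (2 - c)) / (c * (c - 1))"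
    using c by (subst pos_le_divide_eq) (auto simp: mult_ac)
  then show ?thesis using \<open>x < y\<close> by (simp add: h_def of_nat_diff)
qed

text \<open>In a block of length at most sqrt N / 2 the derivative of t^c exceeds c N^(c-1) by a
  relative amount of at most m / N, which over a gap k <= m adds up to at most c N^(c-1) / 4. A gap
  longer by 1 thus increases the difference by at least 3/4 c N^(c-1), and 8/3 makes this at least
  2, more than rounding can hide.\<close>

lemma unequal_gaps_empty:
  fixes c :: real
  assumes c: "1 < c" "c < 2" and N: "N \<ge> 1" and m: "4 * (real m)\<^sup>2 \<le> N" and large: "8 / 3 \<le> c * real N powr (c - 1)"
  shows "unequal_gaps (floor_power c) {N<..N + m} = {}"
proof (rule ccontr)
  assume "\<not> ?thesis"
  then obtain x x' y y' where "(x, x', y, y') \<in> unequal_gaps (floor_power c) {N<..N + m}"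
    by (metis ex_in_conv prod_cases4)
  then have z: "N < x" "N < y" "x' \<le> N + m" "y' \<le> N + m" "x < x'" "y < y'" "y' - y < x' - x"
    "floor_power c x' - floor_power c x = floor_power c y' - floor_power c y"
    by (auto simp: unequal_gaps_def)
  define h k where "h = real x' - real x" and "k = real y' - real y"
  have hk: "k + 1 \<le> h" "0 < k" "k \<le> m" unfolding h_def k_def using z by linarith+
  have N': "real N > 0" using N by simp
  define W where "W = real N powr (c - 1)"
  have W: "W > 0" using N' by (simp add: W_def)
  obtain \<xi> where \<xi>: "real x < \<xi>" "\<xi> < real x'" "real x' powr c - real x powr c = (real x' - real x) * (c * \<xi> powr (c - 1))"
    using powr_mean_value[of "real x" "real x'" c] z by auto
  obtain \<nu> where \<nu>: "real y < \<nu>" "\<nu> < real y'" "real y' powr c - real y powr c = (real y' - real y) * (c * \<nu> powr (c - 1))"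
    using powr_mean_value[of "real y" "real y'" c] z by auto
  have "W \<le> \<xi> powr (c - 1)" unfolding W_def using \<xi> z c by (intro powr_mono2) auto
  then have 1: "h * (c * W) \<le> real x' powr c - real x powr c"
    unfolding \<xi>(3) h_def[symmetric] using hk c by (intro mult_left_mono) auto
  have \<nu>_le: "\<nu> powr (c - 1) \<le> W + real m * (W / N)"
  proof -
    have "\<nu> powr (c - 1) \<le> (real N + real m) powr (c - 1)" using \<nu> z c by (intro powr_mono2) auto
    also have "\<dots> \<le> W + real m * (W / N)"
    proof -
      obtain \<zeta> where \<zeta>: "\<zeta> \<in> {real N..real N + real m}" "(real N + real m) powr (c - 1) - real N powr (c - 1) = (real N + real m - real N) * ((c - 1) * \<zeta> powr (c - 1 - 1))"
        using powr_mean_value'[of "real N" "real N" "real N + real m" "real N + real m" "c - 1"] N' by auto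
      have "\<zeta> powr (c - 1 - 1) \<le> real N powr (c - 1 - 1)" using \<zeta> N' c by (intro powr_mono2') auto
      also have "\<dots> = W / N" using N' powr_diff[of "real N" "c - 1" 1] by (simp add: W_def)
      finally have "(c - 1) * \<zeta> powr (c - 1 - 1) \<le> 1 * (W / N)" using c by (intro mult_mono) auto
      then have "real m * ((c - 1) * \<zeta> powr (c - 1 - 1)) \<le> real m * (W / N)" by (intro mult_left_mono) auto
      then show ?thesis using \<zeta>(2) by (simp add: W_def)
    qed
    finally show ?thesis .
  qed
  have "real y' powr c - real y powr c \<le> k * (c * (W + real m * (W / N)))"
    unfolding \<nu>(3) k_def[symmetric] using \<nu>_le hk c by (intro mult_left_mono) auto
  also have "\<dots> = k * (c * W) + (k * m) * (c * W / N)" by (simp add: algebra_simps)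
  also have "(k * m) * (c * W / N) \<le> (real m)\<^sup>2 * (c * W / N)"
    unfolding power2_eq_square using hk c W by (intro mult_right_mono) auto
  also have "\<dots> \<le> (N / 4) * (c * W / N)" using m c W by (intro mult_right_mono) auto
  also have "\<dots> = c * W / 4" using N' by simp
  finally have 2: "real y' powr c - real y powr c \<le> k * (c * W) + c * W / 4" by simp
  have "(k + 1) * (c * W) \<le> h * (c * W)" using hk c W by (intro mult_right_mono) auto
  then have "k * (c * W) + c * W \<le> h * (c * W)" by (simp only: distrib_right mult_1)
  moreover define P where "P = c * W"
  ultimately have "P - P / 4 < 2"
    using 1 2 floor_power_difference[OF z(8)] unfolding P_def[symmetric] by linarith
  then show False using large by (simp add: P_def W_def)
qed

text \<open>The two conditions on \<tau> belong to the two terms m^2 and m N^(2 - c) log N of the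
  energy: for m of order at least N^\<theta>, each term without the logarithm, times N^(2 \<tau>),
  is O(m^3). The factor N^(- \<epsilon>) pays for constants and the logarithm.\<close>

lemma energy_floor_power_le:
  fixes c \<theta> \<tau> C \<epsilon> :: real and m :: "nat \<Rightarrow> nat"
  assumes c: "c > 1" and \<tau>: "2 * \<tau> \<le> \<theta>" "2 - c + 2 * \<tau> \<le> 2 * \<theta>" and \<epsilon>: "\<epsilon> > 0"
    and m: "\<forall>\<^sub>F N in sequentially. 1 \<le> m N \<and> m N \<le> N" "\<forall>\<^sub>F N in sequentially. real N powr \<theta> \<le> 4 * real (m N)"
    and unequal: "\<forall>\<^sub>F N in sequentially. real (card (unequal_gaps (floor_power c) {N<..N + m N})) \<le> C * (real (m N))\<^sup>2"
  shows "\<forall>\<^sub>F N in sequentially. 2 * energy (floor_power c) {N<..N + m N} * real N powr (2 * \<tau> - \<epsilon>) \<le> real (m N) ^ 3"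
proof -
  define K where "K = 2 * 2 powr \<bar>2 - c\<bar> / (c * (c - 1))"
  have K: "K > 0" unfolding K_def using c by simp
  have E1: "\<forall>\<^sub>F N in sequentially. 16 * (3 + 4 * C) \<le> real N powr \<epsilon>"
    by (rule eventually_ge_powr[OF \<epsilon>])
  have E2: "\<forall>\<^sub>F N in sequentially. 256 * K * (1 + ln (real N)) \<le> real N powr \<epsilon>"
    using \<epsilon> K by real_asymp
  show ?thesis
    using m unequal E1 E2 eventually_ge_at_top[of 1]
  proof eventually_elim
    case (elim N)
    define M where "M = real (m N)"
    have M: "M \<ge> 1" "real N powr \<theta> \<le> 4 * M" using elim by (auto simp: M_def)
    have N: "real N \<ge> 1" using elim by simp
    define L where "L = K * real N powr (2 - c)"
    have L: "L \<ge> 0" using K by (simp add: L_def)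
    have "real (card (equal_gaps (floor_power c) {N<..N + m N})) \<le> (real (m N))\<^sup>2 + 2 * (real (m N) * (L * harm (m N)))"
      using elim equal_gaps_product_le[OF c] unfolding L_def K_def
      by (intro card_equal_gaps_le) (use L in \<open>auto simp: L_def K_def\<close>)
    also have "\<dots> \<le> M\<^sup>2 + 2 * (M * (L * (1 + ln (real N))))"
    proof -
      have "harm (m N) - ln (real (m N)) \<le> harm 1 - ln (real 1)"
        using elim by (intro euler_mascheroni_sequence_decreasing) auto
      then have "harm (m N) \<le> 1 + ln (real (m N))" by (simp add: harm_def)
      also have "\<dots> \<le> 1 + ln (real N)" using elim by simp
      finally have "M * (L * harm (m N)) \<le> M * (L * (1 + ln (real N)))"
        using L M by (intro mult_left_mono) auto
      then show ?thesis by (simp add: M_def)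
    qed
    finally have eq_le: "real (card (equal_gaps (floor_power c) {N<..N + m N})) \<le> M\<^sup>2 + 2 * (M * (L * (1 + ln (real N))))" .
    have "energy (floor_power c) {N<..N + m N} \<le> (card {N<..N + m N})\<^sup>2
      + 2 * card (equal_gaps (floor_power c) {N<..N + m N}) + 4 * card (unequal_gaps (floor_power c) {N<..N + m N})"
      by (rule energy_le_gaps) (auto intro!: strict_mono_onI strict_monoD[OF strict_mono_floor_power[OF c]])
    then have "real (energy (floor_power c) {N<..N + m N}) \<le> real ((card {N<..N + m N})\<^sup>2
      + 2 * card (equal_gaps (floor_power c) {N<..N + m N}) + 4 * card (unequal_gaps (floor_power c) {N<..N + m N}))"
      by (rule of_nat_mono)
    then have "real (energy (floor_power c) {N<..N + m N}) \<le> M\<^sup>2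
      + 2 * real (card (equal_gaps (floor_power c) {N<..N + m N})) + 4 * real (card (unequal_gaps (floor_power c) {N<..N + m N}))"
      by (simp add: M_def)
    also have "\<dots> \<le> M\<^sup>2 + 2 * (M\<^sup>2 + 2 * (M * (L * (1 + ln (real N))))) + 4 * (C * M\<^sup>2)"
      using eq_le elim(3) unfolding M_def by (intro add_mono mult_left_mono order_refl) auto
    also have "\<dots> = (3 + 4 * C) * M\<^sup>2 + 4 * (M * (L * (1 + ln (real N))))"
      by (simp add: algebra_simps)
    finally have E: "real (energy (floor_power c) {N<..N + m N}) \<le> (3 + 4 * C) * M\<^sup>2 + 4 * (M * (L * (1 + ln (real N))))" .
    define X where "X = real N powr (2 * \<tau> - \<epsilon>)"
    have X: "X \<ge> 0" by (simp add: X_def)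
    have first: "2 * ((3 + 4 * C) * M\<^sup>2) * X \<le> M ^ 3 / 2"
    proof -
      define Y where "Y = (3 + 4 * C) * X"
      have "16 * Y \<le> real N powr \<epsilon> * X"
        using elim X mult_right_mono[of "16 * (3 + 4 * C)" "real N powr \<epsilon>" X] unfolding Y_def by (simp only: mult.assoc)
      also have "\<dots> = real N powr (2 * \<tau>)" unfolding X_def powr_add[symmetric] by simp
      also have "\<dots> \<le> real N powr \<theta>" using \<tau> N by (intro powr_mono) auto
      also have "\<dots> \<le> 4 * M" by fact
      finally have "4 * Y \<le> M" by simp
      then have "M\<^sup>2 * (4 * Y) / 2 \<le> M\<^sup>2 * M / 2" by (intro divide_right_mono mult_left_mono) auto
      moreover have "2 * ((3 + 4 * C) * M\<^sup>2) * X = M\<^sup>2 * (4 * Y) / 2" by (simp add: Y_def)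
      moreover have "M\<^sup>2 * M = M ^ 3" by (simp add: power3_eq_cube power2_eq_square)
      ultimately show ?thesis by (simp only:)
    qed
    have second: "2 * (4 * (M * (L * (1 + ln (real N))))) * X \<le> M ^ 3 / 2"
    proof -
      define Y where "Y = L * (1 + ln (real N)) * X"
      have "256 * Y = 256 * K * (1 + ln (real N)) * (real N powr (2 - c) * X)"
        unfolding Y_def L_def by (simp only: mult_ac)
      also have "\<dots> \<le> real N powr \<epsilon> * (real N powr (2 - c) * X)"
        using elim X by (intro mult_right_mono) auto
      also have "\<dots> = real N powr (2 - c + 2 * \<tau>)"
        unfolding X_def powr_add[symmetric] by (simp add: algebra_simps)
      also have "\<dots> \<le> real N powr (2 * \<theta>)" using \<tau> N by (intro powr_mono) auto
      also have "\<dots> = (real N powr \<theta>)\<^sup>2" by (simp add: power2_eq_square powr_add[symmetric])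
      also have "\<dots> \<le> (4 * M)\<^sup>2" using M by (intro power_mono) auto
      also have "(4 * M)\<^sup>2 = 16 * M\<^sup>2" by simp
      finally have "16 * Y \<le> M\<^sup>2" by simp
      then have "M * (16 * Y) / 2 \<le> M * M\<^sup>2 / 2" using M by (intro divide_right_mono mult_left_mono) auto
      moreover have "2 * (4 * (M * (L * (1 + ln (real N))))) * X = M * (16 * Y) / 2" by (simp add: Y_def)
      moreover have "M * M\<^sup>2 = M ^ 3" by (simp add: power3_eq_cube power2_eq_square)
      ultimately show ?thesis by (simp only:)
    qed
    have "2 * real (energy (floor_power c) {N<..N + m N}) * X \<le> 2 * ((3 + 4 * C) * M\<^sup>2 + 4 * (M * (L * (1 + ln (real N))))) * X"
      using E X by (intro mult_right_mono mult_left_mono) auto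
    also have "\<dots> = 2 * ((3 + 4 * C) * M\<^sup>2) * X + 2 * (4 * (M * (L * (1 + ln (real N))))) * X"
      by (simp add: algebra_simps)
    also have "\<dots> \<le> M ^ 3" using first second by linarith
    finally show ?case by (simp add: X_def M_def)
  qed
qed

text \<open>Halving the block length ensures 4 m^2 <= N when \<theta> = 1/2.\<close>

lemma AE_floor_power_Omega:
  fixes c \<theta> \<tau> C :: real
  defines "m \<equiv> \<lambda>N. nat \<lfloor>real N powr \<theta> / 2\<rfloor>"
  assumes c: "c > 1" and \<theta>: "0 < \<theta>" "\<theta> < 1" and \<tau>: "2 * \<tau> \<le> \<theta>" "2 - c + 2 * \<tau> \<le> 2 * \<theta>"
    and unequal: "\<forall>\<^sub>F N in sequentially. real (card (unequal_gaps (floor_power c) {N<..N + m N})) \<le> C * (real (m N))\<^sup>2"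
  shows "AE \<alpha> in lebesgue. \<forall>\<epsilon>>0. Omega_infinitely_often
    (\<lambda>N. real N * star_discrepancy (\<lambda>n. frac (real_of_int (floor_power c n) * \<alpha>)) N) (\<lambda>N. real N powr (\<tau> - \<epsilon>))"
proof (rule AE_star_discrepancy_Omega)
  have ev: "\<forall>\<^sub>F N in sequentially. 4 \<le> real N powr \<theta>" using \<theta> by (intro eventually_ge_powr)
  have m_bounds: "1 \<le> m N \<and> m N \<le> N \<and> real N powr \<theta> \<le> 4 * real (m N)" if "4 \<le> real N powr \<theta>" "N \<ge> 1" for N
  proof -
    have "real N powr \<theta> \<le> real N powr 1" using that \<theta> by (intro powr_mono) auto
    then have "real N powr \<theta> / 2 \<le> N" using that by simp
    moreover have "real (m N) \<le> real N powr \<theta> / 2" "real N powr \<theta> / 2 < real (m N) + 1"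
      unfolding m_def using that by linarith+
    ultimately show ?thesis using that by linarith
  qed
  show m: "\<forall>\<^sub>F N in sequentially. 1 \<le> m N \<and> m N \<le> N"
    using ev eventually_ge_at_top[of 1] by eventually_elim (use m_bounds in auto)
  show "\<forall>\<^sub>F N in sequentially. inj_on (floor_power c) {N<..N + m N}"
    by (intro always_eventually allI strict_mono_on_imp_inj_on)
       (auto intro!: strict_mono_onI strict_monoD[OF strict_mono_floor_power[OF c]])
  show "\<forall>\<^sub>F N in sequentially. \<forall>n\<in>{N<..N + m N}. \<bar>floor_power c n\<bar> \<le> int N ^ nat \<lceil>2 * c\<rceil>"
    using m eventually_ge_at_top[of 2]
  proof eventually_elim
    case (elim N)
    show ?case
    proof
      fix n assume n: "n \<in> {N<..N + m N}"
      \<comment> \<open>The crude bound n <= N^2 suffices, because the size of the frequencies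
        enters only through a logarithm.\<close>
      have "real n \<le> 2 * real N" using n elim by auto
      also have "\<dots> \<le> real N powr 2" using elim by (simp add: power2_eq_square)
      finally have "real n powr c \<le> (real N powr 2) powr c" using c by (intro powr_mono2) auto
      also have "\<dots> = real N powr (2 * c)" by (simp only: powr_powr)
      also have "\<dots> \<le> real N powr (real (nat \<lceil>2 * c\<rceil>))" using elim c by (intro powr_mono) linarith+
      also have "\<dots> = real N ^ nat \<lceil>2 * c\<rceil>" using elim by (intro powr_realpow) simp
      finally have "real_of_int (floor_power c n) \<le> real_of_int (int N ^ nat \<lceil>2 * c\<rceil>)"
        using floor_power_bounds[of c n] by simp
      then have "floor_power c n \<le> int N ^ nat \<lceil>2 * c\<rceil>" by (simp only: of_int_le_iff)
      moreover have "floor_power c n \<ge> 0" by (simp add: floor_power_def)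
      ultimately show "\<bar>floor_power c n\<bar> \<le> int N ^ nat \<lceil>2 * c\<rceil>" by simp
    qed
  qed
  fix \<epsilon> :: real assume "\<epsilon> > 0"
  show "\<forall>\<^sub>F N in sequentially. 2 * energy (floor_power c) {N<..N + m N} * real N powr (2 * \<tau> - \<epsilon>) \<le> real (m N) ^ 3"
  proof (rule energy_floor_power_le[OF c \<tau> \<open>\<epsilon> > 0\<close> m _ unequal])
    show "\<forall>\<^sub>F N in sequentially. real N powr \<theta> \<le> 4 * real (m N)"
      using ev eventually_ge_at_top[of 1] by eventually_elim (use m_bounds in auto)
  qed
qed

theorem corollary2:
  fixes c :: real
  assumes "c > 1"
  shows "AE \<alpha> in lebesgue. \<forall>\<epsilon>>0.
    Omega_infinitely_often
      (\<lambda>N. real N * star_discrepancy (\<lambda>n. frac (real_of_int (floor_power c n) * \<alpha>)) N)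
      (\<lambda>N. real N powr (tau c - \<epsilon>))"
proof (cases "c < 2")
  case True
  define m where "m N = nat \<lfloor>real N powr (1 / 2) / 2\<rfloor>" for N
  have "\<forall>\<^sub>F N in sequentially. 8 / 3 \<le> real N powr (c - 1)"
    using assms by (intro eventually_ge_powr) simp
  then have "\<forall>\<^sub>F N in sequentially. real (card (unequal_gaps (floor_power c) {N<..N + m N})) \<le> 0 * (real (m N))\<^sup>2"
    using eventually_ge_at_top[of 1]
  proof eventually_elim
    case (elim N)
    have "real (m N) \<le> real N powr (1 / 2) / 2" unfolding m_def by (intro of_nat_floor) simp
    then have "(real (m N))\<^sup>2 \<le> (real N powr (1 / 2) / 2)\<^sup>2" by (intro power_mono) auto
    also have "\<dots> = real N / 4" by (simp add: power_divide powr_half_sqrt)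
    finally have "4 * (real (m N))\<^sup>2 \<le> real N" by simp
    moreover have "1 * (8 / 3) \<le> c * real N powr (c - 1)" using elim assms by (intro mult_mono) auto
    ultimately show ?case using unequal_gaps_empty[of c N "m N"] assms True elim by simp
  qed
  \<comment> \<open>For c < 3/2 the second condition is an equality, for c >= 3/2 the first; this is
    the case distinction of \<open>tau\<close> below 2.\<close>
  moreover have "2 * tau c \<le> 1 / 2" "2 - c + 2 * tau c \<le> 2 * (1 / 2)"
    using assms True by (auto simp: tau_def field_simps)
  ultimately show ?thesis
    using assms unfolding m_def by (intro AE_floor_power_Omega[where \<theta> = "1 / 2" and C = 0]) auto
next
  case False
  then have c: "c \<ge> 2" by simp
  \<comment> \<open>The exponent is 2 * 7/26, so that \<theta> / 2 is the required \<tau>. It lies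
    between 1/3, required by m^3 >= N, and 3/5, the limit set by m^5 <= N^3.\<close>
  define m where "m N = nat \<lfloor>real N powr (7 / 13) / 2\<rfloor>" for N
  obtain C \<eta> :: real where "\<eta> > 0" and
    bound: "\<And>N m :: nat. \<lbrakk>N \<ge> 1; real m \<le> \<eta> * N; real m ^ 3 \<ge> N; real m ^ 3 \<le> \<eta> * (real N)\<^sup>2; real m ^ 5 \<le> real N ^ 3\<rbrakk>
      \<Longrightarrow> real (card (unequal_gaps (floor_power c) {N<..N + m})) \<le> C * (real m)\<^sup>2"
    by (rule card_unequal_gaps_le[OF c]) blast
  have "\<forall>\<^sub>F N in sequentially. real N powr (7 / 13) / 2 \<le> \<eta> * N"
    "\<forall>\<^sub>F N in sequentially. (real N powr (7 / 13) / 2) ^ 3 \<le> \<eta> * (real N)\<^sup>2"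
    "\<forall>\<^sub>F N in sequentially. real N \<le> (real N powr (7 / 13) / 2 - 1) ^ 3"
    "\<forall>\<^sub>F N in sequentially. (real N powr (7 / 13) / 2) ^ 5 \<le> real N ^ 3"
    "\<forall>\<^sub>F N in sequentially. 1 \<le> real N powr (7 / 13) / 2"
    using \<open>\<eta> > 0\<close> by real_asymp+
  then have "\<forall>\<^sub>F N in sequentially. real (card (unequal_gaps (floor_power c) {N<..N + m N})) \<le> C * (real (m N))\<^sup>2"
    using eventually_ge_at_top[of 1]
  proof eventually_elim
    case (elim N)
    define u where "u = real N powr (7 / 13) / 2"
    have u: "real (m N) \<le> u" "u - 1 \<le> real (m N)" "0 \<le> u - 1"
      unfolding m_def u_def using elim by linarith+
    have "real (m N) ^ 3 \<le> u ^ 3" "real (m N) ^ 5 \<le> u ^ 5" "(u - 1) ^ 3 \<le> real (m N) ^ 3"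
      using u by (auto intro!: power_mono)
    then show ?case using elim u(1) unfolding u_def[symmetric] by (intro bound) linarith+
  qed
  moreover have "2 * tau c \<le> 7 / 13" "2 - c + 2 * tau c \<le> 2 * (7 / 13)"
    using c by (auto simp: tau_def)
  ultimately show ?thesis
    using assms unfolding m_def by (intro AE_floor_power_Omega[of c "7 / 13"]) auto
qed

end
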